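(* Let $A$ be a bialgebra over a field $k$ and let $V,W$ be $k$-linear spaces. Regard $V\otimes A$ and $W\otimes A$ as left-right Hopf modules over $A$ with action $a\cdot(v\otimes b)=v\otimes ab$ and coaction $v\otimes a\mapsto\sum v\otimes a_1\otimes a_2$ (and likewise for $W$). Let $H^*(M,N)$, for left-right Hopf modules $M,N$ over $A$, be the cohomology of the total complex of the double complex $(C^{n,p}(M,N),d_m^{n,p},d_c^{n,p})_{n,p\ge 0}$ defined in the context. Then $H^{p+1}(V\otimes A,\,W\otimes A)=0$ for all $p\ge 0$.
   Context: $k$ is a field, all linear spaces, tensor products and Homs are over $k$; $A^n$ denotes $A^{\otimes n}$ with $A^0=k$. Sweedler notation: $\Delta(a)=\sum a_1\otimes a_2$, iterated $\sum a_1\otimes\cdots\otimes a_{r}$. A left-right Hopf module over a bialgebra $A$ is a $k$-space $M$ that is a left $A$-module ($a\otimes m\mapsto a\cdot m$) and a right $A$-comodule ($\rho_M(m)=\sum m_0\otimes m_1\in M\otimes A$) with $\sum (a\cdot m)_0\otimes (a\cdot m)_1=\sum a_1\cdot m_0\otimes a_2m_1$ for all $a\in A$, $m\in M$. $C^{n,p}(M,N)=\mathrm{Hom}(A^n\otimes M,N\otimes A^p)$ for $n,p\ge0$. For $f\in C^{n,p}(M,N)$ write $f(x)=\sum f(x)^0\otimes f(x)^1\otimes\cdots\otimes f(x)^p$ with $f(x)^0\in N$ and $f(x)^j\in A$ for $j\ge1$. Superscripts on $a^1,\dots,a^n\in A$ are indices. Maps $b_i^{n,p}:C^{n,p}\to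 C^{n+1,p}$, $0\le i\le n+1$: - $b_0^{n,p}(f)(a^1\otimes\cdots\otimes a^{n+1}\otimes m)=\sum (a^1)_1\cdot f(x)^0\otimes (a^1)_2f(x)^1\otimes\cdots\otimes(a^1)_{p+1}f(x)^p$, with $x=a^2\otimes\cdots\otimes a^{n+1}\otimes m$; - $b_i^{n,p}(f)(a^1\otimes\cdots\otimes a^{n+1}\otimes m)=f(a^1\otimes\cdots\otimes a^ia^{i+1}\otimes\cdots\otimes a^{n+1}\otimes m)$ for $1\le i\le n$; - $b_{n+1}^{n,p}(f)(a^1\otimes\cdots\otimes a^{n+1}\otimes m)=f(a^1\otimes\cdots\otimes a^n\otimes a^{n+1}\cdot m)$. Maps $c_i^{n,p}:C^{n,p}\to C^{n,p+1}$, $0\le i\le p+1$: - $c_0^{n,p}(f)(x)=\sum (f(x)^0)_0\otimes (f(x)^0)_1\otimes f(x)^1\otimes\cdots\otimes f(x)^p$; - for $1\le i\le p$, $c_i^{n,p}(f)(x)=\sum f(x)^0\otimes\cdots\otimes (f(x)^i)_1\otimes(f(x)^i)_2\otimes\cdots\otimes f(x)^p$ ($\Delta$ applied to the $i$-th $A$-factor); - $c_{p+1}^{n,p}(f)(a^1\otimes\cdots\otimes a^n\otimes m)=\sum f((a^1)_1\otimes\cdots\otimes(a^n)_1\otimes m_0)\otimes (a^1)_2\cdots(a^n)_2m_1$. (Empty products, when $n=0$, equal $1$.) $d_m^{n,p}=\sum_{i=0}^{n+1}(-1)^ib_i^{n,p}$ and $d_c^{n,p}=\sum_{i=0}^{p+1}(-1)^ic_i^{n,p}$.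 These satisfy $d_md_m=0$, $d_cd_c=0$, $d_cd_m=d_md_c$. The total complex has degree-$r$ term $\bigoplus_{n+p=r}C^{n,p}(M,N)$ and differential $d_m^{n,p}+(-1)^nd_c^{n,p}$ on $C^{n,p}(M,N)$. *)

theory Defs
  imports "HOL-Algebra.Module" "HOL-Algebra.AbelCoset" "HOL-Library.FuncSet" "HOL.Hull"
begin

section \<open>Vector spaces\<close>

text \<open>
  A vector space over a field \<^term>\<open>K\<close> is a \<^term>\<open>M\<close> with \<^term>\<open>module K M\<close>, in the sense of
  the session HOL-Algebra.  The record type of modules extends the one of rings; for the
  vector spaces constructed here the two multiplicative fields carry no information and are
  left unspecified.
\<close>

definition quot_module ::
    "('k, 'm, 'r) module_scheme \<Rightarrow> 'm set \<Rightarrow> ('k, 'm set) module"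
  where "quot_module M H =
    \<lparr> carrier = a_rcosets\<^bsub>M\<^esub> H, mult = undefined, one = undefined,
      zero = H, add = (\<lambda>S T. S <+>\<^bsub>M\<^esub> T),
      smult = (\<lambda>k S. \<Union>x\<in>S. H +>\<^bsub>M\<^esub> (k \<odot>\<^bsub>M\<^esub> x)) \<rparr>"

definition prod_module ::
    "'i set \<Rightarrow> ('i \<Rightarrow> ('k, 'm, 'r) module_scheme) \<Rightarrow> ('k, 'i \<Rightarrow> 'm) module"
  where "prod_module I X =
    \<lparr> carrier = (\<Pi>\<^sub>E i\<in>I. carrier (X i)), mult = undefined, one = undefined,
      zero = (\<lambda>i\<in>I. \<zero>\<^bsub>X i\<^esub>), add = (\<lambda>f g. \<lambda>i\<in>I. f i \<oplus>\<^bsub>X i\<^esub> g i),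
      smult = (\<lambda>k f. \<lambda>i\<in>I. k \<odot>\<^bsub>X i\<^esub> f i) \<rparr>"

definition linear_map ::
    "('k, 'q) ring_scheme \<Rightarrow> ('k, 'm, 'r) module_scheme \<Rightarrow> ('k, 'n, 's) module_scheme
      \<Rightarrow> ('m \<Rightarrow> 'n) \<Rightarrow> bool"
  where "linear_map K X Y f \<longleftrightarrow>
    f \<in> carrier X \<rightarrow> carrier Y \<and>
    (\<forall>x\<in>carrier X. \<forall>y\<in>carrier X. f (x \<oplus>\<^bsub>X\<^esub> y) = f x \<oplus>\<^bsub>Y\<^esub> f y) \<and>
    (\<forall>k\<in>carrier K. \<forall>x\<in>carrier X. f (k \<odot>\<^bsub>X\<^esub> x) = k \<odot>\<^bsub>Y\<^esub> f x)"

text \<open>Linear maps are made extensional, so that equality in \<open>hom_module\<close> is equality of maps.\<close>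

definition hom_module ::
    "('k, 'q) ring_scheme \<Rightarrow> ('k, 'm, 'r) module_scheme \<Rightarrow> ('k, 'n, 's) module_scheme
      \<Rightarrow> ('k, 'm \<Rightarrow> 'n) module"
  where "hom_module K X Y =
    \<lparr> carrier = {f \<in> extensional (carrier X). linear_map K X Y f}, mult = undefined, one = undefined,
      zero = (\<lambda>x\<in>carrier X. \<zero>\<^bsub>Y\<^esub>), add = (\<lambda>f g. \<lambda>x\<in>carrier X. f x \<oplus>\<^bsub>Y\<^esub> g x),
      smult = (\<lambda>k f. \<lambda>x\<in>carrier X. k \<odot>\<^bsub>Y\<^esub> f x) \<rparr>"

definition free_module :: "('k, 'q) ring_scheme \<Rightarrow> 'g set \<Rightarrow> ('k, 'g \<Rightarrow> 'k) module"
  where "free_module K G =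
    \<lparr> carrier = {u. (\<forall>g. u g \<in> carrier K) \<and> finite {g. u g \<noteq> \<zero>\<^bsub>K\<^esub>} \<and> {g. u g \<noteq> \<zero>\<^bsub>K\<^esub>} \<subseteq> G},
      mult = undefined, one = undefined,
      zero = (\<lambda>g. \<zero>\<^bsub>K\<^esub>), add = (\<lambda>u v g. u g \<oplus>\<^bsub>K\<^esub> v g), smult = (\<lambda>k u g. k \<otimes>\<^bsub>K\<^esub> u g) \<rparr>"

definition free_gen :: "('k, 'q) ring_scheme \<Rightarrow> 'g \<Rightarrow> 'g \<Rightarrow> 'k"
  where "free_gen K g = (\<lambda>h. if h = g then \<one>\<^bsub>K\<^esub> else \<zero>\<^bsub>K\<^esub>)"


section \<open>Tensor products\<close>

text \<open>
  A tensor product is the free vector space on the tuples of vectors, modulo the subspace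
  generated by the relations expressing multilinearity.  \<open>slot_rels K F X I\<close> are the
  relations for one factor \<open>X\<close>; every \<open>\<iota> \<in> I\<close> maps \<open>x \<in> X\<close> to the tuple with \<open>x\<close> in that
  factor and fixed vectors in all other ones.
\<close>

type_synonym ('g, 'k) tensors = "('g \<Rightarrow> 'k) set"

definition slot_rels ::
    "('k, 'q) ring_scheme \<Rightarrow> ('k, 'g \<Rightarrow> 'k) module \<Rightarrow> ('k, 'x, 'r) module_scheme
      \<Rightarrow> ('x \<Rightarrow> 'g) set \<Rightarrow> ('g \<Rightarrow> 'k) set"
  where "slot_rels K F X I =
    {free_gen K (\<iota> (x \<oplus>\<^bsub>X\<^esub> y)) \<ominus>\<^bsub>F\<^esub> (free_gen K (\<iota> x) \<oplus>\<^bsub>F\<^esub> free_gen K (\<iota> y))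
       | \<iota> x y. \<iota> \<in> I \<and> x \<in> carrier X \<and> y \<in> carrier X} \<union>
    {free_gen K (\<iota> (k \<odot>\<^bsub>X\<^esub> x)) \<ominus>\<^bsub>F\<^esub> k \<odot>\<^bsub>F\<^esub> free_gen K (\<iota> x)
       | \<iota> k x. \<iota> \<in> I \<and> k \<in> carrier K \<and> x \<in> carrier X}"

definition rel_span :: "('k, 'q) ring_scheme \<Rightarrow> 'g set \<Rightarrow> ('g \<Rightarrow> 'k) set \<Rightarrow> ('g \<Rightarrow> 'k) set"
  where "rel_span K G R = (\<lambda>H. submodule H K (free_module K G)) hull R"

definition presented ::
    "('k, 'q) ring_scheme \<Rightarrow> 'g set \<Rightarrow> ('g \<Rightarrow> 'k) set \<Rightarrow> ('k, ('g, 'k) tensors) module"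
  where "presented K G R = quot_module (free_module K G) (rel_span K G R)"

definition presented_gen ::
    "('k, 'q) ring_scheme \<Rightarrow> 'g set \<Rightarrow> ('g \<Rightarrow> 'k) set \<Rightarrow> 'g \<Rightarrow> ('g, 'k) tensors"
  where "presented_gen K G R g = rel_span K G R +>\<^bsub>free_module K G\<^esub> free_gen K g"

definition words :: "('k, 'a, 'r) module_scheme \<Rightarrow> nat \<Rightarrow> 'a list set"
  where "words A n = {as. length as = n \<and> set as \<subseteq> carrier A}"

text \<open>The tensor product \<open>V \<otimes> W\<close> and its elements \<open>v \<otimes> w\<close>.\<close>

definition ten_rels ::
    "('k, 'q) ring_scheme \<Rightarrow> ('k, 'v, 'r) module_scheme \<Rightarrow> ('k, 'w, 's) module_scheme
      \<Rightarrow> ('v \<times> 'w \<Rightarrow> 'k) set"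
  where "ten_rels K V W =
    (let F = free_module K (carrier V \<times> carrier W) in
      slot_rels K F V {\<lambda>v. (v, w) | w. w \<in> carrier W} \<union>
      slot_rels K F W {\<lambda>w. (v, w) | v. v \<in> carrier V})"

definition tensor ::
    "('k, 'q) ring_scheme \<Rightarrow> ('k, 'v, 'r) module_scheme \<Rightarrow> ('k, 'w, 's) module_scheme
      \<Rightarrow> ('k, ('v \<times> 'w, 'k) tensors) module"
  where "tensor K V W = presented K (carrier V \<times> carrier W) (ten_rels K V W)"

definition ten ::
    "('k, 'q) ring_scheme \<Rightarrow> ('k, 'v, 'r) module_scheme \<Rightarrow> ('k, 'w, 's) module_scheme
      \<Rightarrow> 'v \<Rightarrow> 'w \<Rightarrow> ('v \<times> 'w, 'k) tensors"
  where "ten K V W v w = presented_gen K (carrier V \<times> carrier W) (ten_rels K V W) (v, w)"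

text \<open>
  The tensor product \<open>A\<^sup>n \<otimes> M\<close> of \<open>n\<close> copies of \<open>A\<close> with \<open>M\<close>; the elements
  \<open>a\<^sup>1 \<otimes> \<dots> \<otimes> a\<^sup>n \<otimes> m\<close> are \<open>tenl K A n M [a\<^sup>1, \<dots>, a\<^sup>n] m\<close>.
\<close>

definition tenl_rels ::
    "('k, 'q) ring_scheme \<Rightarrow> ('k, 'a, 'r) module_scheme \<Rightarrow> nat \<Rightarrow> ('k, 'm, 's) module_scheme
      \<Rightarrow> ('a list \<times> 'm \<Rightarrow> 'k) set"
  where "tenl_rels K A n M =
    (let F = free_module K (words A n \<times> carrier M) in
      slot_rels K F A {\<lambda>a. (as[i := a], m) | as i m. as \<in> words A n \<and> i < n \<and> m \<in> carrier M} \<union>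
      slot_rels K F M {\<lambda>m. (as, m) | as. as \<in> words A n})"

definition tensorl ::
    "('k, 'q) ring_scheme \<Rightarrow> ('k, 'a, 'r) module_scheme \<Rightarrow> nat \<Rightarrow> ('k, 'm, 's) module_scheme
      \<Rightarrow> ('k, ('a list \<times> 'm, 'k) tensors) module"
  where "tensorl K A n M = presented K (words A n \<times> carrier M) (tenl_rels K A n M)"

definition tenl ::
    "('k, 'q) ring_scheme \<Rightarrow> ('k, 'a, 'r) module_scheme \<Rightarrow> nat \<Rightarrow> ('k, 'm, 's) module_scheme
      \<Rightarrow> 'a list \<Rightarrow> 'm \<Rightarrow> ('a list \<times> 'm, 'k) tensors"
  where "tenl K A n M as m = presented_gen K (words A n \<times> carrier M) (tenl_rels K A n M) (as, m)"

text \<open>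
  The tensor product \<open>N \<otimes> A\<^sup>p\<close> of \<open>N\<close> with \<open>p\<close> copies of \<open>A\<close>; the elements
  \<open>n \<otimes> a\<^sup>1 \<otimes> \<dots> \<otimes> a\<^sup>p\<close> are \<open>tenr K N A p n [a\<^sup>1, \<dots>, a\<^sup>p]\<close>.
\<close>

definition tenr_rels ::
    "('k, 'q) ring_scheme \<Rightarrow> ('k, 'n, 's) module_scheme \<Rightarrow> ('k, 'a, 'r) module_scheme \<Rightarrow> nat
      \<Rightarrow> ('n \<times> 'a list \<Rightarrow> 'k) set"
  where "tenr_rels K N A p =
    (let F = free_module K (carrier N \<times> words A p) in
      slot_rels K F N {\<lambda>n. (n, as) | as. as \<in> words A p} \<union>
      slot_rels K F A {\<lambda>a. (n, as[i := a]) | n as i. n \<in> carrier N \<and> as \<in> words A p \<and> i < p})"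

definition tensorr ::
    "('k, 'q) ring_scheme \<Rightarrow> ('k, 'n, 's) module_scheme \<Rightarrow> ('k, 'a, 'r) module_scheme \<Rightarrow> nat
      \<Rightarrow> ('k, ('n \<times> 'a list, 'k) tensors) module"
  where "tensorr K N A p = presented K (carrier N \<times> words A p) (tenr_rels K N A p)"

definition tenr ::
    "('k, 'q) ring_scheme \<Rightarrow> ('k, 'n, 's) module_scheme \<Rightarrow> ('k, 'a, 'r) module_scheme \<Rightarrow> nat
      \<Rightarrow> 'n \<Rightarrow> 'a list \<Rightarrow> ('n \<times> 'a list, 'k) tensors"
  where "tenr K N A p n as = presented_gen K (carrier N \<times> words A p) (tenr_rels K N A p) (n, as)"

text \<open>
  For \<open>n = 0\<close> or \<open>p = 0\<close> the only word is the empty list, so \<open>A\<^sup>0 \<otimes> M\<close> and \<open>N \<otimes> A\<^sup>0\<close>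
  are copies of \<open>M\<close> and \<open>N\<close>.

  Sweedler sums: if \<open>t = \<Sum> x\<^sub>1 \<otimes> x\<^sub>2\<close>, then \<open>sweedler K X t (\<lambda>(x\<^sub>1, x\<^sub>2). \<phi> x\<^sub>1 x\<^sub>2)\<close> is
  \<open>\<Sum> \<phi> x\<^sub>1 x\<^sub>2\<close> in \<open>X\<close>, and likewise for more factors.  The value does not depend on the
  representative of \<open>t\<close> when \<open>\<phi>\<close> is multilinear.
\<close>

definition free_lift ::
    "('k, 'q) ring_scheme \<Rightarrow> ('k, 'x, 'r) module_scheme \<Rightarrow> ('g \<Rightarrow> 'x) \<Rightarrow> ('g \<Rightarrow> 'k) \<Rightarrow> 'x"
  where "free_lift K X \<phi> u = (\<Oplus>\<^bsub>X\<^esub> g \<in> {g. u g \<noteq> \<zero>\<^bsub>K\<^esub>}. u g \<odot>\<^bsub>X\<^esub> \<phi> g)"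

definition sweedler ::
    "('k, 'q) ring_scheme \<Rightarrow> ('k, 'x, 'r) module_scheme \<Rightarrow> ('g, 'k) tensors \<Rightarrow> ('g \<Rightarrow> 'x) \<Rightarrow> 'x"
  where "sweedler K X t \<phi> = free_lift K X \<phi> (SOME u. u \<in> t)"


section \<open>Bialgebras and left-right Hopf modules\<close>

record ('k, 'a) bialg = "('k, 'a) module" +
  comult :: "'a \<Rightarrow> ('a \<times> 'a, 'k) tensors"
  counit :: "'a \<Rightarrow> 'k"

text \<open>Coassociativity is stated in \<open>A \<otimes> A \<otimes> A\<close>, that is, in \<open>tensorr K A A 2\<close>.\<close>

locale bialgebra = K: field K + A: ring A + module K A
  for K :: "('k, 'q) ring_scheme" and A :: "('k, 'a, 'r) bialg_scheme" +
  assumes smult_mult_left: "\<lbrakk>k \<in> carrier K; a \<in> carrier A; b \<in> carrier A\<rbrakk>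
      \<Longrightarrow> (k \<odot>\<^bsub>A\<^esub> a) \<otimes>\<^bsub>A\<^esub> b = k \<odot>\<^bsub>A\<^esub> (a \<otimes>\<^bsub>A\<^esub> b)"
    and smult_mult_right: "\<lbrakk>k \<in> carrier K; a \<in> carrier A; b \<in> carrier A\<rbrakk>
      \<Longrightarrow> a \<otimes>\<^bsub>A\<^esub> (k \<odot>\<^bsub>A\<^esub> b) = k \<odot>\<^bsub>A\<^esub> (a \<otimes>\<^bsub>A\<^esub> b)"
    and comult_linear: "linear_map K A (tensor K A A) (comult A)"
    and coassoc: "a \<in> carrier A \<Longrightarrow>
      sweedler K (tensorr K A A 2) (comult A a) (\<lambda>(x, y).
        sweedler K (tensorr K A A 2) (comult A x) (\<lambda>(x1, x2). tenr K A A 2 x1 [x2, y])) =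
      sweedler K (tensorr K A A 2) (comult A a) (\<lambda>(x, y).
        sweedler K (tensorr K A A 2) (comult A y) (\<lambda>(y1, y2). tenr K A A 2 x [y1, y2]))"
    and counit_ring_hom: "counit A \<in> ring_hom A K"
    and counit_smult: "\<lbrakk>k \<in> carrier K; a \<in> carrier A\<rbrakk>
      \<Longrightarrow> counit A (k \<odot>\<^bsub>A\<^esub> a) = k \<otimes>\<^bsub>K\<^esub> counit A a"
    and counit_left: "a \<in> carrier A \<Longrightarrow>
      sweedler K A (comult A a) (\<lambda>(x, y). counit A x \<odot>\<^bsub>A\<^esub> y) = a"
    and counit_right: "a \<in> carrier A \<Longrightarrow>
      sweedler K A (comult A a) (\<lambda>(x, y). counit A y \<odot>\<^bsub>A\<^esub> x) = a"
    and comult_mult: "\<lbrakk>a \<in> carrier A; b \<in> carrier A\<rbrakk> \<Longrightarrow>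
      comult A (a \<otimes>\<^bsub>A\<^esub> b) =
      sweedler K (tensor K A A) (comult A a) (\<lambda>(a1, a2).
        sweedler K (tensor K A A) (comult A b) (\<lambda>(b1, b2).
          ten K A A (a1 \<otimes>\<^bsub>A\<^esub> b1) (a2 \<otimes>\<^bsub>A\<^esub> b2)))"
    and comult_one: "comult A \<one>\<^bsub>A\<^esub> = ten K A A \<one>\<^bsub>A\<^esub> \<one>\<^bsub>A\<^esub>"

record ('k, 'm, 'a) hmod = "('k, 'm) module" +
  act :: "'a \<Rightarrow> 'm \<Rightarrow> 'm"
  coact :: "'m \<Rightarrow> ('m \<times> 'a, 'k) tensors"

locale hopf_module = bialgebra K A + M: module K M
  for K :: "('k, 'q) ring_scheme" and A :: "('k, 'a, 'r) bialg_scheme"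
    and M :: "('k, 'm, 'a, 's) hmod_scheme" +
  assumes act_linear: "a \<in> carrier A \<Longrightarrow> linear_map K M M (act M a)"
    and act_linear_left: "m \<in> carrier M \<Longrightarrow> linear_map K A M (\<lambda>a. act M a m)"
    and act_one: "m \<in> carrier M \<Longrightarrow> act M \<one>\<^bsub>A\<^esub> m = m"
    and act_mult: "\<lbrakk>a \<in> carrier A; b \<in> carrier A; m \<in> carrier M\<rbrakk>
      \<Longrightarrow> act M (a \<otimes>\<^bsub>A\<^esub> b) m = act M a (act M b m)"
    and coact_linear: "linear_map K M (tensor K M A) (coact M)"
    and coact_coassoc: "m \<in> carrier M \<Longrightarrow>
      sweedler K (tensorr K M A 2) (coact M m) (\<lambda>(x, y).
        sweedler K (tensorr K M A 2) (coact M x) (\<lambda>(x0, x1). tenr K M A 2 x0 [x1, y])) =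
      sweedler K (tensorr K M A 2) (coact M m) (\<lambda>(x, y).
        sweedler K (tensorr K M A 2) (comult A y) (\<lambda>(y1, y2). tenr K M A 2 x [y1, y2]))"
    and coact_counit: "m \<in> carrier M \<Longrightarrow>
      sweedler K M (coact M m) (\<lambda>(x, y). counit A y \<odot>\<^bsub>M\<^esub> x) = m"
    and coact_act: "\<lbrakk>a \<in> carrier A; m \<in> carrier M\<rbrakk> \<Longrightarrow>
      coact M (act M a m) =
      sweedler K (tensor K M A) (comult A a) (\<lambda>(a1, a2).
        sweedler K (tensor K M A) (coact M m) (\<lambda>(m0, m1).
          ten K M A (act M a1 m0) (a2 \<otimes>\<^bsub>A\<^esub> m1)))"

text \<open>The left-right Hopf module \<open>V \<otimes> A\<close> for a vector space \<open>V\<close>.\<close>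

definition free_hmod ::
    "('k, 'q) ring_scheme \<Rightarrow> ('k, 'v, 's) module_scheme \<Rightarrow> ('k, 'a, 'r) bialg_scheme
      \<Rightarrow> ('k, ('v \<times> 'a, 'k) tensors, 'a) hmod"
  where "free_hmod K V A = module.extend (tensor K V A)
    \<lparr> act = (\<lambda>a t. sweedler K (tensor K V A) t (\<lambda>(v, b). ten K V A v (a \<otimes>\<^bsub>A\<^esub> b))),
      coact = (\<lambda>t. sweedler K (tensor K (tensor K V A) A) t (\<lambda>(v, b).
        sweedler K (tensor K (tensor K V A) A) (comult A b) (\<lambda>(b1, b2).
          ten K (tensor K V A) A (ten K V A v b1) b2))) \<rparr>"


section \<open>The double complex\<close>

text \<open>\<open>\<Sum> a\<^sub>1 \<otimes> \<dots> \<otimes> a\<^bsub>p+1\<^esub>\<close>, as an element of \<open>A \<otimes> A\<^sup>p\<close>.\<close>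

primrec iter_comult ::
    "('k, 'q) ring_scheme \<Rightarrow> ('k, 'a, 'r) bialg_scheme \<Rightarrow> nat \<Rightarrow> 'a \<Rightarrow> ('a \<times> 'a list, 'k) tensors"
  where
    "iter_comult K A 0 a = tenr K A A 0 a []"
  | "iter_comult K A (Suc p) a =
      sweedler K (tensorr K A A (Suc p)) (iter_comult K A p a) (\<lambda>(c, cs).
        sweedler K (tensorr K A A (Suc p)) (comult A c) (\<lambda>(c1, c2).
          tenr K A A (Suc p) c1 (c2 # cs)))"

text \<open>\<open>\<Sum> \<phi> [(a\<^sup>1)\<^sub>1, \<dots>, (a\<^sup>n)\<^sub>1] [(a\<^sup>1)\<^sub>2, \<dots>, (a\<^sup>n)\<^sub>2]\<close>, summed in \<open>X\<close>.\<close>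

primrec sweedler_list ::
    "('k, 'q) ring_scheme \<Rightarrow> ('k, 'a, 'r) bialg_scheme \<Rightarrow> ('k, 'x, 's) module_scheme
      \<Rightarrow> 'a list \<Rightarrow> ('a list \<Rightarrow> 'a list \<Rightarrow> 'x) \<Rightarrow> 'x"
  where
    "sweedler_list K A X [] \<phi> = \<phi> [] []"
  | "sweedler_list K A X (a # as) \<phi> = sweedler K X (comult A a) (\<lambda>(a1, a2).
      sweedler_list K A X as (\<lambda>as1 as2. \<phi> (a1 # as1) (a2 # as2)))"

context
  fixes K :: "('k, 'q) ring_scheme"
    and A :: "('k, 'a, 'r) bialg_scheme"
    and M :: "('k, 'm, 'a, 's) hmod_scheme"
    and N :: "('k, 'n, 'a, 't) hmod_scheme"
begin

definition cochains ::
    "nat \<Rightarrow> nat \<Rightarrow> ('k, ('a list \<times> 'm, 'k) tensors \<Rightarrow> ('n \<times> 'a list, 'k) tensors) module"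
  where "cochains n p = hom_module K (tensorl K A n M) (tensorr K N A p)"

text \<open>Lists are numbered from 0, so \<open>a\<^sup>i\<close> is \<open>as ! (i - 1)\<close>.\<close>

definition bmap ::
    "nat \<Rightarrow> nat \<Rightarrow> nat \<Rightarrow> (('a list \<times> 'm, 'k) tensors \<Rightarrow> ('n \<times> 'a list, 'k) tensors)
      \<Rightarrow> ('a list \<times> 'm, 'k) tensors \<Rightarrow> ('n \<times> 'a list, 'k) tensors"
  where "bmap n p i f =
    (\<lambda>t\<in>carrier (tensorl K A (Suc n) M). sweedler K (tensorr K N A p) t (\<lambda>(as, m).
      if i = 0 then
        sweedler K (tensorr K N A p) (iter_comult K A p (hd as)) (\<lambda>(c, cs).
          sweedler K (tensorr K N A p) (f (tenl K A n M (tl as) m)) (\<lambda>(y, bs).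
            tenr K N A p (act N c y) (map2 (\<lambda>c b. c \<otimes>\<^bsub>A\<^esub> b) cs bs)))
      else if i \<le> n then
        f (tenl K A n M (take (i - 1) as @ [as ! (i - 1) \<otimes>\<^bsub>A\<^esub> as ! i] @ drop (i + 1) as) m)
      else
        f (tenl K A n M (butlast as) (act M (last as) m))))"

definition cmap ::
    "nat \<Rightarrow> nat \<Rightarrow> nat \<Rightarrow> (('a list \<times> 'm, 'k) tensors \<Rightarrow> ('n \<times> 'a list, 'k) tensors)
      \<Rightarrow> ('a list \<times> 'm, 'k) tensors \<Rightarrow> ('n \<times> 'a list, 'k) tensors"
  where "cmap n p i f =
    (\<lambda>t\<in>carrier (tensorl K A n M).
      if i = 0 then
        sweedler K (tensorr K N A (Suc p)) (f t) (\<lambda>(y, bs).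
          sweedler K (tensorr K N A (Suc p)) (coact N y) (\<lambda>(y0, y1).
            tenr K N A (Suc p) y0 (y1 # bs)))
      else if i \<le> p then
        sweedler K (tensorr K N A (Suc p)) (f t) (\<lambda>(y, bs).
          sweedler K (tensorr K N A (Suc p)) (comult A (bs ! (i - 1))) (\<lambda>(b1, b2).
            tenr K N A (Suc p) y (take (i - 1) bs @ [b1, b2] @ drop i bs)))
      else
        sweedler K (tensorr K N A (Suc p)) t (\<lambda>(as, m).
          sweedler_list K A (tensorr K N A (Suc p)) as (\<lambda>as1 as2.
            sweedler K (tensorr K N A (Suc p)) (coact M m) (\<lambda>(m0, m1).
              sweedler K (tensorr K N A (Suc p)) (f (tenl K A n M as1 m0)) (\<lambda>(y, bs).
                tenr K N A (Suc p) y (bs @ [foldr (\<otimes>\<^bsub>A\<^esub>) as2 \<one>\<^bsub>A\<^esub> \<otimes>\<^bsub>A\<^esub> m1]))))))"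

definition sgn_pow :: "nat \<Rightarrow> 'k"
  where "sgn_pow i = (\<ominus>\<^bsub>K\<^esub> \<one>\<^bsub>K\<^esub>) [^]\<^bsub>K\<^esub> i"

definition d_m where
  "d_m n p f = (\<Oplus>\<^bsub>cochains (Suc n) p\<^esub> i \<in> {..Suc n}. sgn_pow i \<odot>\<^bsub>cochains (Suc n) p\<^esub> bmap n p i f)"

definition d_c where
  "d_c n p f = (\<Oplus>\<^bsub>cochains n (Suc p)\<^esub> i \<in> {..Suc p}. sgn_pow i \<odot>\<^bsub>cochains n (Suc p)\<^esub> cmap n p i f)"

text \<open>
  An element \<open>F\<close> of the total complex in degree \<open>r\<close> has components
  \<open>F n \<in> cochains n (r - n)\<close> for \<open>n \<le> r\<close>.
\<close>

definition total ::
    "nat \<Rightarrow> ('k, nat \<Rightarrow> ('a list \<times> 'm, 'k) tensors \<Rightarrow> ('n \<times> 'a list, 'k) tensors) module"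
  where "total r = prod_module {..r} (\<lambda>n. cochains n (r - n))"

definition total_d where
  "total_d r F = (\<lambda>n\<in>{..Suc r}.
    (if n = 0 then \<zero>\<^bsub>cochains n (Suc r - n)\<^esub> else d_m (n - 1) (Suc r - n) (F (n - 1)))
    \<oplus>\<^bsub>cochains n (Suc r - n)\<^esub>
    (if n = Suc r then \<zero>\<^bsub>cochains n (Suc r - n)\<^esub>
     else sgn_pow n \<odot>\<^bsub>cochains n (Suc r - n)\<^esub> d_c n (r - n) (F n)))"

definition cocycles where
  "cocycles r = {F \<in> carrier (total r). total_d r F = \<zero>\<^bsub>total (Suc r)\<^esub>}"

definition coboundaries where
  "coboundaries r =
    (case r of 0 \<Rightarrow> {\<zero>\<^bsub>total 0\<^esub>} | Suc s \<Rightarrow> total_d s ` carrier (total s))"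

definition cohomology where
  "cohomology r = quot_module ((total r)\<lparr>carrier := cocycles r\<rparr>) (coboundaries r)"

end


section \<open>Universal property of the presented vector spaces\<close>

lemma free_module_module:
  assumes "cring K" shows "module K (free_module K G)"
proof -
  interpret K: cring K by fact
  let ?F = "free_module K G"
  have sm: "k \<odot>\<^bsub>?F\<^esub> u \<in> carrier ?F" if "k \<in> carrier K" "u \<in> carrier ?F" for k u
  proof -
    have "{g. k \<otimes>\<^bsub>K\<^esub> u g \<noteq> \<zero>\<^bsub>K\<^esub>} \<subseteq> {g. u g \<noteq> \<zero>\<^bsub>K\<^esub>}" using that by auto
    then show ?thesis using that by (auto simp: free_module_def intro: finite_subset)
  qed
  have ad: "u \<oplus>\<^bsub>?F\<^esub> v \<in> carrier ?F" if "u \<in> carrier ?F" "v \<in> carrier ?F" for u v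
  proof -
    have sub: "{g. u g \<oplus>\<^bsub>K\<^esub> v g \<noteq> \<zero>\<^bsub>K\<^esub>} \<subseteq> {g. u g \<noteq> \<zero>\<^bsub>K\<^esub>} \<union> {g. v g \<noteq> \<zero>\<^bsub>K\<^esub>}" by auto
    have "finite {g. u g \<oplus>\<^bsub>K\<^esub> v g \<noteq> \<zero>\<^bsub>K\<^esub>}"
      by (rule finite_subset[OF sub]) (use that in \<open>auto simp: free_module_def\<close>)
    moreover have "{g. u g \<oplus>\<^bsub>K\<^esub> v g \<noteq> \<zero>\<^bsub>K\<^esub>} \<subseteq> G"
      using sub that by (simp add: free_module_def) blast
    ultimately show ?thesis using that by (simp add: free_module_def)
  qed
  have ab: "abelian_group ?F"
  proof (rule abelian_groupI)
    fix u assume u: "u \<in> carrier ?F"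
    have "(\<lambda>g. \<ominus>\<^bsub>K\<^esub> u g) = (\<ominus>\<^bsub>K\<^esub> \<one>\<^bsub>K\<^esub>) \<odot>\<^bsub>?F\<^esub> u"
      using u by (auto simp: free_module_def K.l_minus)
    then have "(\<lambda>g. \<ominus>\<^bsub>K\<^esub> u g) \<in> carrier ?F" using sm[of "\<ominus>\<^bsub>K\<^esub> \<one>\<^bsub>K\<^esub>" u] u by simp
    moreover have "(\<lambda>g. \<ominus>\<^bsub>K\<^esub> u g) \<oplus>\<^bsub>?F\<^esub> u = \<zero>\<^bsub>?F\<^esub>"
      using u by (auto simp: free_module_def K.l_neg)
    ultimately show "\<exists>y\<in>carrier ?F. y \<oplus>\<^bsub>?F\<^esub> u = \<zero>\<^bsub>?F\<^esub>" by blast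
  qed (use ad in \<open>auto simp: free_module_def K.a_ac\<close>)
  show ?thesis
    by (rule moduleI[OF assms ab sm])
      (auto simp: free_module_def K.l_distr K.r_distr K.m_assoc)
qed

lemma free_gen_carrier:
  assumes "cring K" "g \<in> G" shows "free_gen K g \<in> carrier (free_module K G)"
proof -
  interpret K: cring K by fact
  show ?thesis using assms(2) by (auto simp: free_module_def free_gen_def)
qed

lemma free_module_induct [consumes 2, case_names zero add]:
  assumes "cring K" "u \<in> carrier (free_module K G)"
    and z: "P \<zero>\<^bsub>free_module K G\<^esub>"
    and a: "\<And>k g u. k \<in> carrier K \<Longrightarrow> g \<in> G \<Longrightarrow> u \<in> carrier (free_module K G) \<Longrightarrow> P u
      \<Longrightarrow> P (k \<odot>\<^bsub>free_module K G\<^esub> free_gen K g \<oplus>\<^bsub>free_module K G\<^esub> u)"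
  shows "P u"
proof -
  interpret K: cring K by fact
  have "finite {g. u g \<noteq> \<zero>\<^bsub>K\<^esub>}" using assms(2) by (simp add: free_module_def)
  then show ?thesis using assms(2)
  proof (induction "{g. u g \<noteq> \<zero>\<^bsub>K\<^esub>}" arbitrary: u rule: finite_induct)
    case empty
    then have "u = \<zero>\<^bsub>free_module K G\<^esub>" by (auto simp: free_module_def)
    then show ?case using z by simp
  next
    case (insert g S)
    let ?v = "u(g := \<zero>\<^bsub>K\<^esub>)"
    have S: "S = {h. ?v h \<noteq> \<zero>\<^bsub>K\<^esub>}" using insert by auto
    have u: "\<And>h. u h \<in> carrier K" "g \<in> G" using insert by (auto simp: free_module_def)
    have v: "?v \<in> carrier (free_module K G)"
      using insert S by (auto simp: free_module_def)
    have "P ?v" using insert.hyps(3)[OF S v] .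
    moreover have "u = u g \<odot>\<^bsub>free_module K G\<^esub> free_gen K g \<oplus>\<^bsub>free_module K G\<^esub> ?v"
      using u by (auto simp: free_module_def free_gen_def fun_eq_iff)
    ultimately show ?case using a[OF u(1)[of g] u(2) v] by metis
  qed
qed

lemma free_lift_superset:
  assumes "module K X" "u \<in> carrier (free_module K G)" "\<phi> \<in> G \<rightarrow> carrier X"
    "finite S" "{g. u g \<noteq> \<zero>\<^bsub>K\<^esub>} \<subseteq> S" "S \<subseteq> G"
  shows "free_lift K X \<phi> u = (\<Oplus>\<^bsub>X\<^esub> g \<in> S. u g \<odot>\<^bsub>X\<^esub> \<phi> g)"
proof -
  interpret X: module K X by fact
  have u: "\<And>h. u h \<in> carrier K" using assms(2) by (auto simp: free_module_def)
  have \<phi>: "\<And>g. g \<in> S \<Longrightarrow> \<phi> g \<in> carrier X" using assms(3,6) by blast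
  show ?thesis unfolding free_lift_def
  proof (rule X.M.add.finprod_mono_neutral_cong_left[OF assms(4,5) _ refl])
    show "u g \<odot>\<^bsub>X\<^esub> \<phi> g = \<zero>\<^bsub>X\<^esub>" if "g \<in> S - {g. u g \<noteq> \<zero>\<^bsub>K\<^esub>}" for g
      using that \<phi>[of g] by simp
    show "(\<lambda>g. u g \<odot>\<^bsub>X\<^esub> \<phi> g) \<in> S \<rightarrow> carrier X"
      using u \<phi> by (intro funcsetI X.smult_closed)
  qed
qed

lemma free_lift_linear:
  assumes "module K X" "\<phi> \<in> G \<rightarrow> carrier X"
  shows "linear_map K (free_module K G) X (free_lift K X \<phi>)"
proof -
  interpret X: module K X by fact
  let ?F = "free_module K G"
  interpret F: module K ?F using free_module_module X.R.is_cring by blast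
  have cl: "\<And>u h. u \<in> carrier ?F \<Longrightarrow> u h \<in> carrier K" 
    and fin: "\<And>u. u \<in> carrier ?F \<Longrightarrow> finite {g. u g \<noteq> \<zero>\<^bsub>K\<^esub>}"
    and sub: "\<And>u. u \<in> carrier ?F \<Longrightarrow> {g. u g \<noteq> \<zero>\<^bsub>K\<^esub>} \<subseteq> G" by (auto simp: free_module_def)
  show ?thesis unfolding linear_map_def
  proof (intro conjI ballI funcsetI)
    fix u assume u: "u \<in> carrier ?F"
    show "free_lift K X \<phi> u \<in> carrier X" unfolding free_lift_def
      by (rule X.M.finsum_closed) (use assms sub[OF u] cl[OF u] in auto)
    fix k assume k: "k \<in> carrier K"
    have ku: "k \<odot>\<^bsub>?F\<^esub> u \<in> carrier ?F" using k u by simp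
    have s: "{g. (k \<odot>\<^bsub>?F\<^esub> u) g \<noteq> \<zero>\<^bsub>K\<^esub>} \<subseteq> {g. u g \<noteq> \<zero>\<^bsub>K\<^esub>}"
      using k by (auto simp: free_module_def)
    have f: "\<And>g. g \<in> {g. u g \<noteq> \<zero>\<^bsub>K\<^esub>} \<Longrightarrow> \<phi> g \<in> carrier X" using assms sub[OF u] by auto
    have "free_lift K X \<phi> (k \<odot>\<^bsub>?F\<^esub> u) =
        (\<Oplus>\<^bsub>X\<^esub> g \<in> {g. u g \<noteq> \<zero>\<^bsub>K\<^esub>}. (k \<odot>\<^bsub>?F\<^esub> u) g \<odot>\<^bsub>X\<^esub> \<phi> g)"
      by (rule free_lift_superset[OF assms(1) ku assms(2) fin[OF u] s sub[OF u]])
    also have "\<dots> = (\<Oplus>\<^bsub>X\<^esub> g \<in> {g. u g \<noteq> \<zero>\<^bsub>K\<^esub>}. k \<odot>\<^bsub>X\<^esub> (u g \<odot>\<^bsub>X\<^esub> \<phi> g))"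
    proof (rule X.M.finsum_cong'[OF refl])
      show "(\<lambda>g. k \<odot>\<^bsub>X\<^esub> (u g \<odot>\<^bsub>X\<^esub> \<phi> g)) \<in> {g. u g \<noteq> \<zero>\<^bsub>K\<^esub>} \<rightarrow> carrier X"
        by (intro funcsetI X.smult_closed k cl[OF u] f)
      show "(k \<odot>\<^bsub>?F\<^esub> u) g \<odot>\<^bsub>X\<^esub> \<phi> g = k \<odot>\<^bsub>X\<^esub> (u g \<odot>\<^bsub>X\<^esub> \<phi> g)" if "g \<in> {g. u g \<noteq> \<zero>\<^bsub>K\<^esub>}" for g
        using X.smult_assoc1[OF k cl[OF u] f[OF that]] by (simp add: free_module_def)
    qed
    also have "\<dots> = k \<odot>\<^bsub>X\<^esub> free_lift K X \<phi> u" unfolding free_lift_def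
      by (rule X.finsum_smult_ldistr[symmetric, OF fin[OF u] k])
        (intro funcsetI X.smult_closed cl[OF u] f)
    finally show "free_lift K X \<phi> (k \<odot>\<^bsub>?F\<^esub> u) = k \<odot>\<^bsub>X\<^esub> free_lift K X \<phi> u" .
  next
    fix u v assume u: "u \<in> carrier ?F" and v: "v \<in> carrier ?F"
    let ?S = "{g. u g \<noteq> \<zero>\<^bsub>K\<^esub>} \<union> {g. v g \<noteq> \<zero>\<^bsub>K\<^esub>}"
    have S: "finite ?S" "?S \<subseteq> G" using fin sub u v by auto
    have s: "{g. (u \<oplus>\<^bsub>?F\<^esub> v) g \<noteq> \<zero>\<^bsub>K\<^esub>} \<subseteq> ?S" by (auto simp: free_module_def)
    have f: "\<And>g. g \<in> ?S \<Longrightarrow> \<phi> g \<in> carrier X" using assms S by auto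
    have uv: "u \<oplus>\<^bsub>?F\<^esub> v \<in> carrier ?F" using u v by simp
    have "free_lift K X \<phi> (u \<oplus>\<^bsub>?F\<^esub> v) = (\<Oplus>\<^bsub>X\<^esub> g \<in> ?S. (u \<oplus>\<^bsub>?F\<^esub> v) g \<odot>\<^bsub>X\<^esub> \<phi> g)"
      by (rule free_lift_superset[OF assms(1) uv assms(2) S(1) s S(2)])
    also have "\<dots> = (\<Oplus>\<^bsub>X\<^esub> g \<in> ?S. u g \<odot>\<^bsub>X\<^esub> \<phi> g \<oplus>\<^bsub>X\<^esub> v g \<odot>\<^bsub>X\<^esub> \<phi> g)"
    proof (rule X.M.finsum_cong'[OF refl])
      show "(\<lambda>g. u g \<odot>\<^bsub>X\<^esub> \<phi> g \<oplus>\<^bsub>X\<^esub> v g \<odot>\<^bsub>X\<^esub> \<phi> g) \<in> ?S \<rightarrow> carrier X"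
        by (intro funcsetI X.M.a_closed X.smult_closed cl[OF u] cl[OF v] f)
      show "(u \<oplus>\<^bsub>?F\<^esub> v) g \<odot>\<^bsub>X\<^esub> \<phi> g = u g \<odot>\<^bsub>X\<^esub> \<phi> g \<oplus>\<^bsub>X\<^esub> v g \<odot>\<^bsub>X\<^esub> \<phi> g" if "g \<in> ?S" for g
        using X.smult_l_distr[OF cl[OF u] cl[OF v] f[OF that]] by (simp add: free_module_def)
    qed
    also have "\<dots> = (\<Oplus>\<^bsub>X\<^esub> g \<in> ?S. u g \<odot>\<^bsub>X\<^esub> \<phi> g) \<oplus>\<^bsub>X\<^esub> (\<Oplus>\<^bsub>X\<^esub> g \<in> ?S. v g \<odot>\<^bsub>X\<^esub> \<phi> g)"
      by (rule X.M.finsum_addf) (intro funcsetI X.smult_closed cl[OF u] cl[OF v] f; assumption)+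
    also have "\<dots> = free_lift K X \<phi> u \<oplus>\<^bsub>X\<^esub> free_lift K X \<phi> v"
      by (simp only: free_lift_superset[OF assms(1) u assms(2) S(1) Un_upper1 S(2)]
        free_lift_superset[OF assms(1) v assms(2) S(1) Un_upper2 S(2)])
    finally show "free_lift K X \<phi> (u \<oplus>\<^bsub>?F\<^esub> v) = free_lift K X \<phi> u \<oplus>\<^bsub>X\<^esub> free_lift K X \<phi> v" .
  qed
qed

lemma free_lift_gen:
  assumes "module K X" "\<phi> \<in> G \<rightarrow> carrier X" "g \<in> G"
  shows "free_lift K X \<phi> (free_gen K g) = \<phi> g"
proof -
  interpret X: module K X by fact
  have \<phi>: "\<phi> g \<in> carrier X" using assms(2,3) by blast
  have "free_lift K X \<phi> (free_gen K g) = (\<Oplus>\<^bsub>X\<^esub> h \<in> {g}. free_gen K g h \<odot>\<^bsub>X\<^esub> \<phi> h)"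
  proof (rule free_lift_superset[OF assms(1) _ assms(2)])
    show "free_gen K g \<in> carrier (free_module K G)"
      by (rule free_gen_carrier[OF X.R.is_cring assms(3)])
    show "{h. free_gen K g h \<noteq> \<zero>\<^bsub>K\<^esub>} \<subseteq> {g}" by (auto simp: free_gen_def)
  qed (use assms(3) in simp_all)
  also have "\<dots> = \<phi> g" using \<phi> by (simp add: free_gen_def)
  finally show ?thesis .
qed

lemma linear_mapD:
  assumes "linear_map K X Y f"
  shows "x \<in> carrier X \<Longrightarrow> f x \<in> carrier Y"
    "x \<in> carrier X \<Longrightarrow> y \<in> carrier X \<Longrightarrow> f (x \<oplus>\<^bsub>X\<^esub> y) = f x \<oplus>\<^bsub>Y\<^esub> f y"
    "k \<in> carrier K \<Longrightarrow> x \<in> carrier X \<Longrightarrow> f (k \<odot>\<^bsub>X\<^esub> x) = k \<odot>\<^bsub>Y\<^esub> f x"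
  using assms by (auto simp: linear_map_def)

lemma linear_map_zero:
  assumes "module K X" "module K Y" "linear_map K X Y f" shows "f \<zero>\<^bsub>X\<^esub> = \<zero>\<^bsub>Y\<^esub>"
proof -
  interpret X: module K X by fact
  interpret Y: module K Y by fact
  have "f (\<zero>\<^bsub>K\<^esub> \<odot>\<^bsub>X\<^esub> \<zero>\<^bsub>X\<^esub>) = \<zero>\<^bsub>K\<^esub> \<odot>\<^bsub>Y\<^esub> f \<zero>\<^bsub>X\<^esub>"
    by (rule linear_mapD(3)[OF assms(3)]) auto
  then show ?thesis using linear_mapD(1)[OF assms(3)] by simp
qed

lemma linear_map_minus:
  assumes "module K X" "module K Y" "linear_map K X Y f" "x \<in> carrier X" "y \<in> carrier X"
  shows "f (x \<ominus>\<^bsub>X\<^esub> y) = f x \<ominus>\<^bsub>Y\<^esub> f y"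
proof -
  interpret X: module K X by fact
  interpret Y: module K Y by fact
  have "x \<ominus>\<^bsub>X\<^esub> y = x \<oplus>\<^bsub>X\<^esub> (\<ominus>\<^bsub>K\<^esub> \<one>\<^bsub>K\<^esub>) \<odot>\<^bsub>X\<^esub> y"
    using assms by (simp add: X.smult_l_minus a_minus_def)
  then show ?thesis using assms linear_mapD[OF assms(3)]
    by (simp add: Y.smult_l_minus a_minus_def)
qed

lemma module_abelian_subgroup:
  assumes "module K M" "submodule H K M" shows "abelian_subgroup H M"
proof -
  interpret M: module K M by fact
  show ?thesis using assms(2) module.axioms(2)[OF assms(1)] unfolding submodule_def
    by (intro abelian_subgroupI3) (auto intro: additive_subgroupI)
qed

lemma quot_module_add:
  assumes "module K M" "submodule H K M" "x \<in> carrier M" "y \<in> carrier M"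
  shows "(H +>\<^bsub>M\<^esub> x) \<oplus>\<^bsub>quot_module M H\<^esub> (H +>\<^bsub>M\<^esub> y) = H +>\<^bsub>M\<^esub> (x \<oplus>\<^bsub>M\<^esub> y)"
proof -
  interpret abelian_subgroup H M by (rule module_abelian_subgroup) fact+
  show ?thesis using assms by (simp add: quot_module_def a_rcos_sum)
qed

lemma quot_module_smult:
  assumes "module K M" "submodule H K M" "x \<in> carrier M" "k \<in> carrier K"
  shows "k \<odot>\<^bsub>quot_module M H\<^esub> (H +>\<^bsub>M\<^esub> x) = H +>\<^bsub>M\<^esub> (k \<odot>\<^bsub>M\<^esub> x)"
proof -
  interpret abelian_subgroup H M by (rule module_abelian_subgroup) fact+
  interpret M: module K M by fact
  interpret H: submodule H K M by fact
  have "H +>\<^bsub>M\<^esub> (k \<odot>\<^bsub>M\<^esub> y) = H +>\<^bsub>M\<^esub> (k \<odot>\<^bsub>M\<^esub> x)" if "y \<in> H +>\<^bsub>M\<^esub> x" for y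
  proof -
    obtain h where h: "h \<in> H" "y = h \<oplus>\<^bsub>M\<^esub> x" using \<open>y \<in> _\<close> by (auto simp: a_r_coset_def')
    then have "k \<odot>\<^bsub>M\<^esub> y = k \<odot>\<^bsub>M\<^esub> h \<oplus>\<^bsub>M\<^esub> k \<odot>\<^bsub>M\<^esub> x" "k \<odot>\<^bsub>M\<^esub> h \<in> H"
      using assms by (auto simp: M.smult_r_distr)
    then have "k \<odot>\<^bsub>M\<^esub> y \<in> H +>\<^bsub>M\<^esub> (k \<odot>\<^bsub>M\<^esub> x)" by (auto simp: a_r_coset_def')
    then show ?thesis using a_repr_independence' assms by (metis M.smult_closed)
  qed
  moreover have "x \<in> H +>\<^bsub>M\<^esub> x" using a_rcos_self assms by simp
  ultimately have "(\<Union>y\<in>H +>\<^bsub>M\<^esub> x. H +>\<^bsub>M\<^esub> (k \<odot>\<^bsub>M\<^esub> y)) = H +>\<^bsub>M\<^esub> (k \<odot>\<^bsub>M\<^esub> x)" by blast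
  then show ?thesis by (simp add: quot_module_def)
qed

lemma quot_module_carrier:
  "carrier (quot_module M H) = (\<lambda>x. H +>\<^bsub>M\<^esub> x) ` carrier M"
  by (auto simp: quot_module_def A_RCOSETS_def')

lemma quot_module_zero:
  assumes "module K M" "submodule H K M" 
  shows "\<zero>\<^bsub>quot_module M H\<^esub> = H +>\<^bsub>M\<^esub> \<zero>\<^bsub>M\<^esub>"
proof -
  interpret abelian_subgroup H M by (rule module_abelian_subgroup) fact+
  show ?thesis using a_coset_add_zero[OF a_subset] by (simp add: quot_module_def)
qed

lemma quot_module_module:
  assumes "module K M" "submodule H K M" shows "module K (quot_module M H)"
proof -
  interpret M: module K M by fact
  note [simp] = quot_module_add[OF assms] quot_module_smult[OF assms] quot_module_carrier
    quot_module_zero[OF assms]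
  show ?thesis
  proof (rule moduleI)
    show "cring K" by (rule M.R.is_cring)
    show "abelian_group (quot_module M H)"
    proof (rule abelian_groupI)
      fix x assume "x \<in> carrier (quot_module M H)"
      then obtain m where m: "m \<in> carrier M" "x = H +>\<^bsub>M\<^esub> m" by auto
      then show "\<exists>y\<in>carrier (quot_module M H). y \<oplus>\<^bsub>quot_module M H\<^esub> x = \<zero>\<^bsub>quot_module M H\<^esub>"
        by (auto intro!: bexI[of _ "\<ominus>\<^bsub>M\<^esub> m"] simp: M.l_neg)
    qed (auto simp: M.M.a_ac)
  qed (auto simp: M.smult_l_distr M.smult_r_distr M.smult_assoc1)
qed

lemma submodule_Inter:
  assumes "module K M" "\<And>H. H \<in> \<H> \<Longrightarrow> submodule H K M" "\<H> \<noteq> {}"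
  shows "submodule (\<Inter>\<H>) K M"
proof -
  interpret M: module K M by fact
  note e = M.submoduleE[OF assms(2)]
  show ?thesis
  proof (rule M.submoduleI)
    show "\<zero>\<^bsub>M\<^esub> \<in> \<Inter>\<H>"
    proof
      fix H assume H: "H \<in> \<H>"
      then interpret submodule H K M by (rule assms(2))
      show "\<zero>\<^bsub>M\<^esub> \<in> H" using one_closed by simp
    qed
  next
    obtain H where "H \<in> \<H>" using assms(3) by auto
    then show "\<Inter>\<H> \<subseteq> carrier M" using e(1)[of H] by auto
  qed (auto intro: e)
qed

lemma rel_span_submodule:
  assumes "cring K" "R \<subseteq> carrier (free_module K G)"
  shows "submodule (rel_span K G R) K (free_module K G)"
proof -
  interpret F: module K "free_module K G" by (rule free_module_module) fact
  show ?thesis unfolding rel_span_def hull_def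
    by (rule submodule_Inter[OF F.module_axioms]) (use assms F.carrier_is_submodule in auto)
qed

locale presentation = K: cring K for K :: "('k, 'q) ring_scheme" +
  fixes G :: "'g set" and R
  assumes R: "R \<subseteq> carrier (free_module K G)"
begin

abbreviation "F \<equiv> free_module K G"
abbreviation "P \<equiv> presented K G R"
abbreviation "H \<equiv> rel_span K G R"

lemma F_module: "module K F" by (rule free_module_module) (rule K.is_cring)
lemma H_submodule: "submodule H K F" by (rule rel_span_submodule[OF K.is_cring R])
lemma P_module: "module K P" unfolding presented_def
  by (rule quot_module_module[OF F_module H_submodule])

lemma gen_closed: "g \<in> G \<Longrightarrow> presented_gen K G R g \<in> carrier P"
  by (simp add: presented_def presented_gen_def quot_module_carrier free_gen_carrier K.is_cring)

lemma rel_gen: "u \<in> carrier F \<Longrightarrow> v \<in> carrier F \<Longrightarrow> u \<ominus>\<^bsub>F\<^esub> v \<in> R \<Longrightarrow> H +>\<^bsub>F\<^esub> u = H +>\<^bsub>F\<^esub> v"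
proof -
  assume *: "u \<in> carrier F" "v \<in> carrier F" "u \<ominus>\<^bsub>F\<^esub> v \<in> R"
  interpret F: module K F by (rule F_module)
  interpret abelian_subgroup H F by (rule module_abelian_subgroup[OF F_module H_submodule])
  have "R \<subseteq> H" unfolding rel_span_def by (rule hull_subset)
  then have "u \<ominus>\<^bsub>F\<^esub> v \<in> H" using * by auto
  moreover have "u = (u \<ominus>\<^bsub>F\<^esub> v) \<oplus>\<^bsub>F\<^esub> v"
    using * by (simp add: a_minus_def F.M.a_assoc F.M.l_neg)
  ultimately have "u \<in> H +>\<^bsub>F\<^esub> v" by (auto simp: a_r_coset_def')
  then show ?thesis using a_repr_independence' * by metis
qed

lemma induct [consumes 1, case_names zero add smult gen]:
  assumes "t \<in> carrier P" and z: "Q \<zero>\<^bsub>P\<^esub>"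
    and a: "\<And>s t. s \<in> carrier P \<Longrightarrow> t \<in> carrier P \<Longrightarrow> Q s \<Longrightarrow> Q t \<Longrightarrow> Q (s \<oplus>\<^bsub>P\<^esub> t)"
    and s: "\<And>k t. k \<in> carrier K \<Longrightarrow> t \<in> carrier P \<Longrightarrow> Q t \<Longrightarrow> Q (k \<odot>\<^bsub>P\<^esub> t)"
    and g: "\<And>g. g \<in> G \<Longrightarrow> Q (presented_gen K G R g)"
  shows "Q t"
proof -
  interpret F: module K F by (rule F_module)
  interpret P: module K P by (rule P_module)
  note ms = F_module H_submodule
  obtain u where u: "u \<in> carrier F" "t = H +>\<^bsub>F\<^esub> u"
    using assms(1) by (auto simp: presented_def quot_module_carrier)
  have "Q (H +>\<^bsub>F\<^esub> u)" using K.is_cring u(1)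
  proof (induction rule: free_module_induct)
    case zero
    then show ?case using z quot_module_zero[OF ms] by (simp add: presented_def)
  next
    case (add k g u)
    let ?g = "presented_gen K G R g"
    have g': "free_gen K g \<in> carrier F" by (rule free_gen_carrier[OF K.is_cring add(2)])
    have u': "H +>\<^bsub>F\<^esub> u \<in> carrier P" unfolding presented_def quot_module_carrier by (rule imageI[OF add(3)])
    have "H +>\<^bsub>F\<^esub> (k \<odot>\<^bsub>F\<^esub> free_gen K g \<oplus>\<^bsub>F\<^esub> u) =
        (H +>\<^bsub>F\<^esub> (k \<odot>\<^bsub>F\<^esub> free_gen K g)) \<oplus>\<^bsub>P\<^esub> (H +>\<^bsub>F\<^esub> u)"
      unfolding presented_def
      by (rule quot_module_add[OF ms F.smult_closed[OF add(1) g'] add(3), symmetric])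
    also have "H +>\<^bsub>F\<^esub> (k \<odot>\<^bsub>F\<^esub> free_gen K g) = k \<odot>\<^bsub>P\<^esub> ?g"
      unfolding presented_def presented_gen_def
      by (rule quot_module_smult[OF ms g' add(1), symmetric])
    finally have eq: "H +>\<^bsub>F\<^esub> (k \<odot>\<^bsub>F\<^esub> free_gen K g \<oplus>\<^bsub>F\<^esub> u) = k \<odot>\<^bsub>P\<^esub> ?g \<oplus>\<^bsub>P\<^esub> (H +>\<^bsub>F\<^esub> u)" .
    show ?case unfolding eq
      by (rule a[OF P.smult_closed[OF add(1) gen_closed[OF add(2)]] u'
            s[OF add(1) gen_closed[OF add(2)] g[OF add(2)]] add(4)])
  qed
  then show ?thesis using u by simp
qed

context
  fixes X :: "('k, 'x, 'z) module_scheme" and \<phi>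
  assumes X: "module K X" and \<phi>: "\<phi> \<in> G \<rightarrow> carrier X"
    and kill: "\<And>r. r \<in> R \<Longrightarrow> free_lift K X \<phi> r = \<zero>\<^bsub>X\<^esub>"
begin

lemma sweedler_coset:
  assumes "u \<in> carrier F" shows "sweedler K X (H +>\<^bsub>F\<^esub> u) \<phi> = free_lift K X \<phi> u"
proof -
  interpret F: module K F by (rule F_module)
  interpret X: module K X by (rule X)
  note lin = free_lift_linear[OF X \<phi>]
  interpret abelian_subgroup H F by (rule module_abelian_subgroup[OF F_module H_submodule])
  have "submodule {r \<in> carrier F. free_lift K X \<phi> r = \<zero>\<^bsub>X\<^esub>} K F"
  proof (rule F.submoduleI)
    show "\<ominus>\<^bsub>F\<^esub> a \<in> {r \<in> carrier F. free_lift K X \<phi> r = \<zero>\<^bsub>X\<^esub>}"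
      if "a \<in> {r \<in> carrier F. free_lift K X \<phi> r = \<zero>\<^bsub>X\<^esub>}" for a
      using linear_map_minus[OF F_module X lin, of "\<zero>\<^bsub>F\<^esub>" a] that
        linear_map_zero[OF F_module X lin] by (simp add: a_minus_def)
  qed (auto simp: linear_map_zero[OF F_module X lin] linear_mapD[OF lin])
  moreover have "R \<subseteq> {r \<in> carrier F. free_lift K X \<phi> r = \<zero>\<^bsub>X\<^esub>}" using R kill by auto
  ultimately have H: "H \<subseteq> {r \<in> carrier F. free_lift K X \<phi> r = \<zero>\<^bsub>X\<^esub>}"
    unfolding rel_span_def by (simp add: hull_minimal)
  have "(SOME v. v \<in> H +>\<^bsub>F\<^esub> u) \<in> H +>\<^bsub>F\<^esub> u"
    using a_rcos_self[OF assms] by (rule someI[of "\<lambda>v. v \<in> H +>\<^bsub>F\<^esub> u"])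
  then obtain h where "h \<in> H" "(SOME v. v \<in> H +>\<^bsub>F\<^esub> u) = h \<oplus>\<^bsub>F\<^esub> u"
    by (auto simp: a_r_coset_def')
  then show ?thesis unfolding sweedler_def using H assms linear_mapD[OF lin] by auto
qed

lemma sweedler_gen: "g \<in> G \<Longrightarrow> sweedler K X (presented_gen K G R g) \<phi> = \<phi> g"
  unfolding presented_gen_def
  by (simp add: sweedler_coset free_gen_carrier K.is_cring free_lift_gen[OF X \<phi>])

lemma sweedler_linear: "linear_map K P X (\<lambda>t. sweedler K X t \<phi>)"
proof -
  note ms = F_module H_submodule
  interpret F: module K F by (rule F_module)
  note lin = linear_mapD[OF free_lift_linear[OF X \<phi>]]
  show ?thesis unfolding linear_map_def presented_def
    by (auto simp: quot_module_carrier quot_module_add[OF ms] quot_module_smult[OF ms]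
        sweedler_coset lin)
qed

end
end

lemma linear_mapI:
  assumes "\<And>x. x \<in> carrier X \<Longrightarrow> f x \<in> carrier Y"
    "\<And>x y. x \<in> carrier X \<Longrightarrow> y \<in> carrier X \<Longrightarrow> f (x \<oplus>\<^bsub>X\<^esub> y) = f x \<oplus>\<^bsub>Y\<^esub> f y"
    "\<And>k x. k \<in> carrier K \<Longrightarrow> x \<in> carrier X \<Longrightarrow> f (k \<odot>\<^bsub>X\<^esub> x) = k \<odot>\<^bsub>Y\<^esub> f x"
  shows "linear_map K X Y f"
  using assms by (auto simp: linear_map_def)

lemma linear_map_comp:
  "linear_map K X Y f \<Longrightarrow> linear_map K Y Z g \<Longrightarrow> linear_map K X Z (\<lambda>x. g (f x))"
  by (rule linear_mapI) (simp_all add: linear_mapD)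

lemma linear_map_cong:
  assumes "module K X" "linear_map K X Y f" "\<And>x. x \<in> carrier X \<Longrightarrow> f x = g x"
  shows "linear_map K X Y g"
proof -
  interpret X: module K X by fact
  show ?thesis using assms(2) unfolding linear_map_def
    by (auto simp flip: assms(3))
qed

lemma linear_map_zero_fun:
  assumes "module K X" "module K Y" shows "linear_map K X Y (\<lambda>x. \<zero>\<^bsub>Y\<^esub>)"
proof -
  interpret X: module K X by fact
  interpret Y: module K Y by fact
  show ?thesis by (rule linear_mapI) auto
qed

lemma linear_map_add_fun:
  assumes "module K X" "module K Y" "linear_map K X Y f" "linear_map K X Y g"
  shows "linear_map K X Y (\<lambda>x. f x \<oplus>\<^bsub>Y\<^esub> g x)"
proof -
  interpret X: module K X by fact
  interpret Y: module K Y by fact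
  note f = linear_mapD[OF assms(3)] and g = linear_mapD[OF assms(4)]
  show ?thesis by (rule linear_mapI) (simp_all add: f g Y.smult_r_distr Y.M.a_ac)
qed

lemma linear_map_smult_fun:
  assumes "module K X" "module K Y" "linear_map K X Y f" "k \<in> carrier K"
  shows "linear_map K X Y (\<lambda>x. k \<odot>\<^bsub>Y\<^esub> f x)"
proof -
  interpret X: module K X by fact
  interpret Y: module K Y by fact
  note f = linear_mapD[OF assms(3)]
  have "k \<odot>\<^bsub>Y\<^esub> (l \<odot>\<^bsub>Y\<^esub> y) = l \<odot>\<^bsub>Y\<^esub> (k \<odot>\<^bsub>Y\<^esub> y)" if "l \<in> carrier K" "y \<in> carrier Y" for l y
    using that assms(4) by (metis Y.smult_assoc1 X.R.m_comm)
  then show ?thesis by (intro linear_mapI) (simp_all add: f assms(4) Y.smult_r_distr)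
qed

context presentation
begin

definition good :: "('k, 'x, 'z) module_scheme \<Rightarrow> ('g \<Rightarrow> 'x) \<Rightarrow> bool" where
  "good X \<phi> \<longleftrightarrow> \<phi> \<in> G \<rightarrow> carrier X \<and> (\<forall>r\<in>R. free_lift K X \<phi> r = \<zero>\<^bsub>X\<^esub>)"

lemma good_gen: "module K X \<Longrightarrow> good X \<phi> \<Longrightarrow> g \<in> G \<Longrightarrow> sweedler K X (presented_gen K G R g) \<phi> = \<phi> g"
  unfolding good_def by (rule sweedler_gen) auto

lemma good_linear: "module K X \<Longrightarrow> good X \<phi> \<Longrightarrow> linear_map K P X (\<lambda>t. sweedler K X t \<phi>)"
  unfolding good_def by (rule sweedler_linear) auto

lemma linear_eq:
  assumes "module K X" "linear_map K P X f" "linear_map K P X h"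
    "\<And>g. g \<in> G \<Longrightarrow> f (presented_gen K G R g) = h (presented_gen K G R g)" "t \<in> carrier P"
  shows "f t = h t"
  using assms(5)
proof (induction rule: induct)
  case zero
  then show ?case using linear_map_zero[OF P_module assms(1)] assms(2,3) by metis
qed (simp_all add: linear_mapD[OF assms(2)] linear_mapD[OF assms(3)] assms(4))

lemma sweedler_comp:
  assumes "module K X" "module K Y" "good X \<phi>" "linear_map K X Y L" "t \<in> carrier P"
    "good Y (\<lambda>g. L (\<phi> g))"
  shows "L (sweedler K X t \<phi>) = sweedler K Y t (\<lambda>g. L (\<phi> g))"
  by (rule linear_eq[OF assms(2) linear_map_comp[OF good_linear[OF assms(1,3)] assms(4)]
      good_linear[OF assms(2,6)] _ assms(5)]) (simp add: good_gen assms)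

lemma free_lift_linear_comp:
  assumes "module K X" "module K Y" "\<phi> \<in> G \<rightarrow> carrier X" "linear_map K X Y L" "u \<in> carrier F"
  shows "L (free_lift K X \<phi> u) = free_lift K Y (\<lambda>g. L (\<phi> g)) u"
proof -
  interpret X: module K X by fact
  interpret Y: module K Y by fact
  interpret F: module K F by (rule F_module)
  have \<psi>: "(\<lambda>g. L (\<phi> g)) \<in> G \<rightarrow> carrier Y" using assms(3) linear_mapD(1)[OF assms(4)] by auto
  note l = free_lift_linear[OF assms(1,3)] and m = free_lift_linear[OF assms(2) \<psi>]
  show ?thesis using K.is_cring assms(5)
  proof (induction rule: free_module_induct)
    case zero
    show ?case using linear_map_zero[OF F_module assms(1) l] linear_map_zero[OF F_module assms(2) m]
      linear_map_zero[OF assms(1,2,4)] by simp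
  next
    case (add k g u)
    note g' = free_gen_carrier[OF K.is_cring add(2)]
    show ?case using add(1,3,4) assms(3) g' add(2)
      by (simp add: linear_mapD[OF l] linear_mapD[OF m] linear_mapD[OF assms(4)] free_lift_gen[OF assms(1,3)]
          free_lift_gen[OF assms(2) \<psi>] Pi_iff)
  qed
qed

lemma good_comp:
  assumes "module K X" "module K Y" "good X \<phi>" "linear_map K X Y L"
  shows "good Y (\<lambda>g. L (\<phi> g))"
  unfolding good_def
proof (intro conjI ballI funcsetI)
  have \<phi>: "\<phi> \<in> G \<rightarrow> carrier X" using assms(3) by (simp add: good_def)
  then show "L (\<phi> g) \<in> carrier Y" if "g \<in> G" for g
    using that linear_mapD(1)[OF assms(4)] by blast
  fix r assume r: "r \<in> R"
  then have r': "r \<in> carrier F" using R by auto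
  show "free_lift K Y (\<lambda>g. L (\<phi> g)) r = \<zero>\<^bsub>Y\<^esub>"
    using free_lift_linear_comp[OF assms(1,2) \<phi> assms(4) r'] assms(3) r
      linear_map_zero[OF assms(1,2,4)] by (simp add: good_def)
qed

lemmas sweedler_comp' = sweedler_comp[OF _ _ _ _ _ good_comp]

lemma sweedler_param:
  assumes "module K V" "module K X" "\<And>v. v \<in> carrier V \<Longrightarrow> good X (\<phi> v)"
    "\<And>g. g \<in> G \<Longrightarrow> linear_map K V X (\<lambda>v. \<phi> v g)" "t \<in> carrier P"
  shows "linear_map K V X (\<lambda>v. sweedler K X t (\<phi> v))"
  using assms(5)
proof (induction rule: induct)
  case zero
  show ?case
    by (rule linear_map_cong[OF assms(1) linear_map_zero_fun[OF assms(1,2)]])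
      (use linear_map_zero[OF P_module assms(2) good_linear[OF assms(2,3)]] in simp)
next
  case (add s t)
  show ?case
    by (rule linear_map_cong[OF assms(1) linear_map_add_fun[OF assms(1,2) add(3,4)]])
      (simp add: add(1,2) linear_mapD[OF good_linear[OF assms(2,3)]])
next
  case (smult k t)
  show ?case
    by (rule linear_map_cong[OF assms(1) linear_map_smult_fun[OF assms(1,2) smult(3,1)]])
      (simp add: smult(1,2) linear_mapD[OF good_linear[OF assms(2,3)]])
next
  case (gen g)
  show ?case
    by (rule linear_map_cong[OF assms(1) assms(4)[OF gen]]) (simp add: good_gen assms gen)
qed

lemma sweedler_cong:
  assumes "module K X" "good X \<phi>" "t \<in> carrier P" "\<And>g. g \<in> G \<Longrightarrow> \<phi> g = \<psi> g"
  shows "sweedler K X t \<phi> = sweedler K X t \<psi>"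
proof -
  interpret X: module K X by fact
  have \<phi>: "\<phi> \<in> G \<rightarrow> carrier X" using assms(2) by (simp add: good_def)
  have fl: "free_lift K X \<phi> u = free_lift K X \<psi> u" if "u \<in> carrier F" for u
  proof -
    have u: "{g. u g \<noteq> \<zero>\<^bsub>K\<^esub>} \<subseteq> G" "\<And>g. u g \<in> carrier K" using that by (auto simp: free_module_def)
    show ?thesis unfolding free_lift_def
    proof (rule X.M.finsum_cong'[OF refl])
      show "(\<lambda>g. u g \<odot>\<^bsub>X\<^esub> \<psi> g) \<in> {g. u g \<noteq> \<zero>\<^bsub>K\<^esub>} \<rightarrow> carrier X"
      proof (intro funcsetI X.smult_closed u)
        fix g assume "g \<in> {g. u g \<noteq> \<zero>\<^bsub>K\<^esub>}"
        then have "g \<in> G" using u by blast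
        then show "\<psi> g \<in> carrier X" using Pi_mem[OF \<phi>, of g] assms(4)[of g] by simp
      qed
      fix g assume "g \<in> {g. u g \<noteq> \<zero>\<^bsub>K\<^esub>}"
      then have "g \<in> G" using u by blast
      then show "u g \<odot>\<^bsub>X\<^esub> \<phi> g = u g \<odot>\<^bsub>X\<^esub> \<psi> g" using assms(4) by simp
    qed
  qed
  have \<psi>: "good X \<psi>" unfolding good_def
  proof (intro conjI ballI funcsetI)
    show "\<psi> g \<in> carrier X" if "g \<in> G" for g using Pi_mem[OF \<phi> that] assms(4)[OF that] by simp
    fix r assume r: "r \<in> R"
    then have "free_lift K X \<phi> r = \<zero>\<^bsub>X\<^esub>" using assms(2) by (simp add: good_def)
    moreover have "r \<in> carrier F" using r R by auto
    ultimately show "free_lift K X \<psi> r = \<zero>\<^bsub>X\<^esub>" using fl by simp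
  qed
  show ?thesis
    by (rule linear_eq[OF assms(1) good_linear[OF assms(1,2)] good_linear[OF assms(1) \<psi>] _ assms(3)])
      (simp add: good_gen assms \<psi>)
qed

lemma slot_good:
  assumes "module K Y" "module K X" "\<phi> \<in> G \<rightarrow> carrier Y" "\<And>\<iota>. \<iota> \<in> I \<Longrightarrow> \<iota> \<in> carrier X \<rightarrow> G"
    "\<And>\<iota>. \<iota> \<in> I \<Longrightarrow> linear_map K X Y (\<lambda>x. \<phi> (\<iota> x))"
    "r \<in> slot_rels K F X I"
  shows "free_lift K Y \<phi> r = \<zero>\<^bsub>Y\<^esub>"
proof -
  interpret X: module K X by fact
  interpret Y: module K Y by fact
  interpret F: module K F by (rule F_module)
  note fl = free_lift_linear[OF assms(1,3)]
  note gc = free_gen_carrier[OF K.is_cring]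
  note m = linear_map_minus[OF F_module assms(1) fl]
  have G: "\<iota> x \<in> G" if "\<iota> \<in> I" "x \<in> carrier X" for \<iota> x using assms(4) that by auto
  have Ym: "y \<ominus>\<^bsub>Y\<^esub> y = \<zero>\<^bsub>Y\<^esub>" if "y \<in> carrier Y" for y
    using that by (simp add: a_minus_def Y.M.r_neg)
  from assms(6) consider
    (a) \<iota> x y where "\<iota> \<in> I" "x \<in> carrier X" "y \<in> carrier X"
      "r = free_gen K (\<iota> (x \<oplus>\<^bsub>X\<^esub> y)) \<ominus>\<^bsub>F\<^esub> (free_gen K (\<iota> x) \<oplus>\<^bsub>F\<^esub> free_gen K (\<iota> y))"
  | (s) \<iota> k x where "\<iota> \<in> I" "k \<in> carrier K" "x \<in> carrier X"
      "r = free_gen K (\<iota> (k \<odot>\<^bsub>X\<^esub> x)) \<ominus>\<^bsub>F\<^esub> k \<odot>\<^bsub>F\<^esub> free_gen K (\<iota> x)"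
    unfolding slot_rels_def by blast
  then show ?thesis
  proof cases
    case a
    have mem: "\<phi> (\<iota> x) \<in> carrier Y" "\<phi> (\<iota> y) \<in> carrier Y" using G a assms(3) by blast+
    show ?thesis unfolding a(4) using a(1-3) mem
      by (simp add: m gc G linear_mapD[OF fl] free_lift_gen[OF assms(1,3)]
          linear_mapD[OF assms(5)[OF a(1)]] Ym)
  next
    case s
    have mem: "\<phi> (\<iota> x) \<in> carrier Y" using G s assms(3) by blast
    show ?thesis unfolding s(4) using s(1-3) mem
      by (simp add: m gc G linear_mapD[OF fl] free_lift_gen[OF assms(1,3)]
          linear_mapD[OF assms(5)[OF s(1)]] Ym)
  qed
qed

lemma slot_linear:
  assumes "module K X" "\<iota> \<in> I" "\<And>\<iota>. \<iota> \<in> I \<Longrightarrow> \<iota> \<in> carrier X \<rightarrow> G" "slot_rels K F X I \<subseteq> R"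
  shows "linear_map K X P (\<lambda>x. presented_gen K G R (\<iota> x))"
proof -
  interpret X: module K X by fact
  interpret F: module K F by (rule F_module)
  note ms = F_module H_submodule
  have G: "\<iota> x \<in> G" if "x \<in> carrier X" for x using assms(2,3) that by auto
  note gc = free_gen_carrier[OF K.is_cring G]
  show ?thesis
  proof (rule linear_mapI)
    fix x assume x: "x \<in> carrier X"
    show "presented_gen K G R (\<iota> x) \<in> carrier P" using gen_closed G x by simp
    fix k assume k: "k \<in> carrier K"
    have "free_gen K (\<iota> (k \<odot>\<^bsub>X\<^esub> x)) \<ominus>\<^bsub>F\<^esub> k \<odot>\<^bsub>F\<^esub> free_gen K (\<iota> x) \<in> R"
      by (rule subsetD[OF assms(4)], unfold slot_rels_def, rule UnI2, rule CollectI)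
        (intro exI conjI, rule refl, rule assms(2), rule k, rule x)
    then have "presented_gen K G R (\<iota> (k \<odot>\<^bsub>X\<^esub> x)) = H +>\<^bsub>F\<^esub> (k \<odot>\<^bsub>F\<^esub> free_gen K (\<iota> x))"
      unfolding presented_gen_def using x k gc by (intro rel_gen) simp_all
    also have "\<dots> = k \<odot>\<^bsub>P\<^esub> presented_gen K G R (\<iota> x)"
      unfolding presented_def presented_gen_def by (rule quot_module_smult[OF ms gc[OF x] k, symmetric])
    finally show "presented_gen K G R (\<iota> (k \<odot>\<^bsub>X\<^esub> x)) = k \<odot>\<^bsub>P\<^esub> presented_gen K G R (\<iota> x)" .
  next
    fix x y assume x: "x \<in> carrier X" and y: "y \<in> carrier X"
    have "free_gen K (\<iota> (x \<oplus>\<^bsub>X\<^esub> y)) \<ominus>\<^bsub>F\<^esub> (free_gen K (\<iota> x) \<oplus>\<^bsub>F\<^esub> free_gen K (\<iota> y)) \<in> R"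
      by (rule subsetD[OF assms(4)], unfold slot_rels_def, rule UnI1, rule CollectI)
        (intro exI conjI, rule refl, rule assms(2), rule x, rule y)
    then have "presented_gen K G R (\<iota> (x \<oplus>\<^bsub>X\<^esub> y)) = H +>\<^bsub>F\<^esub> (free_gen K (\<iota> x) \<oplus>\<^bsub>F\<^esub> free_gen K (\<iota> y))"
      unfolding presented_gen_def using x y gc by (intro rel_gen) simp_all
    also have "\<dots> = presented_gen K G R (\<iota> x) \<oplus>\<^bsub>P\<^esub> presented_gen K G R (\<iota> y)"
      unfolding presented_def presented_gen_def by (rule quot_module_add[OF ms gc[OF x] gc[OF y], symmetric])
    finally show "presented_gen K G R (\<iota> (x \<oplus>\<^bsub>X\<^esub> y)) =
        presented_gen K G R (\<iota> x) \<oplus>\<^bsub>P\<^esub> presented_gen K G R (\<iota> y)" .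
  qed
qed

end

lemma slot_rels_carrier:
  assumes "cring K" "module K X" "\<And>\<iota>. \<iota> \<in> I \<Longrightarrow> \<iota> \<in> carrier X \<rightarrow> G"
  shows "slot_rels K (free_module K G) X I \<subseteq> carrier (free_module K G)"
proof -
  interpret F: module K "free_module K G" by (rule free_module_module) fact
  interpret X: module K X by fact
  have G: "free_gen K (\<iota> x) \<in> carrier (free_module K G)" if "\<iota> \<in> I" "x \<in> carrier X" for \<iota> x
    by (rule free_gen_carrier[OF assms(1) Pi_mem[OF assms(3)[OF that(1)] that(2)]])
  show ?thesis
  proof
    fix r assume "r \<in> slot_rels K (free_module K G) X I"
    then consider
      (a) \<iota> x y where "\<iota> \<in> I" "x \<in> carrier X" "y \<in> carrier X"
        "r = free_gen K (\<iota> (x \<oplus>\<^bsub>X\<^esub> y)) \<ominus>\<^bsub>free_module K G\<^esub> (free_gen K (\<iota> x) \<oplus>\<^bsub>free_module K G\<^esub> free_gen K (\<iota> y))"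
    | (s) \<iota> k x where "\<iota> \<in> I" "k \<in> carrier K" "x \<in> carrier X"
        "r = free_gen K (\<iota> (k \<odot>\<^bsub>X\<^esub> x)) \<ominus>\<^bsub>free_module K G\<^esub> k \<odot>\<^bsub>free_module K G\<^esub> free_gen K (\<iota> x)"
      unfolding slot_rels_def by blast
    then show "r \<in> carrier (free_module K G)"
    proof cases
      case a
      show ?thesis unfolding a(4) using G[OF a(1)] a(2,3) by (simp add: a_minus_def)
    next
      case s
      show ?thesis unfolding s(4) using G[OF s(1)] s(2,3) by (simp add: a_minus_def)
    qed
  qed
qed


section \<open>Bilinear maps and tensor products\<close>

definition bilinear_map where
  "bilinear_map K V W X \<phi> \<longleftrightarrow>
    (\<forall>w\<in>carrier W. linear_map K V X (\<lambda>v. \<phi> v w)) \<and>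
    (\<forall>v\<in>carrier V. linear_map K W X (\<lambda>w. \<phi> v w))"

locale two_modules = V: module K V + W: module K W
  for K :: "('k, 'q) ring_scheme" and V :: "('k, 'v, 'r) module_scheme"
    and W :: "('k, 'w, 's) module_scheme"
begin

lemma ten_rels_carrier: "ten_rels K V W \<subseteq> carrier (free_module K (carrier V \<times> carrier W))"
  unfolding ten_rels_def Let_def
  by (intro Un_least slot_rels_carrier V.R.is_cring V.module_axioms W.module_axioms) auto

sublocale T: presentation K "carrier V \<times> carrier W" "ten_rels K V W"
  using ten_rels_carrier by unfold_locales

lemma tensor_module: "module K (tensor K V W)"
  unfolding tensor_def by (rule T.P_module)

lemma good_bilinear:
  assumes "module K X" "bilinear_map K V W X \<phi>"
  shows "T.good X (\<lambda>(v, w). \<phi> v w)"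
proof -
  have mem: "(\<lambda>(v, w). \<phi> v w) \<in> carrier V \<times> carrier W \<rightarrow> carrier X"
    using assms(2) by (auto simp: bilinear_map_def linear_mapD)
  have 1: "free_lift K X (\<lambda>(v, w). \<phi> v w) r = \<zero>\<^bsub>X\<^esub>"
    if "r \<in> slot_rels K (free_module K (carrier V \<times> carrier W)) V {\<lambda>v. (v, w) | w. w \<in> carrier W}" for r
    by (rule T.slot_good[OF assms(1) V.module_axioms mem _ _ that])
      (use assms(2) in \<open>auto simp: bilinear_map_def\<close>)
  have 2: "free_lift K X (\<lambda>(v, w). \<phi> v w) r = \<zero>\<^bsub>X\<^esub>"
    if "r \<in> slot_rels K (free_module K (carrier V \<times> carrier W)) W {\<lambda>w. (v, w) | v. v \<in> carrier V}" for r
    by (rule T.slot_good[OF assms(1) W.module_axioms mem _ _ that])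
      (use assms(2) in \<open>auto simp: bilinear_map_def\<close>)
  show ?thesis unfolding T.good_def using mem 1 2 by (auto simp: ten_rels_def Let_def)
qed

lemma ten_bilinear: "bilinear_map K V W (tensor K V W) (ten K V W)"
  unfolding bilinear_map_def
proof (intro conjI ballI)
  fix w assume w: "w \<in> carrier W"
  show "linear_map K V (tensor K V W) (\<lambda>v. ten K V W v w)"
    unfolding tensor_def ten_def
    by (rule T.slot_linear[OF V.module_axioms, where I = "{\<lambda>v. (v, w) | w. w \<in> carrier W}"])
      (use w in \<open>auto simp: ten_rels_def Let_def\<close>)
next
  fix v assume v: "v \<in> carrier V"
  show "linear_map K W (tensor K V W) (\<lambda>w. ten K V W v w)"
    unfolding tensor_def ten_def
    by (rule T.slot_linear[OF W.module_axioms, where I = "{\<lambda>w. (v, w) | v. v \<in> carrier V}"])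
      (use v in \<open>auto simp: ten_rels_def Let_def\<close>)
qed

lemma ten_closed: "v \<in> carrier V \<Longrightarrow> w \<in> carrier W \<Longrightarrow> ten K V W v w \<in> carrier (tensor K V W)"
  unfolding ten_def tensor_def by (rule T.gen_closed) auto

lemma sw_ten:
  assumes "module K X" "bilinear_map K V W X \<phi>" "v \<in> carrier V" "w \<in> carrier W"
  shows "sweedler K X (ten K V W v w) (\<lambda>(v, w). \<phi> v w) = \<phi> v w"
  unfolding ten_def using T.good_gen[OF assms(1) good_bilinear[OF assms(1,2)], of "(v, w)"] assms by simp

lemma sw_linear:
  assumes "module K X" "bilinear_map K V W X \<phi>"
  shows "linear_map K (tensor K V W) X (\<lambda>t. sweedler K X t (\<lambda>(v, w). \<phi> v w))"
  unfolding tensor_def by (rule T.good_linear[OF assms(1) good_bilinear[OF assms]])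

lemma tensor_eq:
  assumes "module K X" "linear_map K (tensor K V W) X f" "linear_map K (tensor K V W) X h"
    "\<And>v w. v \<in> carrier V \<Longrightarrow> w \<in> carrier W \<Longrightarrow> f (ten K V W v w) = h (ten K V W v w)"
    "t \<in> carrier (tensor K V W)"
  shows "f t = h t"
  by (rule T.linear_eq[OF assms(1)]) (use assms in \<open>auto simp: tensor_def ten_def\<close>)

lemma bilinear_comp:
  assumes "bilinear_map K V W X \<phi>" "linear_map K X Y L"
  shows "bilinear_map K V W Y (\<lambda>v w. L (\<phi> v w))"
  using assms by (auto simp: bilinear_map_def intro: linear_map_comp[OF _ assms(2)])

lemma sw_comp:
  assumes "module K X" "module K Y" "bilinear_map K V W X \<phi>" "linear_map K X Y L"
    "t \<in> carrier (tensor K V W)"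
  shows "L (sweedler K X t (\<lambda>(v, w). \<phi> v w)) = sweedler K Y t (\<lambda>(v, w). L (\<phi> v w))"
proof (rule tensor_eq[OF assms(2) _ _ _ assms(5)])
  note b = bilinear_comp[OF assms(3,4)]
  show "linear_map K (tensor K V W) Y (\<lambda>t. L (sweedler K X t (\<lambda>(v, w). \<phi> v w)))"
    by (rule linear_map_comp[OF sw_linear[OF assms(1,3)] assms(4)])
  show "linear_map K (tensor K V W) Y (\<lambda>t. sweedler K Y t (\<lambda>(v, w). L (\<phi> v w)))"
    by (rule sw_linear[OF assms(2) b])
  show "L (sweedler K X (ten K V W v w) (\<lambda>(v, w). \<phi> v w)) =
      sweedler K Y (ten K V W v w) (\<lambda>(v, w). L (\<phi> v w))"
    if "v \<in> carrier V" "w \<in> carrier W" for v w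
    using that by (simp add: sw_ten[OF assms(1,3)] sw_ten[OF assms(2) b])
qed

lemma sw_param:
  assumes "module K U" "module K X" "\<And>u. u \<in> carrier U \<Longrightarrow> bilinear_map K V W X (\<phi> u)"
    "\<And>v w. v \<in> carrier V \<Longrightarrow> w \<in> carrier W \<Longrightarrow> linear_map K U X (\<lambda>u. \<phi> u v w)"
    "t \<in> carrier (tensor K V W)"
  shows "linear_map K U X (\<lambda>u. sweedler K X t (\<lambda>(v, w). \<phi> u v w))"
  by (rule T.sweedler_param[OF assms(1,2)])
    (use assms(4,5) good_bilinear[OF assms(2,3)] in \<open>auto simp: tensor_def\<close>)

lemma sw_cong:
  assumes "module K X" "bilinear_map K V W X \<phi>" "t \<in> carrier (tensor K V W)"
    "\<And>v w. v \<in> carrier V \<Longrightarrow> w \<in> carrier W \<Longrightarrow> \<phi> v w = \<psi> v w"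
  shows "sweedler K X t (\<lambda>(v, w). \<phi> v w) = sweedler K X t (\<lambda>(v, w). \<psi> v w)"
  by (rule T.sweedler_cong[OF assms(1) good_bilinear[OF assms(1,2)]]) (use assms in \<open>auto simp: tensor_def\<close>)

lemma bilinear_cong:
  assumes "bilinear_map K V W X \<phi>"
    "\<And>v w. v \<in> carrier V \<Longrightarrow> w \<in> carrier W \<Longrightarrow> \<phi> v w = \<psi> v w"
  shows "bilinear_map K V W X \<psi>"
  unfolding bilinear_map_def
proof (intro conjI ballI)
  show "linear_map K V X (\<lambda>v. \<psi> v w)" if "w \<in> carrier W" for w
    by (rule linear_map_cong[OF V.module_axioms, of _ "\<lambda>v. \<phi> v w"])
      (use assms that in \<open>auto simp: bilinear_map_def\<close>)
  show "linear_map K W X (\<lambda>w. \<psi> v w)" if "v \<in> carrier V" for v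
    by (rule linear_map_cong[OF W.module_axioms, of _ "\<lambda>w. \<phi> v w"])
      (use assms that in \<open>auto simp: bilinear_map_def\<close>)
qed

end

lemma bilinearI:
  "(\<And>w. w \<in> carrier W \<Longrightarrow> linear_map K V X (\<lambda>v. \<phi> v w)) \<Longrightarrow>
   (\<And>v. v \<in> carrier V \<Longrightarrow> linear_map K W X (\<lambda>w. \<phi> v w)) \<Longrightarrow> bilinear_map K V W X \<phi>"
  by (simp add: bilinear_map_def)

lemma bilinearD:
  assumes "bilinear_map K V W X \<phi>"
  shows "w \<in> carrier W \<Longrightarrow> linear_map K V X (\<lambda>v. \<phi> v w)"
    "v \<in> carrier V \<Longrightarrow> linear_map K W X (\<lambda>w. \<phi> v w)"
  using assms by (simp_all add: bilinear_map_def)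

lemma (in two_modules) tenr2:
  "module K (tensorr K V W 2)"
  "v \<in> carrier V \<Longrightarrow> a \<in> carrier W \<Longrightarrow> linear_map K W (tensorr K V W 2) (\<lambda>b. tenr K V W 2 v [a, b])"
  "v \<in> carrier V \<Longrightarrow> b \<in> carrier W \<Longrightarrow> linear_map K W (tensorr K V W 2) (\<lambda>a. tenr K V W 2 v [a, b])"
  "a \<in> carrier W \<Longrightarrow> b \<in> carrier W \<Longrightarrow> linear_map K V (tensorr K V W 2) (\<lambda>v. tenr K V W 2 v [a, b])"
proof -
  have wl: "\<And>n x as i. as \<in> words W n \<Longrightarrow> i < n \<Longrightarrow> x \<in> carrier W \<Longrightarrow> as[i := x] \<in> words W n"
    by (auto simp: words_def dest!: set_update_subset_insert[THEN subsetD])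
  have c: "tenr_rels K V W 2 \<subseteq> carrier (free_module K (carrier V \<times> words W 2))"
    unfolding tenr_rels_def Let_def
    by (intro Un_least slot_rels_carrier V.R.is_cring V.module_axioms W.module_axioms) (auto intro: wl)
  interpret S: presentation K "carrier V \<times> words W 2" "tenr_rels K V W 2" using c by unfold_locales
  show "module K (tensorr K V W 2)" unfolding tensorr_def by (rule S.P_module)
  let ?I = "{\<lambda>a. (n, as[i := a]) | n as i. n \<in> carrier V \<and> as \<in> words W 2 \<and> i < 2}"
  have sl: "linear_map K W (tensorr K V W 2) (\<lambda>b. tenr K V W 2 v (as[i := b]))"
    if "v \<in> carrier V" "as \<in> words W 2" "i < 2" for v as i
    unfolding tensorr_def tenr_def
    by (rule S.slot_linear[OF W.module_axioms, where I = ?I])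
     (use that wl in \<open>auto simp: tenr_rels_def Let_def\<close>)
  show "linear_map K W (tensorr K V W 2) (\<lambda>b. tenr K V W 2 v [a, b])" if "v \<in> carrier V" "a \<in> carrier W"
    using sl[OF that(1), of "[a, a]" 1] that by (simp add: words_def)
  show "linear_map K W (tensorr K V W 2) (\<lambda>a. tenr K V W 2 v [a, b])" if "v \<in> carrier V" "b \<in> carrier W"
    using sl[OF that(1), of "[b, b]" 0] that by (simp add: words_def)
  show "linear_map K V (tensorr K V W 2) (\<lambda>v. tenr K V W 2 v [a, b])" if "a \<in> carrier W" "b \<in> carrier W"
    unfolding tensorr_def tenr_def
    by (rule S.slot_linear[OF V.module_axioms, where I = "{\<lambda>n. (n, as) | as. as \<in> words W 2}"])
      (use that in \<open>auto simp: tenr_rels_def Let_def words_def\<close>)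
qed


section \<open>The Hopf module structure on a free module\<close>

lemma hmod_ops:
  "carrier (free_hmod K V A) = carrier (tensor K V A)"
  "add (free_hmod K V A) = add (tensor K V A)"
  "zero (free_hmod K V A) = zero (tensor K V A)"
  "smult (free_hmod K V A) = smult (tensor K V A)"
  "act (free_hmod K V A) = (\<lambda>a t. sweedler K (tensor K V A) t (\<lambda>(v, b). ten K V A v (a \<otimes>\<^bsub>A\<^esub> b)))"
  "coact (free_hmod K V A) = (\<lambda>t. sweedler K (tensor K (tensor K V A) A) t (\<lambda>(v, b).
        sweedler K (tensor K (tensor K V A) A) (comult A b) (\<lambda>(b1, b2).
          ten K (tensor K V A) A (ten K V A v b1) b2)))"
  by (simp_all add: free_hmod_def module.defs)

lemma finsum_cong_ops:
  assumes "carrier X = carrier Y" "add X = add Y" "zero X = zero Y"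
  shows "finsum X = finsum Y"
  by (intro ext) (simp add: finsum_def finprod_def assms foldD_def)

lemma ops_cong:
  assumes "carrier X = carrier Y" "add X = add Y" "zero X = zero Y" "smult X = smult Y"
  shows "linear_map K Z X f = linear_map K Z Y f" "linear_map K X Z g = linear_map K Y Z g"
    "slot_rels K F X I = slot_rels K F Y I"
    "sweedler K X t \<phi> = sweedler K Y t \<phi>"
  unfolding linear_map_def slot_rels_def sweedler_def free_lift_def assms finsum_cong_ops[OF assms(1-3)]
  by simp_all

lemma hmod_tens:
  "tensor K (free_hmod K V A) B = tensor K (tensor K V A) B"
  "ten K (free_hmod K V A) B = ten K (tensor K V A) B"
  "tensorr K (free_hmod K V A) B n = tensorr K (tensor K V A) B n"
  "tenr K (free_hmod K V A) B n = tenr K (tensor K V A) B n"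
proof -
  have t: "ten_rels K (free_hmod K V A) B = ten_rels K (tensor K V A) B"
    unfolding ten_rels_def ops_cong(3)[OF hmod_ops(1-4)] hmod_ops(1) ..
  have r: "tenr_rels K (free_hmod K V A) B n = tenr_rels K (tensor K V A) B n"
    unfolding tenr_rels_def ops_cong(3)[OF hmod_ops(1-4)] hmod_ops(1) ..
  show "tensor K (free_hmod K V A) B = tensor K (tensor K V A) B"
    "tensorr K (free_hmod K V A) B n = tensorr K (tensor K V A) B n"
    unfolding tensor_def[of K "free_hmod K V A"] tensor_def[of K "tensor K V A"]
      tensorr_def t r hmod_ops(1) by rule+
  show "ten K (free_hmod K V A) B = ten K (tensor K V A) B"
    by (intro ext) (simp only: ten_def t hmod_ops(1))
  show "tenr K (free_hmod K V A) B n = tenr K (tensor K V A) B n"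
    by (intro ext) (simp only: tenr_def r hmod_ops(1))
qed

lemma hmod_module:
  assumes "module K (tensor K V A)" shows "module K (free_hmod K V A)"
proof -
  interpret T: module K "tensor K V A" by fact
  show ?thesis
  proof (rule moduleI[OF T.R.is_cring])
    show "abelian_group (free_hmod K V A)"
      by (rule abelian_groupI; unfold hmod_ops)
        (auto simp: T.M.a_ac intro: bexI[of _ "\<ominus>\<^bsub>tensor K V A\<^esub> x" for x] T.M.l_neg)
  qed (simp_all add: hmod_ops T.smult_l_distr T.smult_r_distr T.smult_assoc1)
qed

lemmas hmod_cong = ops_cong[OF hmod_ops(1-4)]

locale hopf_setup = bialgebra K A + V: module K V
  for K :: "('k, 'q) ring_scheme" and A :: "('k, 'a, 'r) bialg_scheme"
    and V :: "('k, 'v, 's) module_scheme"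
begin

abbreviation "T \<equiv> tensor K V A"
abbreviation "TA \<equiv> tensor K T A"
abbreviation "AA \<equiv> tensor K A A"
abbreviation "T3 \<equiv> tensorr K T A 2"
abbreviation "A3 \<equiv> tensorr K A A 2"

lemma A_module: "module K A" ..
lemma V_module: "module K V" ..

sublocale VA: two_modules K V A by unfold_locales
sublocale AA: two_modules K A A by unfold_locales
lemma T_module: "module K T" by (rule VA.tensor_module)
lemma AA_module: "module K AA" by (rule AA.tensor_module)
sublocale TA: two_modules K T A
  using T_module A_module by (simp add: two_modules_def)
lemma TA_module: "module K TA" by (rule TA.tensor_module)
lemmas T3_module = TA.tenr2(1) and A3_module = AA.tenr2(1)

abbreviation "ac \<equiv> \<lambda>a t. sweedler K T t (\<lambda>(v, b). ten K V A v (a \<otimes>\<^bsub>A\<^esub> b))"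
abbreviation "co0 \<equiv> \<lambda>v s. sweedler K TA s (\<lambda>(b1, b2). ten K T A (ten K V A v b1) b2)"
abbreviation "co \<equiv> \<lambda>t. sweedler K TA t (\<lambda>(v, b). co0 v (comult A b))"

lemma mult_lin: "a \<in> carrier A \<Longrightarrow> linear_map K A A (\<lambda>b. a \<otimes>\<^bsub>A\<^esub> b)"
  "a \<in> carrier A \<Longrightarrow> linear_map K A A (\<lambda>b. b \<otimes>\<^bsub>A\<^esub> a)"
  by (rule linear_mapI; simp add: A.r_distr A.l_distr smult_mult_left smult_mult_right)+

lemmas ten_lin = bilinearD[OF VA.ten_bilinear] and Tten_lin = bilinearD[OF TA.ten_bilinear]
  and AAten_lin = bilinearD[OF AA.ten_bilinear]

lemma ac_bil: "a \<in> carrier A \<Longrightarrow> bilinear_map K V A T (\<lambda>v b. ten K V A v (a \<otimes>\<^bsub>A\<^esub> b))"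
  by (rule bilinearI) (auto intro: ten_lin linear_map_comp[OF mult_lin(1) ten_lin(2)])

lemma ac_ten: "a \<in> carrier A \<Longrightarrow> v \<in> carrier V \<Longrightarrow> b \<in> carrier A \<Longrightarrow>
    ac a (ten K V A v b) = ten K V A v (a \<otimes>\<^bsub>A\<^esub> b)"
  by (rule VA.sw_ten[OF T_module ac_bil])

lemma ac_lin: "a \<in> carrier A \<Longrightarrow> linear_map K T T (ac a)"
  by (rule VA.sw_linear[OF T_module ac_bil])

lemma ac_lin2: "t \<in> carrier T \<Longrightarrow> linear_map K A T (\<lambda>a. ac a t)"
  by (rule VA.sw_param[OF A_module T_module ac_bil])
    (auto intro: linear_map_comp[OF mult_lin(2) ten_lin(2)])

lemma cm_closed: "b \<in> carrier A \<Longrightarrow> comult A b \<in> carrier AA"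
  by (rule linear_mapD(1)[OF comult_linear])

lemma co0_bil: "v \<in> carrier V \<Longrightarrow> bilinear_map K A A TA (\<lambda>b1 b2. ten K T A (ten K V A v b1) b2)"
  by (rule bilinearI) (auto intro: linear_map_comp[OF ten_lin(2) Tten_lin(1)] Tten_lin VA.ten_closed)

lemma co_bil: "bilinear_map K V A TA (\<lambda>v b. co0 v (comult A b))"
proof (rule bilinearI)
  show "linear_map K V TA (\<lambda>v. co0 v (comult A b))" if "b \<in> carrier A" for b
    by (rule AA.sw_param[OF V_module TA_module co0_bil _ cm_closed[OF that]])
      (auto intro: linear_map_comp[OF ten_lin(1) Tten_lin(1)])
  show "linear_map K A TA (\<lambda>b. co0 v (comult A b))" if "v \<in> carrier V" for v
    by (rule linear_map_comp[OF comult_linear AA.sw_linear[OF TA_module co0_bil[OF that]]])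
qed

lemma co_ten: "v \<in> carrier V \<Longrightarrow> b \<in> carrier A \<Longrightarrow> co (ten K V A v b) = co0 v (comult A b)"
  by (rule VA.sw_ten[OF TA_module co_bil])

lemma co_lin: "linear_map K T TA co" by (rule VA.sw_linear[OF TA_module co_bil])

lemma sw_co0:
  assumes "module K X" "bilinear_map K T A X \<psi>" "v \<in> carrier V" "s \<in> carrier AA"
  shows "sweedler K X (co0 v s) (\<lambda>(x, y). \<psi> x y) = sweedler K X s (\<lambda>(b1, b2). \<psi> (ten K V A v b1) b2)"
proof -
  note L = TA.sw_linear[OF assms(1,2)]
  have "sweedler K X (co0 v s) (\<lambda>(x, y). \<psi> x y) =
    sweedler K X s (\<lambda>(b1, b2). sweedler K X (ten K T A (ten K V A v b1) b2) (\<lambda>(x, y). \<psi> x y))"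
    by (rule AA.sw_comp[OF TA_module assms(1) co0_bil[OF assms(3)] L assms(4)])
  also have "\<dots> = sweedler K X s (\<lambda>(b1, b2). \<psi> (ten K V A v b1) b2)"
    by (rule AA.sw_cong[OF assms(1) AA.bilinear_comp[OF co0_bil[OF assms(3)] L] assms(4)])
      (simp add: TA.sw_ten[OF assms(1,2)] VA.ten_closed assms)
  finally show ?thesis .
qed

lemma act_one: assumes "t \<in> carrier T" shows "ac \<one>\<^bsub>A\<^esub> t = t"
  by (rule VA.tensor_eq[OF T_module ac_lin _ _ assms]) (auto simp: ac_ten linear_map_def)

lemma act_mult: assumes "a \<in> carrier A" "b \<in> carrier A" "t \<in> carrier T"
  shows "ac (a \<otimes>\<^bsub>A\<^esub> b) t = ac a (ac b t)"
  by (rule VA.tensor_eq[OF T_module ac_lin linear_map_comp[OF ac_lin ac_lin] _ assms(3)])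
    (simp_all add: ac_ten A.m_assoc assms)

lemma co_counit: assumes "t \<in> carrier T"
  shows "sweedler K T (co t) (\<lambda>(x, y). counit A y \<odot>\<^bsub>T\<^esub> x) = t"
proof -
  interpret T: module K T by (rule T_module)
  note e = ring_hom_add[OF counit_ring_hom] ring_hom_closed[OF counit_ring_hom]
  have id: "linear_map K X X (\<lambda>x. x)" for X :: "('k, 'z, 'y) module_scheme" by (simp add: linear_map_def)
  have bil: "bilinear_map K X A X (\<lambda>x y. counit A y \<odot>\<^bsub>X\<^esub> x)" if X: "module K X" 
    for X :: "('k, 'z, 'y) module_scheme"
  proof -
    interpret X: module K X by fact
    show ?thesis
    proof (rule bilinearI)
      show "linear_map K X X (\<lambda>x. counit A y \<odot>\<^bsub>X\<^esub> x)" if "y \<in> carrier A" for y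
        by (rule linear_map_smult_fun[OF X X id e(2)[OF that]])
      show "linear_map K A X (\<lambda>y. counit A y \<odot>\<^bsub>X\<^esub> x)" if "x \<in> carrier X" for x
        by (rule linear_mapI) (simp_all add: that e counit_smult X.smult_l_distr X.smult_assoc1)
    qed
  qed
  note bA = bil[OF A_module] and bT = bil[OF T_module]
  show ?thesis
  proof (rule VA.tensor_eq[OF T_module _ _ _ assms])
    show "linear_map K T T (\<lambda>t. sweedler K T (co t) (\<lambda>(x, y). counit A y \<odot>\<^bsub>T\<^esub> x))"
      by (rule linear_map_comp[OF co_lin TA.sw_linear[OF T_module bT]])
    show "linear_map K T T (\<lambda>t. t)" by (simp add: linear_map_def)
    fix v b assume v: "v \<in> carrier V" and b: "b \<in> carrier A"
    have "sweedler K T (co (ten K V A v b)) (\<lambda>(x, y). counit A y \<odot>\<^bsub>T\<^esub> x) =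
      sweedler K T (comult A b) (\<lambda>(b1, b2). counit A b2 \<odot>\<^bsub>T\<^esub> ten K V A v b1)"
      unfolding co_ten[OF v b] by (rule sw_co0[OF T_module bT v cm_closed[OF b]])
    also have "\<dots> = sweedler K T (comult A b) (\<lambda>(b1, b2). ten K V A v (counit A b2 \<odot>\<^bsub>A\<^esub> b1))"
      by (rule AA.sw_cong[symmetric, OF T_module AA.bilinear_comp[OF bA ten_lin(2)[OF v]] cm_closed[OF b]])
        (simp add: linear_mapD[OF ten_lin(2)[OF v]] e)
    also have "\<dots> = ten K V A v (sweedler K A (comult A b) (\<lambda>(b1, b2). counit A b2 \<odot>\<^bsub>A\<^esub> b1))"
      by (rule AA.sw_comp[symmetric, OF A_module T_module bA ten_lin(2)[OF v] cm_closed[OF b]])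
    finally show "sweedler K T (co (ten K V A v b)) (\<lambda>(x, y). counit A y \<odot>\<^bsub>T\<^esub> x) = ten K V A v b"
      by (simp add: counit_right b)
  qed
qed


lemma co_act: assumes a: "a \<in> carrier A" and t: "t \<in> carrier T"
  shows "co (ac a t) = sweedler K TA (comult A a) (\<lambda>(a1, a2).
    sweedler K TA (co t) (\<lambda>(m0, m1). ten K T A (ac a1 m0) (a2 \<otimes>\<^bsub>A\<^esub> m1)))"
proof -
  have b1: "bilinear_map K T A TA (\<lambda>m0 m1. ten K T A (ac a1 m0) (a2 \<otimes>\<^bsub>A\<^esub> m1))"
    if "a1 \<in> carrier A" "a2 \<in> carrier A" for a1 a2
    by (rule bilinearI)
      (auto intro: linear_map_comp[OF ac_lin Tten_lin(1)] linear_map_comp[OF mult_lin(1) Tten_lin(2)]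
        linear_mapD[OF ac_lin] that)
  let ?g = "\<lambda>s a1 a2. sweedler K TA s (\<lambda>(m0, m1). ten K T A (ac a1 m0) (a2 \<otimes>\<^bsub>A\<^esub> m1))"
  have b2: "bilinear_map K A A TA (?g s)" if s: "s \<in> carrier TA" for s
  proof (rule bilinearI)
    show "linear_map K A TA (\<lambda>a1. ?g s a1 a2)" if "a2 \<in> carrier A" for a2
      by (rule TA.sw_param[OF A_module TA_module b1 _ s])
        (auto intro: linear_map_comp[OF ac_lin2 Tten_lin(1)] that)
    show "linear_map K A TA (\<lambda>a2. ?g s a1 a2)" if "a1 \<in> carrier A" for a1
      by (rule TA.sw_param[OF A_module TA_module b1 _ s])
        (auto intro: linear_map_comp[OF mult_lin(2) Tten_lin(2)] linear_mapD[OF ac_lin] that)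
  qed
  have R: "linear_map K T TA (\<lambda>t. sweedler K TA (comult A a) (\<lambda>(a1, a2). ?g (co t) a1 a2))"
    by (rule AA.sw_param[OF T_module TA_module b2 _ cm_closed[OF a]])
      (auto intro: linear_mapD[OF co_lin] linear_map_comp[OF co_lin TA.sw_linear[OF TA_module b1]])
  show ?thesis
  proof (rule VA.tensor_eq[OF TA_module linear_map_comp[OF ac_lin[OF a] co_lin] R _ t])
    fix v b assume v: "v \<in> carrier V" and b: "b \<in> carrier A"
    note c0 = AA.sw_linear[OF TA_module co0_bil[OF v]]
    have m1: "bilinear_map K A A AA (\<lambda>b1 b2. ten K A A (a1 \<otimes>\<^bsub>A\<^esub> b1) (a2 \<otimes>\<^bsub>A\<^esub> b2))"
      if "a1 \<in> carrier A" "a2 \<in> carrier A" for a1 a2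
      by (rule bilinearI)
        (auto intro: linear_map_comp[OF mult_lin(1) AAten_lin(1)] linear_map_comp[OF mult_lin(1) AAten_lin(2)] that)
    have m2: "bilinear_map K A A AA (\<lambda>a1 a2. sweedler K AA (comult A b) (\<lambda>(b1, b2).
        ten K A A (a1 \<otimes>\<^bsub>A\<^esub> b1) (a2 \<otimes>\<^bsub>A\<^esub> b2)))"
      by (rule bilinearI; rule AA.sw_param[OF A_module AA_module m1 _ cm_closed[OF b]])
        (auto intro: linear_map_comp[OF mult_lin(2) AAten_lin(1)] linear_map_comp[OF mult_lin(2) AAten_lin(2)])
    have "co (ac a (ten K V A v b)) = co0 v (comult A (a \<otimes>\<^bsub>A\<^esub> b))"
      using a v b by (simp add: ac_ten co_ten)
    also have "\<dots> = sweedler K TA (comult A a) (\<lambda>(a1, a2). co0 v (sweedler K AA (comult A b) (\<lambda>(b1, b2).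
        ten K A A (a1 \<otimes>\<^bsub>A\<^esub> b1) (a2 \<otimes>\<^bsub>A\<^esub> b2))))"
      unfolding comult_mult[OF a b]
      by (rule AA.sw_comp[OF AA_module TA_module m2 c0 cm_closed[OF a]])
    also have "\<dots> = sweedler K TA (comult A a) (\<lambda>(a1, a2). ?g (co0 v (comult A b)) a1 a2)"
    proof (rule AA.sw_cong[OF TA_module AA.bilinear_comp[OF m2 c0] cm_closed[OF a]])
      fix a1 a2 assume a12: "a1 \<in> carrier A" "a2 \<in> carrier A"
      have "co0 v (sweedler K AA (comult A b) (\<lambda>(b1, b2). ten K A A (a1 \<otimes>\<^bsub>A\<^esub> b1) (a2 \<otimes>\<^bsub>A\<^esub> b2))) =
        sweedler K TA (comult A b) (\<lambda>(b1, b2). co0 v (ten K A A (a1 \<otimes>\<^bsub>A\<^esub> b1) (a2 \<otimes>\<^bsub>A\<^esub> b2)))"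
        by (rule AA.sw_comp[OF AA_module TA_module m1[OF a12] c0 cm_closed[OF b]])
      also have "\<dots> = sweedler K TA (comult A b) (\<lambda>(b1, b2). ten K T A (ac a1 (ten K V A v b1)) (a2 \<otimes>\<^bsub>A\<^esub> b2))"
        by (rule AA.sw_cong[OF TA_module AA.bilinear_comp[OF m1[OF a12] c0] cm_closed[OF b]])
          (simp add: a12 v AA.sw_ten[OF TA_module co0_bil[OF v]] ac_ten)
      also have "\<dots> = ?g (co0 v (comult A b)) a1 a2"
        by (rule sw_co0[symmetric, OF TA_module b1[OF a12] v cm_closed[OF b]])
      finally show "co0 v (sweedler K AA (comult A b) (\<lambda>(b1, b2). ten K A A (a1 \<otimes>\<^bsub>A\<^esub> b1) (a2 \<otimes>\<^bsub>A\<^esub> b2))) =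
        ?g (co0 v (comult A b)) a1 a2" .
    qed
    finally show "co (ac a (ten K V A v b)) =
      sweedler K TA (comult A a) (\<lambda>(a1, a2). ?g (co (ten K V A v b)) a1 a2)"
      by (simp only: co_ten[OF v b])
  qed
qed

lemma co_coassoc: assumes t: "t \<in> carrier T"
  shows "sweedler K T3 (co t) (\<lambda>(x, y). sweedler K T3 (co x) (\<lambda>(x0, x1). tenr K T A 2 x0 [x1, y])) =
    sweedler K T3 (co t) (\<lambda>(x, y). sweedler K T3 (comult A y) (\<lambda>(y1, y2). tenr K T A 2 x [y1, y2]))"
proof -
  note r3 = TA.tenr2 and s3 = AA.tenr2
  have l1: "bilinear_map K T A T3 (\<lambda>x0 x1. tenr K T A 2 x0 [x1, y])" if "y \<in> carrier A" for y
    by (rule bilinearI) (auto intro: r3 that)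
  have l2: "bilinear_map K T A T3 (\<lambda>x y. sweedler K T3 (co x) (\<lambda>(x0, x1). tenr K T A 2 x0 [x1, y]))"
    by (rule bilinearI)
      (auto intro: linear_map_comp[OF co_lin TA.sw_linear[OF T3_module l1]]
        TA.sw_param[OF A_module T3_module l1] r3 linear_mapD[OF co_lin])
  have r1: "bilinear_map K A A T3 (\<lambda>y1 y2. tenr K T A 2 x [y1, y2])" if "x \<in> carrier T" for x
    by (rule bilinearI) (auto intro: r3 that)
  have r2: "bilinear_map K T A T3 (\<lambda>x y. sweedler K T3 (comult A y) (\<lambda>(y1, y2). tenr K T A 2 x [y1, y2]))"
    by (rule bilinearI)
      (auto intro: linear_map_comp[OF comult_linear AA.sw_linear[OF T3_module r1]]
        AA.sw_param[OF T_module T3_module r1] r3 cm_closed)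
  show ?thesis
  proof (rule VA.tensor_eq[OF T3_module _ _ _ t])
    show "linear_map K T T3 (\<lambda>t. sweedler K T3 (co t) (\<lambda>(x, y). sweedler K T3 (co x) (\<lambda>(x0, x1). tenr K T A 2 x0 [x1, y])))"
      by (rule linear_map_comp[OF co_lin TA.sw_linear[OF T3_module l2]])
    show "linear_map K T T3 (\<lambda>t. sweedler K T3 (co t) (\<lambda>(x, y). sweedler K T3 (comult A y) (\<lambda>(y1, y2). tenr K T A 2 x [y1, y2])))"
      by (rule linear_map_comp[OF co_lin TA.sw_linear[OF T3_module r2]])
    fix v b assume v: "v \<in> carrier V" and b: "b \<in> carrier A"
    have wl: "\<And>as i x. as \<in> words A 2 \<Longrightarrow> i < 2 \<Longrightarrow> x \<in> carrier A \<Longrightarrow> as[i := x] \<in> words A 2"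
      by (auto simp: words_def dest!: set_update_subset_insert[THEN subsetD])
    have c: "tenr_rels K A A 2 \<subseteq> carrier (free_module K (carrier A \<times> words A 2))"
      unfolding tenr_rels_def Let_def
      by (intro Un_least slot_rels_carrier module.axioms(1)[OF A_module] A_module) (auto intro: wl)
    interpret S: presentation K "carrier A \<times> words A 2" "tenr_rels K A A 2" using c by unfold_locales
    let ?f = "\<lambda>(c, cs). tenr K T A 2 (ten K V A v c) cs"
    have w2: "\<exists>x y. as = [x, y] \<and> x \<in> carrier A \<and> y \<in> carrier A" if as: "as \<in> words A 2" for as
    proof -
      obtain x y where "as = [x, y]" using as
        by (cases as; cases "tl as") (auto simp: words_def)
      then show ?thesis using that by (auto simp: words_def)
    qed
    have mem: "?f \<in> carrier A \<times> words A 2 \<rightarrow> carrier T3"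
    proof (rule funcsetI)
      fix g assume "g \<in> carrier A \<times> words A 2"
      then obtain c as where g: "g = (c, as)" "c \<in> carrier A" "as \<in> words A 2" by auto
      obtain x y where xy: "as = [x, y]" "x \<in> carrier A" "y \<in> carrier A" using w2[OF g(3)] by auto
      show "?f g \<in> carrier T3"
        using linear_mapD(1)[OF r3(4)[OF xy(2,3)] VA.ten_closed[OF v g(2)]] by (simp add: g(1) xy(1))
    qed
    have "S.good T3 ?f"
    proof -
      have 1: "free_lift K T3 ?f r = \<zero>\<^bsub>T3\<^esub>"
        if "r \<in> slot_rels K S.F A {\<lambda>n. (n, as) | as. as \<in> words A 2}" for r
        by (rule S.slot_good[OF T3_module A_module mem _ _ that])
         (auto, auto dest!: w2 intro: linear_map_comp[OF ten_lin(2)[OF v] r3(4)])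
      have 2: "free_lift K T3 ?f r = \<zero>\<^bsub>T3\<^esub>"
        if "r \<in> slot_rels K S.F A {\<lambda>a. (n, as[i := a]) | n as i. n \<in> carrier A \<and> as \<in> words A 2 \<and> i < 2}" for r
      proof (rule S.slot_good[OF T3_module A_module mem _ _ that])
        fix \<iota> :: "'a \<Rightarrow> 'a \<times> 'a list"
        assume "\<iota> \<in> {\<lambda>a. (n, as[i := a]) | n as i. n \<in> carrier A \<and> as \<in> words A 2 \<and> i < 2}"
        then obtain n as i where i: "\<iota> = (\<lambda>a. (n, as[i := a]))" "n \<in> carrier A" "as \<in> words A 2" "i < 2" by auto
        then show "\<iota> \<in> carrier A \<rightarrow> carrier A \<times> words A 2" using wl by auto
        obtain x y where xy: "as = [x, y]" "x \<in> carrier A" "y \<in> carrier A" using w2 i by blast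
        have "i = 0 \<or> i = 1" using i by auto
        then show "linear_map K A T3 (\<lambda>x. ?f (\<iota> x))" using xy i r3(2,3) v VA.ten_closed by auto
      qed
      show ?thesis unfolding S.good_def using mem 1 2 by (auto simp: tenr_rels_def Let_def)
    qed
    note L = S.good_linear[OF T3_module this, folded tensorr_def]
      and Lg = S.good_gen[OF T3_module this, folded tenr_def]
    let ?L = "\<lambda>t. sweedler K T3 t ?f"
    have Lt: "?L (tenr K A A 2 x [y, z]) = tenr K T A 2 (ten K V A v x) [y, z]"
      if "x \<in> carrier A" "y \<in> carrier A" "z \<in> carrier A" for x y z
      using Lg[of "(x, [y, z])"] that by (simp add: words_def tenr_def)
    have a1: "bilinear_map K A A A3 (\<lambda>x1 x2. tenr K A A 2 x1 [x2, y])" if "y \<in> carrier A" for y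
      by (rule bilinearI) (auto intro: s3 that)
    have a2: "bilinear_map K A A A3 (\<lambda>x y. sweedler K A3 (comult A x) (\<lambda>(x1, x2). tenr K A A 2 x1 [x2, y]))"
      by (rule bilinearI)
        (auto intro: linear_map_comp[OF comult_linear AA.sw_linear[OF A3_module a1]]
          AA.sw_param[OF A_module A3_module a1] s3 cm_closed)
    have d1: "bilinear_map K A A A3 (\<lambda>y1 y2. tenr K A A 2 x [y1, y2])" if "x \<in> carrier A" for x
      by (rule bilinearI) (auto intro: s3 that)
    have d2: "bilinear_map K A A A3 (\<lambda>x y. sweedler K A3 (comult A y) (\<lambda>(y1, y2). tenr K A A 2 x [y1, y2]))"
      by (rule bilinearI)
        (auto intro: linear_map_comp[OF comult_linear AA.sw_linear[OF A3_module d1]]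
          AA.sw_param[OF A_module A3_module d1] s3 cm_closed)
    have "sweedler K T3 (co (ten K V A v b)) (\<lambda>(x, y). sweedler K T3 (co x) (\<lambda>(x0, x1). tenr K T A 2 x0 [x1, y])) =
      sweedler K T3 (comult A b) (\<lambda>(b1, b2). sweedler K T3 (co (ten K V A v b1)) (\<lambda>(x0, x1). tenr K T A 2 x0 [x1, b2]))"
      unfolding co_ten[OF v b] by (rule sw_co0[OF T3_module l2 v cm_closed[OF b]])
    also have "\<dots> = sweedler K T3 (comult A b) (\<lambda>(b1, b2). ?L (sweedler K A3 (comult A b1) (\<lambda>(x1, x2). tenr K A A 2 x1 [x2, b2])))"
    proof (rule AA.sw_cong[symmetric, OF T3_module AA.bilinear_comp[OF a2 L] cm_closed[OF b]])
      fix b1 b2 assume b12: "b1 \<in> carrier A" "b2 \<in> carrier A"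
      have "?L (sweedler K A3 (comult A b1) (\<lambda>(x1, x2). tenr K A A 2 x1 [x2, b2])) =
        sweedler K T3 (comult A b1) (\<lambda>(x1, x2). ?L (tenr K A A 2 x1 [x2, b2]))"
        by (rule AA.sw_comp[OF A3_module T3_module a1[OF b12(2)] L cm_closed[OF b12(1)]])
      also have "\<dots> = sweedler K T3 (comult A b1) (\<lambda>(x1, x2). tenr K T A 2 (ten K V A v x1) [x2, b2])"
        by (rule AA.sw_cong[OF T3_module AA.bilinear_comp[OF a1[OF b12(2)] L] cm_closed[OF b12(1)]])
          (rule Lt; simp add: b12)
      also have "\<dots> = sweedler K T3 (co (ten K V A v b1)) (\<lambda>(x0, x1). tenr K T A 2 x0 [x1, b2])"
        unfolding co_ten[OF v b12(1)] by (rule sw_co0[symmetric, OF T3_module l1[OF b12(2)] v cm_closed[OF b12(1)]])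
      finally show "?L (sweedler K A3 (comult A b1) (\<lambda>(x1, x2). tenr K A A 2 x1 [x2, b2])) =
        sweedler K T3 (co (ten K V A v b1)) (\<lambda>(x0, x1). tenr K T A 2 x0 [x1, b2])" .
    qed
    also have "\<dots> = ?L (sweedler K A3 (comult A b) (\<lambda>(x, y). sweedler K A3 (comult A x) (\<lambda>(x1, x2). tenr K A A 2 x1 [x2, y])))"
      by (rule AA.sw_comp[symmetric, OF A3_module T3_module a2 L cm_closed[OF b]])
    also have "\<dots> = ?L (sweedler K A3 (comult A b) (\<lambda>(x, y). sweedler K A3 (comult A y) (\<lambda>(y1, y2). tenr K A A 2 x [y1, y2])))"
      by (simp only: coassoc[OF b])
    also have "\<dots> = sweedler K T3 (comult A b) (\<lambda>(x, y). ?L (sweedler K A3 (comult A y) (\<lambda>(y1, y2). tenr K A A 2 x [y1, y2])))"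
      by (rule AA.sw_comp[OF A3_module T3_module d2 L cm_closed[OF b]])
    also have "\<dots> = sweedler K T3 (comult A b) (\<lambda>(x, y). sweedler K T3 (comult A y) (\<lambda>(y1, y2). tenr K T A 2 (ten K V A v x) [y1, y2]))"
    proof (rule AA.sw_cong[OF T3_module AA.bilinear_comp[OF d2 L] cm_closed[OF b]])
      fix x y assume xy: "x \<in> carrier A" "y \<in> carrier A"
      have "?L (sweedler K A3 (comult A y) (\<lambda>(y1, y2). tenr K A A 2 x [y1, y2])) =
        sweedler K T3 (comult A y) (\<lambda>(y1, y2). ?L (tenr K A A 2 x [y1, y2]))"
        by (rule AA.sw_comp[OF A3_module T3_module d1[OF xy(1)] L cm_closed[OF xy(2)]])
      also have "\<dots> = sweedler K T3 (comult A y) (\<lambda>(y1, y2). tenr K T A 2 (ten K V A v x) [y1, y2])"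
        by (rule AA.sw_cong[OF T3_module AA.bilinear_comp[OF d1[OF xy(1)] L] cm_closed[OF xy(2)]])
          (rule Lt; simp add: xy)
      finally show "?L (sweedler K A3 (comult A y) (\<lambda>(y1, y2). tenr K A A 2 x [y1, y2])) =
        sweedler K T3 (comult A y) (\<lambda>(y1, y2). tenr K T A 2 (ten K V A v x) [y1, y2])" .
    qed
    also have "\<dots> = sweedler K T3 (co (ten K V A v b)) (\<lambda>(x, y). sweedler K T3 (comult A y) (\<lambda>(y1, y2). tenr K T A 2 x [y1, y2]))"
      unfolding co_ten[OF v b] by (rule sw_co0[symmetric, OF T3_module r2 v cm_closed[OF b]])
    finally show "sweedler K T3 (co (ten K V A v b)) (\<lambda>(x, y). sweedler K T3 (co x) (\<lambda>(x0, x1). tenr K T A 2 x0 [x1, y])) =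
      sweedler K T3 (co (ten K V A v b)) (\<lambda>(x, y). sweedler K T3 (comult A y) (\<lambda>(y1, y2). tenr K T A 2 x [y1, y2]))" .
  qed
qed

end

lemma hopf_module_free_hmod:
  assumes "bialgebra K A" "module K V"
  shows "hopf_module K A (free_hmod K V A)"
proof -
  interpret hopf_setup K A V using assms by (simp add: hopf_setup_def)
  interpret H: module K "free_hmod K V A" by (rule hmod_module[OF T_module])
  show ?thesis
    by (intro hopf_module.intro hopf_module_axioms.intro assms(1) H.module_axioms;
      unfold hmod_cong hmod_tens hmod_ops)
      (simp_all only: ac_lin ac_lin2 act_one act_mult co_lin co_coassoc co_counit co_act)
qed

end

theory Submission
  imports Defs
begin

text \<open>
  Both differentials have explicit contractions.  Applying the counit to the factor \<open>A\<close> of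
  \<open>W \<otimes> A\<close> and moving the next tensor factor into its place gives a map \<open>\<sigma>\<close> lowering \<open>p\<close> that
  commutes with \<open>d\<^sub>m\<close> and satisfies \<open>\<sigma> d\<^sub>c + d\<^sub>c \<sigma> = 1\<close> for \<open>p \<ge> 1\<close>; for \<open>p = 0\<close> it leaves a
  residue \<open>\<sigma> d\<^sub>c = 1 - \<rho>\<close>.  Inserting \<open>1 \<in> A\<close> into \<open>V \<otimes> A\<close>, that is,
  \<open>(s f)(a\<^sup>1, \<dots>, a\<^sup>n, v \<otimes> b) = f(a\<^sup>1, \<dots>, a\<^sup>n, b, v \<otimes> 1)\<close>, contracts \<open>d\<^sub>m\<close>.  Hence a cocycle
  \<open>(F\<^sub>n)\<close> of degree \<open>r = q + 1\<close> is the coboundary of \<open>G\<^sub>n = (-1)\<^sup>n \<sigma> F\<^sub>n\<close>, corrected in module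
  degree \<open>q\<close> by \<open>(-1)\<^sup>r \<rho> s F\<^sub>r\<close>, because \<open>d\<^sub>c \<rho> = 0\<close> and \<open>d\<^sub>m \<rho> s F\<^sub>r = (-1)\<^sup>r \<rho> F\<^sub>r\<close>.
\<close>

text \<open>The two gradings are exact for different reasons. \<open>W \<otimes> A\<close> is a
  cofree comodule, so the \<open>d_c\<close> complexes are exact except at \<open>p = 0\<close>,
  where the kernel of \<open>d_c\<close> consists of the colinear maps; such a map is determined by
  its composite with the counit \<epsilon>, a linear map into \<open>W\<close>. In comodule degree 0
  a value has no second factor to move into place, only the one that the last comodule face has just
  appended. The residue is therefore \<sigma> of that face, and it sends \<open>f\<close> to the
  colinear map with the same composite \<open>\<epsilon> \<circ> f\<close>. On these composites
  \<open>d_m\<close> is a bar differential in which \<open>A\<close> acts on \<open>W\<close>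
  through \<epsilon>, and \<open>V \<otimes> A\<close> is free as a module.

  \<open>s F_r\<close> cannot itself be the correction: a correction has to be killed by
  \<open>d_c\<close>, or it would disturb the component in module degree \<open>q\<close>, and
  \<rho> is what ensures this. The sign \<open>(-1)^n\<close> in \<open>G_n\<close> cancels the one
  that the total differential puts on \<open>d_c\<close>; the sign \<open>(-1)^r\<close> undoes the
  one produced by \<open>d_m \<rho> s\<close>.\<close>

lemma linear_map_id: "linear_map K X X (\<lambda>x. x)"
  by (simp add: linear_map_def)

lemma linear_map_finsum:
  assumes "module K X" "module K Y" "linear_map K X Y L" "finite I" "\<And>i. i \<in> I \<Longrightarrow> f i \<in> carrier X"
  shows "L (\<Oplus>\<^bsub>X\<^esub>i\<in>I. f i) = (\<Oplus>\<^bsub>Y\<^esub>i\<in>I. L (f i))"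
proof -
  interpret X: module K X by fact
  interpret Y: module K Y by fact
  show ?thesis using assms(4,5)
    by (induction I rule: finite_induct)
      (simp_all add: linear_map_zero[OF assms(1-3)] linear_mapD[OF assms(3)] Pi_iff)
qed

lemma linear_map_finsum_fun:
  assumes "module K X" "module K Y" "finite I" "\<And>i. i \<in> I \<Longrightarrow> linear_map K X Y (f i)"
  shows "linear_map K X Y (\<lambda>x. \<Oplus>\<^bsub>Y\<^esub>i\<in>I. f i x)"
  using assms(3,4)
proof (induction I rule: finite_induct)
  case empty
  interpret Y: module K Y by fact
  show ?case using linear_map_zero_fun[OF assms(1,2)] by simp
next
  case (insert i I)
  interpret Y: module K Y by fact
  have "linear_map K X Y (\<lambda>x. f i x \<oplus>\<^bsub>Y\<^esub> (\<Oplus>\<^bsub>Y\<^esub>i\<in>I. f i x))"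
    by (rule linear_map_add_fun[OF assms(1,2)]) (use insert in auto)
  then show ?case
    by (rule linear_map_cong[OF assms(1)])
      (use insert(1,2,4) in \<open>simp add: Pi_iff linear_mapD(1)[OF insert(4)]\<close>)
qed


section \<open>Sweedler sums of maps that need not be multilinear\<close>

text \<open>
  \<^term>\<open>sweedler K X t \<phi>\<close> is a finite sum over the support of a chosen representative of \<open>t\<close>.
  Congruence, exchange of sums and composition with linear maps hold for this sum whatever
  \<open>\<phi>\<close> is; multilinearity of \<open>\<phi>\<close> is needed only to vary \<open>t\<close>.
\<close>

definition supported where
  "supported K G t \<longleftrightarrow> (SOME u. u \<in> t) \<in> carrier (free_module K G)"

lemma (in presentation) supported:
  assumes "t \<in> carrier P" shows "supported K G t"
proof -
  interpret F: module K F by (rule F_module)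
  interpret abelian_subgroup H F by (rule module_abelian_subgroup[OF F_module H_submodule])
  obtain u where u: "u \<in> carrier F" "t = H +>\<^bsub>F\<^esub> u"
    using assms by (auto simp: presented_def quot_module_carrier)
  have "u \<in> t" using u a_rcos_self by simp
  then have "(SOME u. u \<in> t) \<in> t" by (rule someI[of "\<lambda>u. u \<in> t"])
  moreover have "t \<subseteq> carrier F" using u a_subset by (auto simp: a_r_coset_def')
  ultimately show ?thesis by (auto simp: supported_def)
qed

context
  fixes K :: "('k, 'q) ring_scheme" and B :: "'b set" and C :: "'c set" and t
  assumes t: "supported K (B \<times> C) t"
begin

private abbreviation "u \<equiv> SOME u. u \<in> t"
private abbreviation "S \<equiv> {g. u g \<noteq> \<zero>\<^bsub>K\<^esub>}"

private lemma finite_support: "finite S" and support: "S \<subseteq> B \<times> C" and coeff_closed: "u g \<in> carrier K"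
  using t by (auto simp: supported_def free_module_def simp del: split_paired_All)

private lemma sweedler_eq: "sweedler K X t \<phi> = (\<Oplus>\<^bsub>X\<^esub>g\<in>S. u g \<odot>\<^bsub>X\<^esub> \<phi> g)"
  by (simp add: sweedler_def free_lift_def)

lemma sweedler_closed:
  assumes "module K X" "\<And>x y. x \<in> B \<Longrightarrow> y \<in> C \<Longrightarrow> \<phi> x y \<in> carrier X"
  shows "sweedler K X t (\<lambda>(x, y). \<phi> x y) \<in> carrier X"
proof -
  interpret X: module K X by fact
  show ?thesis unfolding sweedler_eq
    by (rule X.M.finsum_closed) (use support coeff_closed assms(2) in auto)
qed

lemma sweedler_cong':
  assumes "module K X" "\<And>x y. x \<in> B \<Longrightarrow> y \<in> C \<Longrightarrow> \<phi> x y \<in> carrier X"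
    "\<And>x y. x \<in> B \<Longrightarrow> y \<in> C \<Longrightarrow> \<phi> x y = \<psi> x y"
  shows "sweedler K X t (\<lambda>(x, y). \<phi> x y) = sweedler K X t (\<lambda>(x, y). \<psi> x y)"
proof -
  interpret X: module K X by fact
  have "\<psi> x y \<in> carrier X" if "x \<in> B" "y \<in> C" for x y
    using assms(2,3)[OF that] by simp
  then show ?thesis unfolding sweedler_eq
    by (intro X.M.finsum_cong'[OF refl]) (use support coeff_closed assms(3) in auto)
qed

lemma sweedler_linear_comp:
  assumes "module K X" "module K Y" "linear_map K X Y L" "\<And>x y. x \<in> B \<Longrightarrow> y \<in> C \<Longrightarrow> \<phi> x y \<in> carrier X"
  shows "L (sweedler K X t (\<lambda>(x, y). \<phi> x y)) = sweedler K Y t (\<lambda>(x, y). L (\<phi> x y))"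
proof -
  interpret X: module K X by fact
  interpret Y: module K Y by fact
  have \<phi>: "\<phi> x y \<in> carrier X" if "(x, y) \<in> S" for x y using support assms(4) that by blast
  show ?thesis unfolding sweedler_eq
    by (subst linear_map_finsum[OF assms(1-3) finite_support])
      (auto simp: \<phi> coeff_closed linear_mapD[OF assms(3)] intro!: Y.M.finsum_cong')
qed

text \<open>The support and the coefficients come from \<open>t\<close> alone, so the sum is a fixed
  linear combination of maps that are linear in \<open>v\<close>.\<close>

lemma sweedler_linear_param:
  assumes "module K U" "module K X" "\<And>x y. x \<in> B \<Longrightarrow> y \<in> C \<Longrightarrow> linear_map K U X (\<lambda>v. \<phi> v x y)"
  shows "linear_map K U X (\<lambda>v. sweedler K X t (\<lambda>(x, y). \<phi> v x y))"
  unfolding sweedler_eq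
proof (rule linear_map_finsum_fun[OF assms(1,2) finite_support])
  fix g assume "g \<in> S"
  then obtain x y where "g = (x, y)" "x \<in> B" "y \<in> C" using support by blast
  then show "linear_map K U X (\<lambda>v. u g \<odot>\<^bsub>X\<^esub> (case g of (x, y) \<Rightarrow> \<phi> v x y))"
    using linear_map_smult_fun[OF assms(1,2) assms(3) coeff_closed] by simp
qed

lemma sweedler_smult:
  assumes "module K X" "k \<in> carrier K" "\<And>x y. x \<in> B \<Longrightarrow> y \<in> C \<Longrightarrow> \<phi> x y \<in> carrier X"
  shows "k \<odot>\<^bsub>X\<^esub> sweedler K X t (\<lambda>(x, y). \<phi> x y) = sweedler K X t (\<lambda>(x, y). k \<odot>\<^bsub>X\<^esub> \<phi> x y)"
  by (rule sweedler_linear_comp[OF assms(1,1) linear_map_smult_fun[OF assms(1,1) linear_map_id assms(2)] assms(3)])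

lemma sweedler_finsum:
  assumes "module K X" "finite I" "\<And>i x y. i \<in> I \<Longrightarrow> x \<in> B \<Longrightarrow> y \<in> C \<Longrightarrow> \<phi> i x y \<in> carrier X"
  shows "(\<Oplus>\<^bsub>X\<^esub>i\<in>I. sweedler K X t (\<lambda>(x, y). \<phi> i x y)) = sweedler K X t (\<lambda>(x, y). \<Oplus>\<^bsub>X\<^esub>i\<in>I. \<phi> i x y)"
proof -
  interpret X: module K X by fact
  have add: "sweedler K X t (\<lambda>(x, y). \<phi> x y) \<oplus>\<^bsub>X\<^esub> sweedler K X t (\<lambda>(x, y). \<psi> x y) =
      sweedler K X t (\<lambda>(x, y). \<phi> x y \<oplus>\<^bsub>X\<^esub> \<psi> x y)"
    if "\<And>x y. x \<in> B \<Longrightarrow> y \<in> C \<Longrightarrow> \<phi> x y \<in> carrier X" "\<And>x y. x \<in> B \<Longrightarrow> y \<in> C \<Longrightarrow> \<psi> x y \<in> carrier X" for \<phi> \<psi>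
    unfolding sweedler_eq
    by (subst X.M.finsum_addf[symmetric])
      (use support coeff_closed that in \<open>auto intro!: X.M.finsum_cong' X.M.a_closed X.smult_closed
        simp: X.smult_r_distr subset_iff\<close>)
  show ?thesis using assms(2,3)
  proof (induction I rule: finite_induct)
    case empty
    show ?case by (simp add: sweedler_eq coeff_closed case_prod_beta)
  next
    case (insert i I)
    have "(\<Oplus>\<^bsub>X\<^esub>i\<in>insert i I. sweedler K X t (\<lambda>(x, y). \<phi> i x y)) =
        sweedler K X t (\<lambda>(x, y). \<phi> i x y) \<oplus>\<^bsub>X\<^esub> sweedler K X t (\<lambda>(x, y). \<Oplus>\<^bsub>X\<^esub>i\<in>I. \<phi> i x y)"
      using insert by (subst X.M.finsum_insert) (auto intro: sweedler_closed[OF assms(1)])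
    also have "\<dots> = sweedler K X t (\<lambda>(x, y). \<phi> i x y \<oplus>\<^bsub>X\<^esub> (\<Oplus>\<^bsub>X\<^esub>i\<in>I. \<phi> i x y))"
      by (rule add) (use insert in auto)
    also have "\<dots> = sweedler K X t (\<lambda>(x, y). \<Oplus>\<^bsub>X\<^esub>i\<in>insert i I. \<phi> i x y)"
      by (rule sweedler_cong'[OF assms(1)]) (use insert in \<open>auto simp: Pi_iff\<close>)
    finally show ?case .
  qed
qed

text \<open>Exchange of two finite sums: one is unfolded over its support, the other absorbs the
  coefficients by linearity.\<close>

lemma sweedler_swap:
  fixes X :: "('k, 'x, 'r) module_scheme"
  assumes "module K X" "supported K (D \<times> E) s"
    "\<And>x y z w. x \<in> B \<Longrightarrow> y \<in> C \<Longrightarrow> z \<in> D \<Longrightarrow> w \<in> E \<Longrightarrow> \<phi> x y z w \<in> carrier X"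
  shows "sweedler K X s (\<lambda>(z, w). sweedler K X t (\<lambda>(x, y). \<phi> x y z w)) =
    sweedler K X t (\<lambda>(x, y). sweedler K X s (\<lambda>(z, w). \<phi> x y z w))"
proof -
  interpret X: module K X by fact
  let ?v = "SOME u. u \<in> s"
  let ?S = "{g. ?v g \<noteq> \<zero>\<^bsub>K\<^esub>}"
  have v: "finite ?S" "?S \<subseteq> D \<times> E" "?v h \<in> carrier K" for h
    using assms(2) by (auto simp: supported_def free_module_def simp del: split_paired_All)
  have s: "sweedler K X s \<psi> = (\<Oplus>\<^bsub>X\<^esub>g\<in>?S. ?v g \<odot>\<^bsub>X\<^esub> \<psi> g)" for \<psi>
    by (simp add: sweedler_def free_lift_def)
  have "sweedler K X s (\<lambda>(z, w). sweedler K X t (\<lambda>(x, y). \<phi> x y z w)) =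
      (\<Oplus>\<^bsub>X\<^esub>g\<in>?S. sweedler K X t (\<lambda>(x, y). ?v g \<odot>\<^bsub>X\<^esub> \<phi> x y (fst g) (snd g)))"
    unfolding s
    by (rule X.M.finsum_cong'[OF refl])
      (use v assms(3) in \<open>auto intro!: sweedler_closed[OF assms(1)] sweedler_smult[OF assms(1)]
        simp: subset_iff\<close>)
  also have "\<dots> = sweedler K X t (\<lambda>(x, y). \<Oplus>\<^bsub>X\<^esub>g\<in>?S. ?v g \<odot>\<^bsub>X\<^esub> \<phi> x y (fst g) (snd g))"
    by (rule sweedler_finsum[OF assms(1) v(1)]) (use v assms(3) in \<open>auto simp: subset_iff\<close>)
  also have "\<dots> = sweedler K X t (\<lambda>(x, y). sweedler K X s (\<lambda>(z, w). \<phi> x y z w))"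
    unfolding s case_prod_beta ..
  finally show ?thesis .
qed

end

section \<open>Multilinear maps on words\<close>

lemma words_0 [simp]: "words A 0 = {[]}"
  by (auto simp: words_def)

lemma Cons_in_words [simp]: "a # as \<in> words A (Suc n) \<longleftrightarrow> a \<in> carrier A \<and> as \<in> words A n"
  by (auto simp: words_def)

lemma words_SucE:
  assumes "xs \<in> words A (Suc n)"
  obtains a as where "xs = a # as" "a \<in> carrier A" "as \<in> words A n"
  using assms by (cases xs) (auto simp: words_def)

lemma words_SucE':
  assumes "xs \<in> words A (Suc n)"
  obtains as a where "xs = as @ [a]" "as \<in> words A n" "a \<in> carrier A"
  using assms by (cases xs rule: rev_cases) (auto simp: words_def)

lemma snoc_in_words [simp]: "as @ [a] \<in> words A (Suc n) \<longleftrightarrow> as \<in> words A n \<and> a \<in> carrier A"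
  by (auto simp: words_def)

text \<open>A slot is given by the letters before and after it rather than by an index and a list
  update. This form survives adding a letter at either end and so suits induction on the word, where
  \<open>as[i := a]\<close> would need index shifts.\<close>

definition slot_linear where
  "slot_linear K A n X \<phi> \<longleftrightarrow> (\<forall>as bs. set as \<subseteq> carrier A \<and> set bs \<subseteq> carrier A \<and>
    Suc (length as + length bs) = n \<longrightarrow> linear_map K A X (\<lambda>a. \<phi> (as @ a # bs)))"

text \<open>The vector \<open>m\<close> comes first in \<open>\<phi>\<close> although it follows the
  word in \<open>tensorl\<close>; one notion then covers both \<open>tensorl\<close> and
  \<open>tensorr\<close>.\<close>

definition multilinear where
  "multilinear K M A n X \<phi> \<longleftrightarrow>
    (\<forall>as\<in>words A n. linear_map K M X (\<lambda>m. \<phi> m as)) \<and> (\<forall>m\<in>carrier M. slot_linear K A n X (\<phi> m))"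

lemma slot_linearI:
  assumes "\<And>as bs. set as \<subseteq> carrier A \<Longrightarrow> set bs \<subseteq> carrier A \<Longrightarrow> Suc (length as + length bs) = n \<Longrightarrow>
    linear_map K A X (\<lambda>a. \<phi> (as @ a # bs))"
  shows "slot_linear K A n X \<phi>"
  using assms by (simp add: slot_linear_def)

lemma slot_linearD:
  assumes "slot_linear K A n X \<phi>" "set as \<subseteq> carrier A" "set bs \<subseteq> carrier A" "Suc (length as + length bs) = n"
  shows "linear_map K A X (\<lambda>a. \<phi> (as @ a # bs))"
  using assms by (simp add: slot_linear_def)

lemma slot_linear_0: "slot_linear K A 0 X \<phi>"
  by (simp add: slot_linear_def)

text \<open>The induction step for maps on words: it splits off the slot of the first letter, in the
  direction in which \<open>sweedler_list\<close> recurses.\<close>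

lemma slot_linear_Suc:
  "slot_linear K A (Suc n) X \<phi> \<longleftrightarrow>
    (\<forall>as\<in>words A n. linear_map K A X (\<lambda>a. \<phi> (a # as))) \<and>
    (\<forall>a\<in>carrier A. slot_linear K A n X (\<lambda>as. \<phi> (a # as)))" (is "?L = ?R")
proof
  assume L: ?L
  show ?R
  proof (intro conjI ballI slot_linearI)
    show "linear_map K A X (\<lambda>a. \<phi> (a # as))" if "as \<in> words A n" for as
      using slot_linearD[OF L, of "[]" as] that by (simp add: words_def)
    show "linear_map K A X (\<lambda>x. \<phi> (a # as @ x # bs))"
      if "a \<in> carrier A" "set as \<subseteq> carrier A" "set bs \<subseteq> carrier A" "Suc (length as + length bs) = n" for a as bs
      using slot_linearD[OF L, of "a # as" bs] that by simp
  qed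
next
  assume R: ?R
  show ?L
  proof (rule slot_linearI)
    fix as bs assume *: "set as \<subseteq> carrier A" "set bs \<subseteq> carrier A" "Suc (length as + length bs) = Suc n"
    show "linear_map K A X (\<lambda>a. \<phi> (as @ a # bs))"
    proof (cases as)
      case Nil
      then show ?thesis using R * by (simp add: words_def)
    next
      case (Cons a as')
      then show ?thesis using R * by (auto intro: slot_linearD)
    qed
  qed
qed

lemma slot_linear_comp: "slot_linear K A n X \<phi> \<Longrightarrow> linear_map K X Y L \<Longrightarrow> slot_linear K A n Y (\<lambda>as. L (\<phi> as))"
  by (rule slot_linearI) (rule linear_map_comp[OF slot_linearD])

lemma slot_linear_snoc:
  assumes "slot_linear K A (Suc n) X \<phi>" "a \<in> carrier A"
  shows "slot_linear K A n X (\<lambda>as. \<phi> (as @ [a]))"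
proof (rule slot_linearI)
  fix as bs assume "set as \<subseteq> carrier A" "set bs \<subseteq> carrier A" "Suc (length as + length bs) = n"
  then show "linear_map K A X (\<lambda>x. \<phi> ((as @ x # bs) @ [a]))"
    using slot_linearD[OF assms(1), of as "bs @ [a]"] assms(2) by simp
qed

lemma slot_linear_last:
  assumes "slot_linear K A (Suc n) X \<phi>" "as \<in> words A n"
  shows "linear_map K A X (\<lambda>a. \<phi> (as @ [a]))"
  using slot_linearD[OF assms(1), of as "[]"] assms(2) by (simp add: words_def)

lemma multilinearI:
  assumes "\<And>as. as \<in> words A n \<Longrightarrow> linear_map K M X (\<lambda>m. \<phi> m as)"
    "\<And>m. m \<in> carrier M \<Longrightarrow> slot_linear K A n X (\<phi> m)"
  shows "multilinear K M A n X \<phi>"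
  using assms by (simp add: multilinear_def)

lemma multilinearD:
  assumes "multilinear K M A n X \<phi>"
  shows "as \<in> words A n \<Longrightarrow> linear_map K M X (\<lambda>m. \<phi> m as)"
    "m \<in> carrier M \<Longrightarrow> slot_linear K A n X (\<phi> m)"
    "m \<in> carrier M \<Longrightarrow> as \<in> words A n \<Longrightarrow> \<phi> m as \<in> carrier X"
proof -
  show 1: "linear_map K M X (\<lambda>m. \<phi> m as)" if "as \<in> words A n" for as
    using assms that by (simp add: multilinear_def)
  show "slot_linear K A n X (\<phi> m)" if "m \<in> carrier M" using assms that by (simp add: multilinear_def)
  show "\<phi> m as \<in> carrier X" if "m \<in> carrier M" "as \<in> words A n" using linear_mapD(1)[OF 1] that by simp
qed

lemma multilinear_comp:
  "multilinear K M A n X \<phi> \<Longrightarrow> linear_map K X Y L \<Longrightarrow> multilinear K M A n Y (\<lambda>m as. L (\<phi> m as))"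
  by (rule multilinearI; rule linear_map_comp[OF multilinearD(1)] slot_linear_comp[OF multilinearD(2)])

lemma update_in_words: "as \<in> words A n \<Longrightarrow> x \<in> carrier A \<Longrightarrow> as[i := x] \<in> words A n"
  by (auto simp: words_def dest!: set_update_subset_insert[THEN subsetD])

text \<open>Translates to the list updates in which \<open>tenl_rels\<close> and
  \<open>tenr_rels\<close> are written.\<close>

lemma slot_linear_update:
  assumes "slot_linear K A n X \<phi>" "as \<in> words A n" "i < n"
  shows "linear_map K A X (\<lambda>a. \<phi> (as[i := a]))"
proof -
  have "as[i := a] = take i as @ a # drop (Suc i) as" for a
    using assms by (simp add: words_def upd_conv_take_nth_drop)
  moreover have "linear_map K A X (\<lambda>a. \<phi> (take i as @ a # drop (Suc i) as))"
    by (rule slot_linearD[OF assms(1)])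
      (use assms in \<open>auto simp: words_def dest: in_set_takeD in_set_dropD\<close>)
  ultimately show ?thesis by simp
qed

context two_modules
begin

lemma presentation_tenr: "presentation K (carrier V \<times> words W p) (tenr_rels K V W p)"
proof
  show "tenr_rels K V W p \<subseteq> carrier (free_module K (carrier V \<times> words W p))"
    unfolding tenr_rels_def Let_def
    by (intro Un_least slot_rels_carrier V.R.is_cring V.module_axioms W.module_axioms)
      (auto intro: update_in_words)
qed

lemma presentation_tenl: "presentation K (words W n \<times> carrier V) (tenl_rels K W n V)"
proof
  show "tenl_rels K W n V \<subseteq> carrier (free_module K (words W n \<times> carrier V))"
    unfolding tenl_rels_def Let_def
    by (intro Un_least slot_rels_carrier V.R.is_cring V.module_axioms W.module_axioms)
      (auto intro: update_in_words)
qed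

lemma tensorr_module: "module K (tensorr K V W p)"
  unfolding tensorr_def by (rule presentation.P_module[OF presentation_tenr])

lemma tensorl_module: "module K (tensorl K W n V)"
  unfolding tensorl_def by (rule presentation.P_module[OF presentation_tenl])

lemma tenr_closed: "v \<in> carrier V \<Longrightarrow> as \<in> words W p \<Longrightarrow> tenr K V W p v as \<in> carrier (tensorr K V W p)"
  unfolding tensorr_def tenr_def by (rule presentation.gen_closed[OF presentation_tenr]) simp

lemma tenl_closed: "v \<in> carrier V \<Longrightarrow> as \<in> words W n \<Longrightarrow> tenl K W n V as v \<in> carrier (tensorl K W n V)"
  unfolding tensorl_def tenl_def by (rule presentation.gen_closed[OF presentation_tenl]) simp

lemma supported_tensor: "t \<in> carrier (tensor K V W) \<Longrightarrow> supported K (carrier V \<times> carrier W) t"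
  unfolding tensor_def by (rule T.supported)

lemma supported_tensorr: "t \<in> carrier (tensorr K V W p) \<Longrightarrow> supported K (carrier V \<times> words W p) t"
  unfolding tensorr_def by (rule presentation.supported[OF presentation_tenr])

lemma tenr_multilinear: "multilinear K V W p (tensorr K V W p) (tenr K V W p)"
proof (intro multilinearI slot_linearI)
  interpret S: presentation K "carrier V \<times> words W p" "tenr_rels K V W p" by (rule presentation_tenr)
  show "linear_map K V (tensorr K V W p) (\<lambda>v. tenr K V W p v as)" if "as \<in> words W p" for as
    unfolding tensorr_def tenr_def
    by (rule S.slot_linear[OF V.module_axioms, where I = "{\<lambda>n. (n, as) | as. as \<in> words W p}"])
      (use that in \<open>auto simp: tenr_rels_def Let_def\<close>)
  fix v as bs assume v: "v \<in> carrier V" and ab: "set as \<subseteq> carrier W" "set bs \<subseteq> carrier W" "Suc (length as + length bs) = p"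
  let ?I = "{\<lambda>a. (n, as[i := a]) | n as i. n \<in> carrier V \<and> as \<in> words W p \<and> i < p}"
  \<comment> \<open>The relations ask for a word to be updated; \<open>\<zero>\<close> merely fills
    the position that the update overwrites.\<close>
  have "(\<lambda>a. (v, as @ a # bs)) = (\<lambda>a. (v, (as @ \<zero>\<^bsub>W\<^esub> # bs)[length as := a]))" by simp
  moreover have "as @ \<zero>\<^bsub>W\<^esub> # bs \<in> words W p" "length as < p" using ab by (auto simp: words_def)
  ultimately have I: "(\<lambda>a. (v, as @ a # bs)) \<in> ?I" using v by blast
  show "linear_map K W (tensorr K V W p) (\<lambda>a. tenr K V W p v (as @ a # bs))"
    unfolding tensorr_def tenr_def
    by (rule S.slot_linear[OF W.module_axioms I])
      (use update_in_words in \<open>auto simp: tenr_rels_def Let_def\<close>)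
qed

lemma tenl_multilinear: "multilinear K V W n (tensorl K W n V) (\<lambda>v as. tenl K W n V as v)"
proof (intro multilinearI slot_linearI)
  interpret S: presentation K "words W n \<times> carrier V" "tenl_rels K W n V" by (rule presentation_tenl)
  show "linear_map K V (tensorl K W n V) (\<lambda>v. tenl K W n V as v)" if "as \<in> words W n" for as
    unfolding tensorl_def tenl_def
    by (rule S.slot_linear[OF V.module_axioms, where I = "{\<lambda>m. (as, m) | as. as \<in> words W n}"])
      (use that in \<open>auto simp: tenl_rels_def Let_def\<close>)
  fix v as bs assume v: "v \<in> carrier V" and ab: "set as \<subseteq> carrier W" "set bs \<subseteq> carrier W" "Suc (length as + length bs) = n"
  let ?I = "{\<lambda>a. (as[i := a], m) | as i m. as \<in> words W n \<and> i < n \<and> m \<in> carrier V}"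
  have "(\<lambda>a. (as @ a # bs, v)) = (\<lambda>a. ((as @ \<zero>\<^bsub>W\<^esub> # bs)[length as := a], v))" by simp
  moreover have "as @ \<zero>\<^bsub>W\<^esub> # bs \<in> words W n" "length as < n" using ab by (auto simp: words_def)
  ultimately have I: "(\<lambda>a. (as @ a # bs, v)) \<in> ?I" using v by blast
  show "linear_map K W (tensorl K W n V) (\<lambda>a. tenl K W n V (as @ a # bs) v)"
    unfolding tensorl_def tenl_def
    by (rule S.slot_linear[OF W.module_axioms I])
      (use update_in_words in \<open>auto simp: tenl_rels_def Let_def\<close>)
qed

context
  fixes X :: "('k, 'x, 'z) module_scheme" and \<phi> p
  assumes X: "module K X" and \<phi>: "multilinear K V W p X \<phi>"
begin

lemma good_multilinear_right:
  "presentation.good K (carrier V \<times> words W p) (tenr_rels K V W p) X (\<lambda>(v, as). \<phi> v as)"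
proof -
  interpret S: presentation K "carrier V \<times> words W p" "tenr_rels K V W p" by (rule presentation_tenr)
  have mem: "(\<lambda>(v, as). \<phi> v as) \<in> carrier V \<times> words W p \<rightarrow> carrier X"
    using multilinearD(3)[OF \<phi>] by auto
  have 1: "free_lift K X (\<lambda>(v, as). \<phi> v as) r = \<zero>\<^bsub>X\<^esub>"
    if "r \<in> slot_rels K S.F V {\<lambda>n. (n, as) | as. as \<in> words W p}" for r
    by (rule S.slot_good[OF X V.module_axioms mem _ _ that]) (use multilinearD(1)[OF \<phi>] in auto)
  have 2: "free_lift K X (\<lambda>(v, as). \<phi> v as) r = \<zero>\<^bsub>X\<^esub>"
    if "r \<in> slot_rels K S.F W {\<lambda>a. (n, as[i := a]) | n as i. n \<in> carrier V \<and> as \<in> words W p \<and> i < p}" for r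
    by (rule S.slot_good[OF X W.module_axioms mem _ _ that])
      (use slot_linear_update[OF multilinearD(2)[OF \<phi>]] update_in_words in auto)
  show ?thesis unfolding S.good_def using mem 1 2 by (auto simp: tenr_rels_def Let_def)
qed

lemma good_multilinear_left:
  "presentation.good K (words W p \<times> carrier V) (tenl_rels K W p V) X (\<lambda>(as, v). \<phi> v as)"
proof -
  interpret S: presentation K "words W p \<times> carrier V" "tenl_rels K W p V" by (rule presentation_tenl)
  have mem: "(\<lambda>(as, v). \<phi> v as) \<in> words W p \<times> carrier V \<rightarrow> carrier X"
    using multilinearD(3)[OF \<phi>] by auto
  have 1: "free_lift K X (\<lambda>(as, v). \<phi> v as) r = \<zero>\<^bsub>X\<^esub>"
    if "r \<in> slot_rels K S.F V {\<lambda>m. (as, m) | as. as \<in> words W p}" for r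
    by (rule S.slot_good[OF X V.module_axioms mem _ _ that]) (use multilinearD(1)[OF \<phi>] in auto)
  have 2: "free_lift K X (\<lambda>(as, v). \<phi> v as) r = \<zero>\<^bsub>X\<^esub>"
    if "r \<in> slot_rels K S.F W {\<lambda>a. (as[i := a], m) | as i m. as \<in> words W p \<and> i < p \<and> m \<in> carrier V}" for r
    by (rule S.slot_good[OF X W.module_axioms mem _ _ that])
      (use slot_linear_update[OF multilinearD(2)[OF \<phi>]] update_in_words in auto)
  show ?thesis unfolding S.good_def using mem 1 2 by (auto simp: tenl_rels_def Let_def)
qed

lemma sweedler_tenr:
  "v \<in> carrier V \<Longrightarrow> as \<in> words W p \<Longrightarrow> sweedler K X (tenr K V W p v as) (\<lambda>(v, as). \<phi> v as) = \<phi> v as"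
  unfolding tenr_def
  by (subst presentation.good_gen[OF presentation_tenr X good_multilinear_right]) auto

lemma sweedler_tenl:
  "v \<in> carrier V \<Longrightarrow> as \<in> words W p \<Longrightarrow> sweedler K X (tenl K W p V as v) (\<lambda>(as, v). \<phi> v as) = \<phi> v as"
  unfolding tenl_def
  by (subst presentation.good_gen[OF presentation_tenl X good_multilinear_left]) auto

lemma sweedler_tensorr_linear: "linear_map K (tensorr K V W p) X (\<lambda>t. sweedler K X t (\<lambda>(v, as). \<phi> v as))"
  unfolding tensorr_def by (rule presentation.good_linear[OF presentation_tenr X good_multilinear_right])

lemma sweedler_tensorl_linear: "linear_map K (tensorl K W p V) X (\<lambda>t. sweedler K X t (\<lambda>(as, v). \<phi> v as))"
  unfolding tensorl_def by (rule presentation.good_linear[OF presentation_tenl X good_multilinear_left])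

end

lemma tensorr_eq:
  assumes "module K X" "linear_map K (tensorr K V W p) X f" "linear_map K (tensorr K V W p) X h"
    "\<And>v as. v \<in> carrier V \<Longrightarrow> as \<in> words W p \<Longrightarrow> f (tenr K V W p v as) = h (tenr K V W p v as)"
    "t \<in> carrier (tensorr K V W p)"
  shows "f t = h t"
  by (rule presentation.linear_eq[OF presentation_tenr assms(1)]) (use assms in \<open>auto simp: tensorr_def tenr_def\<close>)

lemma tensorl_eq:
  assumes "module K X" "linear_map K (tensorl K W n V) X f" "linear_map K (tensorl K W n V) X h"
    "\<And>v as. v \<in> carrier V \<Longrightarrow> as \<in> words W n \<Longrightarrow> f (tenl K W n V as v) = h (tenl K W n V as v)"
    "t \<in> carrier (tensorl K W n V)"
  shows "f t = h t"
  by (rule presentation.linear_eq[OF presentation_tenl assms(1)]) (use assms in \<open>auto simp: tensorl_def tenl_def\<close>)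

end

section \<open>Sweedler calculus in a bialgebra\<close>

text \<open>Positions count from 0, so \<open>merge A (i - 1)\<close> forms the product in the i-th
  module face. The rules that follow let proofs run from either end of the word.\<close>

definition merge :: "('a, 'r) ring_scheme \<Rightarrow> nat \<Rightarrow> 'a list \<Rightarrow> 'a list" where
  "merge A k xs = take k xs @ [xs ! k \<otimes>\<^bsub>A\<^esub> xs ! Suc k] @ drop (Suc (Suc k)) xs"

lemma merge_0 [simp]: "merge A 0 (a # b # xs) = (a \<otimes>\<^bsub>A\<^esub> b) # xs"
  and merge_Suc [simp]: "merge A (Suc k) (a # xs) = a # merge A k xs"
  by (simp_all add: merge_def)

lemma merge_snoc: "Suc k < length xs \<Longrightarrow> merge A k (xs @ [a]) = merge A k xs @ [a]"
  by (simp add: merge_def nth_append)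

lemma merge_last: "merge A (length xs) (xs @ [a, b]) = xs @ [a \<otimes>\<^bsub>A\<^esub> b]"
  by (simp add: merge_def nth_append)

lemma slot_linear_sweedler:
  assumes "supported K (B \<times> C) t" "module K A" "module K X"
    "\<And>x y. x \<in> B \<Longrightarrow> y \<in> C \<Longrightarrow> slot_linear K A n X (\<phi> x y)"
  shows "slot_linear K A n X (\<lambda>xs. sweedler K X t (\<lambda>(x, y). \<phi> x y xs))"
  by (rule slot_linearI) (rule sweedler_linear_param[OF assms(1-3)], rule slot_linearD[OF assms(4)])

context bialgebra
begin

sublocale AA: two_modules K A A by unfold_locales

abbreviation word_prod :: "'a list \<Rightarrow> 'a" where "word_prod as \<equiv> foldr (\<otimes>\<^bsub>A\<^esub>) as \<one>\<^bsub>A\<^esub>"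

lemma module_A: "module K A" ..

lemma comult_closed: "a \<in> carrier A \<Longrightarrow> comult A a \<in> carrier (tensor K A A)"
  by (rule linear_mapD(1)[OF comult_linear])

lemma supported_comult: "a \<in> carrier A \<Longrightarrow> supported K (carrier A \<times> carrier A) (comult A a)"
  by (rule AA.supported_tensor[OF comult_closed])

lemma mult_linear:
  assumes "a \<in> carrier A"
  shows "linear_map K A A (\<lambda>b. a \<otimes>\<^bsub>A\<^esub> b)" "linear_map K A A (\<lambda>b. b \<otimes>\<^bsub>A\<^esub> a)"
  by (rule linear_mapI; simp add: assms A.r_distr A.l_distr smult_mult_left smult_mult_right)+

lemma counit_closed: "a \<in> carrier A \<Longrightarrow> counit A a \<in> carrier K"
  by (rule ring_hom_closed[OF counit_ring_hom])

lemma counit_mult: "a \<in> carrier A \<Longrightarrow> b \<in> carrier A \<Longrightarrow> counit A (a \<otimes>\<^bsub>A\<^esub> b) = counit A a \<otimes>\<^bsub>K\<^esub> counit A b"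
  by (rule ring_hom_mult[OF counit_ring_hom])

lemma counit_smult_linear:
  assumes "module K X" "x \<in> carrier X"
  shows "linear_map K A X (\<lambda>a. counit A a \<odot>\<^bsub>X\<^esub> x)"
proof -
  interpret X: module K X by fact
  show ?thesis
    by (rule linear_mapI) (simp_all add: assms counit_smult counit_closed ring_hom_add[OF counit_ring_hom]
      X.smult_l_distr X.smult_assoc1)
qed

lemma comult_sweedler_linear:
  assumes "module K X" "bilinear_map K A A X \<phi>"
  shows "linear_map K A X (\<lambda>a. sweedler K X (comult A a) (\<lambda>(x, y). \<phi> x y))"
  by (rule linear_map_comp[OF comult_linear AA.sw_linear[OF assms]])

text \<open>The axiom \<open>coassoc\<close> is the case of the universal trilinear map into
  \<open>A \<otimes> A \<otimes> A\<close>. A map \<open>\<phi>\<close> that is linear in each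
  argument factors through it by a linear map \<open>?L\<close>, which is pulled through both nested
  sums.\<close>

lemma sweedler_coassoc:
  assumes X: "module K X" and a: "a \<in> carrier A"
    and 1: "\<And>y z. y \<in> carrier A \<Longrightarrow> z \<in> carrier A \<Longrightarrow> linear_map K A X (\<lambda>x. \<phi> x y z)"
    and 2: "\<And>x z. x \<in> carrier A \<Longrightarrow> z \<in> carrier A \<Longrightarrow> linear_map K A X (\<lambda>y. \<phi> x y z)"
    and 3: "\<And>x y. x \<in> carrier A \<Longrightarrow> y \<in> carrier A \<Longrightarrow> linear_map K A X (\<lambda>z. \<phi> x y z)"
  shows "sweedler K X (comult A a) (\<lambda>(x, z). sweedler K X (comult A x) (\<lambda>(x, y). \<phi> x y z)) =
    sweedler K X (comult A a) (\<lambda>(x, y). sweedler K X (comult A y) (\<lambda>(y, z). \<phi> x y z))"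
proof -
  let ?\<phi> = "\<lambda>x ys. \<phi> x (ys ! 0) (ys ! 1)"
  let ?T = "tensorr K A A 2"
  note T = AA.tensorr_module
  have "multilinear K A A 2 X ?\<phi>"
  proof (rule multilinearI)
    show "linear_map K A X (\<lambda>x. ?\<phi> x as)" if "as \<in> words A 2" for as
      by (rule 1) (use that in \<open>auto simp: words_def\<close>)
    show "slot_linear K A 2 X (?\<phi> x)" if "x \<in> carrier A" for x
      using 2 3 that by (simp add: numeral_2_eq_2 slot_linear_Suc slot_linear_0 words_SucE)
        (auto elim!: words_SucE)
  qed
  note L = AA.sweedler_tensorr_linear[OF X this] and e = AA.sweedler_tenr[OF X this]
  let ?L = "\<lambda>t. sweedler K X t (\<lambda>(v, as). ?\<phi> v as)"
  have e: "?L (tenr K A A 2 x [y, z]) = \<phi> x y z" if "x \<in> carrier A" "y \<in> carrier A" "z \<in> carrier A" for x y z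
    using e[of x "[y, z]"] that by (simp add: words_def)
  have c: "tenr K A A 2 x [y, z] \<in> carrier ?T" if "x \<in> carrier A" "y \<in> carrier A" "z \<in> carrier A" for x y z
    by (rule AA.tenr_closed) (use that in \<open>auto simp: words_def\<close>)
  note s = supported_comult
  have \<phi>: "\<phi> x y z \<in> carrier X" if "x \<in> carrier A" "y \<in> carrier A" "z \<in> carrier A" for x y z
    using linear_mapD(1)[OF 1] that by simp
  have "sweedler K X (comult A a) (\<lambda>(x, z). sweedler K X (comult A x) (\<lambda>(x, y). \<phi> x y z)) =
    sweedler K X (comult A a) (\<lambda>(x, z). ?L (sweedler K ?T (comult A x) (\<lambda>(x, y). tenr K A A 2 x [y, z])))"
  proof (rule sweedler_cong'[OF s[OF a] X])
    fix x z assume xz: "x \<in> carrier A" "z \<in> carrier A"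
    show "sweedler K X (comult A x) (\<lambda>(x, y). \<phi> x y z) \<in> carrier X"
      by (rule sweedler_closed[OF s[OF xz(1)] X]) (simp add: \<phi> xz)
    show "sweedler K X (comult A x) (\<lambda>(x, y). \<phi> x y z) =
      ?L (sweedler K ?T (comult A x) (\<lambda>(x, y). tenr K A A 2 x [y, z]))"
      by (subst sweedler_linear_comp[OF s[OF xz(1)] T X L])
        (auto simp: c e[unfolded One_nat_def] \<phi> xz intro!: sweedler_cong'[OF s[OF xz(1)] X])
  qed
  also have "\<dots> = ?L (sweedler K ?T (comult A a) (\<lambda>(x, z). sweedler K ?T (comult A x) (\<lambda>(x, y). tenr K A A 2 x [y, z])))"
    by (rule sweedler_linear_comp[OF s[OF a] T X L, symmetric]) (rule sweedler_closed[OF s T c])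
  also have "\<dots> = ?L (sweedler K ?T (comult A a) (\<lambda>(x, y). sweedler K ?T (comult A y) (\<lambda>(y, z). tenr K A A 2 x [y, z])))"
    by (simp only: coassoc[OF a])
  also have "\<dots> = sweedler K X (comult A a) (\<lambda>(x, y). ?L (sweedler K ?T (comult A y) (\<lambda>(y, z). tenr K A A 2 x [y, z])))"
    by (rule sweedler_linear_comp[OF s[OF a] T X L]) (rule sweedler_closed[OF s T c])
  also have "\<dots> = sweedler K X (comult A a) (\<lambda>(x, y). sweedler K X (comult A y) (\<lambda>(y, z). \<phi> x y z))"
  proof (rule sweedler_cong'[OF s[OF a] X, symmetric])
    fix x y assume xz: "x \<in> carrier A" "y \<in> carrier A"
    show "sweedler K X (comult A y) (\<lambda>(y, z). \<phi> x y z) \<in> carrier X"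
      by (rule sweedler_closed[OF s[OF xz(2)] X]) (simp add: \<phi> xz)
    show "sweedler K X (comult A y) (\<lambda>(y, z). \<phi> x y z) =
      ?L (sweedler K ?T (comult A y) (\<lambda>(y, z). tenr K A A 2 x [y, z]))"
      by (subst sweedler_linear_comp[OF s[OF xz(2)] T X L])
        (auto simp: c e[unfolded One_nat_def] \<phi> xz intro!: sweedler_cong'[OF s[OF xz(2)] X])
  qed
  finally show ?thesis .
qed

text \<open>The counit axiom sums in \<open>A\<close>; applying \<open>L\<close> carries the sum
  over to \<open>X\<close>. In this form the counit cancels one part of a comultiplication inside a
  larger expression.\<close>

lemma sweedler_counit_left:
  assumes "module K X" "linear_map K A X L" "a \<in> carrier A"
  shows "sweedler K X (comult A a) (\<lambda>(x, y). counit A x \<odot>\<^bsub>X\<^esub> L y) = L a"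
proof -
  have "L a = L (sweedler K A (comult A a) (\<lambda>(x, y). counit A x \<odot>\<^bsub>A\<^esub> y))"
    by (simp add: counit_left assms)
  also have "\<dots> = sweedler K X (comult A a) (\<lambda>(x, y). L (counit A x \<odot>\<^bsub>A\<^esub> y))"
    by (rule sweedler_linear_comp[OF supported_comult module_A assms(1,2)]) (simp_all add: assms counit_closed)
  also have "\<dots> = sweedler K X (comult A a) (\<lambda>(x, y). counit A x \<odot>\<^bsub>X\<^esub> L y)"
    by (rule sweedler_cong'[OF supported_comult assms(1)])
      (simp_all add: assms counit_closed linear_mapD[OF assms(2)] flip: linear_mapD(3)[OF assms(2)])
  finally show ?thesis by simp
qed

text \<open>The representative chosen for the comultiplication of a product has no relation to the
  products of the chosen representatives; they agree only modulo the relations of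
  \<open>A \<otimes> A\<close>, and bilinearity of \<open>\<phi>\<close> makes the sums
  equal.\<close>

lemma sweedler_comult_mult:
  assumes "module K X" "bilinear_map K A A X \<phi>" "a \<in> carrier A" "b \<in> carrier A"
  shows "sweedler K X (comult A (a \<otimes>\<^bsub>A\<^esub> b)) (\<lambda>(x, y). \<phi> x y) =
    sweedler K X (comult A a) (\<lambda>(a1, a2). sweedler K X (comult A b) (\<lambda>(b1, b2). \<phi> (a1 \<otimes>\<^bsub>A\<^esub> b1) (a2 \<otimes>\<^bsub>A\<^esub> b2)))"
proof -
  note s = supported_comult and L = AA.sw_linear[OF assms(1,2)] and T = AA.tensor_module
  let ?L = "\<lambda>t. sweedler K X t (\<lambda>(x, y). \<phi> x y)"
  have \<phi>: "\<phi> x y \<in> carrier X" if "x \<in> carrier A" "y \<in> carrier A" for x y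
    using linear_mapD(1)[OF bilinearD(1)[OF assms(2)]] that by simp
  have "?L (comult A (a \<otimes>\<^bsub>A\<^esub> b)) = sweedler K X (comult A a) (\<lambda>(a1, a2).
      ?L (sweedler K (tensor K A A) (comult A b) (\<lambda>(b1, b2). ten K A A (a1 \<otimes>\<^bsub>A\<^esub> b1) (a2 \<otimes>\<^bsub>A\<^esub> b2))))"
    unfolding comult_mult[OF assms(3,4)]
    by (rule sweedler_linear_comp[OF s[OF assms(3)] T assms(1) L])
      (rule sweedler_closed[OF s[OF assms(4)] T], simp add: AA.ten_closed)
  also have "\<dots> = sweedler K X (comult A a) (\<lambda>(a1, a2). sweedler K X (comult A b) (\<lambda>(b1, b2). \<phi> (a1 \<otimes>\<^bsub>A\<^esub> b1) (a2 \<otimes>\<^bsub>A\<^esub> b2)))"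
  proof (rule sweedler_cong'[OF s[OF assms(3)] assms(1), symmetric])
    fix a1 a2 assume a: "a1 \<in> carrier A" "a2 \<in> carrier A"
    show "sweedler K X (comult A b) (\<lambda>(b1, b2). \<phi> (a1 \<otimes>\<^bsub>A\<^esub> b1) (a2 \<otimes>\<^bsub>A\<^esub> b2)) \<in> carrier X"
      by (rule sweedler_closed[OF s[OF assms(4)] assms(1)]) (simp add: \<phi> a)
    show "sweedler K X (comult A b) (\<lambda>(b1, b2). \<phi> (a1 \<otimes>\<^bsub>A\<^esub> b1) (a2 \<otimes>\<^bsub>A\<^esub> b2)) =
      ?L (sweedler K (tensor K A A) (comult A b) (\<lambda>(b1, b2). ten K A A (a1 \<otimes>\<^bsub>A\<^esub> b1) (a2 \<otimes>\<^bsub>A\<^esub> b2)))"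
      by (subst sweedler_linear_comp[OF s[OF assms(4)] T assms(1) L])
        (auto simp: AA.ten_closed AA.sw_ten[OF assms(1,2)] \<phi> a intro!: sweedler_cong'[OF s[OF assms(4)] assms(1)])
  qed
  finally show ?thesis .
qed

lemma sweedler_comult_one:
  "module K X \<Longrightarrow> bilinear_map K A A X \<phi> \<Longrightarrow> sweedler K X (comult A \<one>\<^bsub>A\<^esub>) (\<lambda>(x, y). \<phi> x y) = \<phi> \<one>\<^bsub>A\<^esub> \<one>\<^bsub>A\<^esub>"
  by (simp add: comult_one AA.sw_ten)

lemma word_prod_closed: "as \<in> words A n \<Longrightarrow> word_prod as \<in> carrier A"
  by (induction as arbitrary: n) (auto simp: words_def)

lemma word_prod_append: "as \<in> words A n \<Longrightarrow> bs \<in> words A m \<Longrightarrow> word_prod (as @ bs) = word_prod as \<otimes>\<^bsub>A\<^esub> word_prod bs"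
  by (induction n arbitrary: as)
    (auto elim!: words_SucE simp: word_prod_closed A.m_assoc)

lemma word_prod_snoc: "as \<in> words A n \<Longrightarrow> b \<in> carrier A \<Longrightarrow> word_prod (as @ [b]) = word_prod as \<otimes>\<^bsub>A\<^esub> b"
  using word_prod_append[of as n "[b]" 1] by simp

lemma word_prod_slot_linear: "slot_linear K A n A word_prod"
proof (induction n)
  case (Suc n)
  then show ?case unfolding slot_linear_Suc
    by (auto intro: mult_linear word_prod_closed slot_linear_comp[OF _ mult_linear(1)])
qed (rule slot_linear_0)

lemma merge_in_words: "xs \<in> words A (Suc n) \<Longrightarrow> k < n \<Longrightarrow> merge A k xs \<in> words A n"
proof (induction k arbitrary: xs n)
  case 0
  then show ?case by (auto elim!: words_SucE simp: gr0_conv_Suc)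
next
  case (Suc k)
  then show ?case by (auto elim!: words_SucE simp: less_Suc_eq_0_disj Suc_less_eq2)
qed

lemma word_prod_merge: "xs \<in> words A (Suc n) \<Longrightarrow> k < n \<Longrightarrow> word_prod (merge A k xs) = word_prod xs"
proof (induction k arbitrary: xs n)
  case 0
  then show ?case by (auto elim!: words_SucE simp: gr0_conv_Suc A.m_assoc word_prod_closed)
next
  case (Suc k)
  then show ?case by (auto elim!: words_SucE simp: Suc_less_eq2)
qed

context
  fixes X :: "('k, 'x, 's) module_scheme"
  assumes X: "module K X"
begin

lemma sweedler_list_closed:
  "xs \<in> words A n \<Longrightarrow> (\<And>cs ds. cs \<in> words A n \<Longrightarrow> ds \<in> words A n \<Longrightarrow> \<phi> cs ds \<in> carrier X)
    \<Longrightarrow> sweedler_list K A X xs \<phi> \<in> carrier X"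
proof (induction n arbitrary: xs \<phi>)
  case (Suc n)
  from Suc.prems(1) obtain x xs' where x: "xs = x # xs'" "x \<in> carrier A" "xs' \<in> words A n" by (rule words_SucE)
  show ?case unfolding x(1) sweedler_list.simps
    by (rule sweedler_closed[OF supported_comult[OF x(2)] X], rule Suc.IH[OF x(3)]) (simp add: Suc.prems(2))
qed simp

lemma sweedler_list_cong:
  "xs \<in> words A n \<Longrightarrow> (\<And>cs ds. cs \<in> words A n \<Longrightarrow> ds \<in> words A n \<Longrightarrow> \<phi> cs ds \<in> carrier X) \<Longrightarrow>
    (\<And>cs ds. cs \<in> words A n \<Longrightarrow> ds \<in> words A n \<Longrightarrow> \<phi> cs ds = \<psi> cs ds)
    \<Longrightarrow> sweedler_list K A X xs \<phi> = sweedler_list K A X xs \<psi>"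
proof (induction n arbitrary: xs \<phi> \<psi>)
  case (Suc n)
  from Suc.prems(1) obtain x xs' where x: "xs = x # xs'" "x \<in> carrier A" "xs' \<in> words A n" by (rule words_SucE)
  show ?case unfolding x(1) sweedler_list.simps
  proof (rule sweedler_cong'[OF supported_comult[OF x(2)] X])
    fix a b assume ab: "a \<in> carrier A" "b \<in> carrier A"
    show "sweedler_list K A X xs' (\<lambda>cs ds. \<phi> (a # cs) (b # ds)) \<in> carrier X"
      by (rule sweedler_list_closed[OF x(3)]) (simp add: Suc.prems(2) ab)
    show "sweedler_list K A X xs' (\<lambda>cs ds. \<phi> (a # cs) (b # ds)) = sweedler_list K A X xs' (\<lambda>cs ds. \<psi> (a # cs) (b # ds))"
      by (rule Suc.IH[OF x(3)]; (rule Suc.prems(2) | rule Suc.prems(3)); simp add: ab)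
  qed
qed simp

lemma sweedler_list_linear_comp:
  assumes "module K Y" "linear_map K X Y L"
  shows "xs \<in> words A n \<Longrightarrow> (\<And>cs ds. cs \<in> words A n \<Longrightarrow> ds \<in> words A n \<Longrightarrow> \<phi> cs ds \<in> carrier X)
    \<Longrightarrow> L (sweedler_list K A X xs \<phi>) = sweedler_list K A Y xs (\<lambda>cs ds. L (\<phi> cs ds))"
proof (induction n arbitrary: xs \<phi>)
  case (Suc n)
  from Suc.prems(1) obtain x xs' where x: "xs = x # xs'" "x \<in> carrier A" "xs' \<in> words A n" by (rule words_SucE)
  have c: "sweedler_list K A X xs' (\<lambda>cs ds. \<phi> (a # cs) (b # ds)) \<in> carrier X" if "a \<in> carrier A" "b \<in> carrier A" for a b
    by (rule sweedler_list_closed[OF x(3)]) (simp add: Suc.prems(2) that)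
  show ?case unfolding x(1) sweedler_list.simps
    by (subst sweedler_linear_comp[OF supported_comult[OF x(2)] X assms c], assumption+)
      (rule sweedler_cong'[OF supported_comult[OF x(2)] assms(1)],
        auto intro!: linear_mapD(1)[OF assms(2)] c Suc.IH[OF x(3)] Suc.prems(2))
qed simp

lemma sweedler_list_linear_param:
  assumes "module K U"
  shows "xs \<in> words A n \<Longrightarrow>
    (\<And>cs ds. cs \<in> words A n \<Longrightarrow> ds \<in> words A n \<Longrightarrow> linear_map K U X (\<lambda>u. \<phi> u cs ds))
    \<Longrightarrow> linear_map K U X (\<lambda>u. sweedler_list K A X xs (\<phi> u))"
proof (induction n arbitrary: xs \<phi>)
  case (Suc n)
  from Suc.prems(1) obtain x xs' where x: "xs = x # xs'" "x \<in> carrier A" "xs' \<in> words A n" by (rule words_SucE)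
  show ?case unfolding x(1) sweedler_list.simps
    by (rule sweedler_linear_param[OF supported_comult[OF x(2)] assms X])
      (rule Suc.IH[OF x(3)], rule Suc.prems(2), simp_all)
qed simp

lemma sweedler_list_swap:
  assumes "supported K (B \<times> C) t"
  shows "xs \<in> words A n \<Longrightarrow>
    (\<And>cs ds y z. cs \<in> words A n \<Longrightarrow> ds \<in> words A n \<Longrightarrow> y \<in> B \<Longrightarrow> z \<in> C \<Longrightarrow> \<phi> cs ds y z \<in> carrier X)
    \<Longrightarrow> sweedler_list K A X xs (\<lambda>cs ds. sweedler K X t (\<lambda>(y, z). \<phi> cs ds y z)) =
      sweedler K X t (\<lambda>(y, z). sweedler_list K A X xs (\<lambda>cs ds. \<phi> cs ds y z))"
proof (induction n arbitrary: xs \<phi>)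
  case (Suc n)
  from Suc.prems(1) obtain x xs' where x: "xs = x # xs'" "x \<in> carrier A" "xs' \<in> words A n" by (rule words_SucE)
  note s = supported_comult[OF x(2)]
  have c: "sweedler_list K A X xs' (\<lambda>cs ds. \<phi> (a # cs) (b # ds) y z) \<in> carrier X"
    if "a \<in> carrier A" "b \<in> carrier A" "y \<in> B" "z \<in> C" for a b y z
    by (rule sweedler_list_closed[OF x(3)]) (simp add: Suc.prems(2) that)
  have "sweedler_list K A X xs (\<lambda>cs ds. sweedler K X t (\<lambda>(y, z). \<phi> cs ds y z)) =
    sweedler K X (comult A x) (\<lambda>(a, b). sweedler K X t (\<lambda>(y, z). sweedler_list K A X xs' (\<lambda>cs ds. \<phi> (a # cs) (b # ds) y z)))"
    unfolding x(1) sweedler_list.simps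
    by (rule sweedler_cong'[OF s X])
      (auto intro!: sweedler_list_closed[OF x(3)] sweedler_closed[OF assms X] Suc.prems(2) Suc.IH[OF x(3)])
  also have "\<dots> = sweedler K X t (\<lambda>(y, z). sweedler_list K A X xs (\<lambda>cs ds. \<phi> cs ds y z))"
    unfolding x(1) sweedler_list.simps by (rule sweedler_swap[OF assms X s c])
  finally show ?case .
qed simp

lemma sweedler_list_finsum:
  assumes "finite I"
  shows "xs \<in> words A n \<Longrightarrow>
    (\<And>i cs ds. i \<in> I \<Longrightarrow> cs \<in> words A n \<Longrightarrow> ds \<in> words A n \<Longrightarrow> \<phi> i cs ds \<in> carrier X)
    \<Longrightarrow> (\<Oplus>\<^bsub>X\<^esub>i\<in>I. sweedler_list K A X xs (\<phi> i)) = sweedler_list K A X xs (\<lambda>cs ds. \<Oplus>\<^bsub>X\<^esub>i\<in>I. \<phi> i cs ds)"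
proof (induction n arbitrary: xs \<phi>)
  case (Suc n)
  from Suc.prems(1) obtain x xs' where x: "xs = x # xs'" "x \<in> carrier A" "xs' \<in> words A n" by (rule words_SucE)
  interpret X: module K X by (rule X)
  have c: "sweedler_list K A X xs' (\<lambda>cs ds. \<phi> i (a # cs) (b # ds)) \<in> carrier X"
    if "i \<in> I" "a \<in> carrier A" "b \<in> carrier A" for a b i
    by (rule sweedler_list_closed[OF x(3)]) (simp add: Suc.prems(2) that)
  show ?case unfolding x(1) sweedler_list.simps
    by (subst sweedler_finsum[OF supported_comult[OF x(2)] X assms c], assumption+)
      (rule sweedler_cong'[OF supported_comult[OF x(2)] X],
        auto intro!: X.M.finsum_closed c Suc.IH[OF x(3)] Suc.prems(2))
qed simp

lemma sweedler_list_slot_linear: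
  "(\<And>ds. ds \<in> words A n \<Longrightarrow> slot_linear K A n X (\<lambda>cs. \<phi> cs ds)) \<Longrightarrow>
    (\<And>cs. cs \<in> words A n \<Longrightarrow> slot_linear K A n X (\<phi> cs))
    \<Longrightarrow> slot_linear K A n X (\<lambda>xs. sweedler_list K A X xs \<phi>)"
proof (induction n arbitrary: \<phi>)
  case (Suc n)
  have 1: "slot_linear K A (Suc n) X (\<lambda>cs. \<phi> cs (b # ds))" if "b \<in> carrier A" "ds \<in> words A n" for b ds
    by (rule Suc.prems(1)) (simp add: that)
  have 2: "slot_linear K A (Suc n) X (\<phi> (a # cs))" if "a \<in> carrier A" "cs \<in> words A n" for a cs
    by (rule Suc.prems(2)) (simp add: that)
  show ?case unfolding slot_linear_Suc sweedler_list.simps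
  proof (intro conjI ballI)
    fix xs assume xs: "xs \<in> words A n"
    show "linear_map K A X (\<lambda>x. sweedler K X (comult A x) (\<lambda>(a, b). sweedler_list K A X xs (\<lambda>cs ds. \<phi> (a # cs) (b # ds))))"
      by (rule comult_sweedler_linear[OF X bilinearI]; rule sweedler_list_linear_param[OF module_A xs])
        (use 1 2 in \<open>simp_all add: slot_linear_Suc\<close>)
  next
    fix x assume x: "x \<in> carrier A"
    show "slot_linear K A n X (\<lambda>xs. sweedler K X (comult A x) (\<lambda>(a, b). sweedler_list K A X xs (\<lambda>cs ds. \<phi> (a # cs) (b # ds))))"
      by (rule slot_linear_sweedler[OF supported_comult[OF x] module_A X]; rule Suc.IH)
        (use 1 2 in \<open>simp_all add: slot_linear_Suc\<close>)
  qed
qed (rule slot_linear_0)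

text \<open>As the comultiplication is multiplicative, splitting a word after multiplying two
  neighbours amounts to multiplying those neighbours in both halves. This is the compatibility of
  the inner module faces with the codiagonal coaction.\<close>

lemma sweedler_list_merge:
  "xs \<in> words A (Suc n) \<Longrightarrow> k < n \<Longrightarrow>
    (\<And>ds. ds \<in> words A n \<Longrightarrow> slot_linear K A n X (\<lambda>cs. \<phi> cs ds)) \<Longrightarrow>
    (\<And>cs. cs \<in> words A n \<Longrightarrow> slot_linear K A n X (\<phi> cs)) \<Longrightarrow>
    sweedler_list K A X (merge A k xs) \<phi> = sweedler_list K A X xs (\<lambda>cs ds. \<phi> (merge A k cs) (merge A k ds))"
proof (induction k arbitrary: xs n \<phi>)
  case 0
  then obtain m where n: "n = Suc m" by (auto simp: gr0_conv_Suc)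
  obtain a b as where xs: "xs = a # b # as" "a \<in> carrier A" "b \<in> carrier A" "as \<in> words A m"
    using 0(1) unfolding n by (elim words_SucE) auto
  have "bilinear_map K A A X (\<lambda>x y. sweedler_list K A X as (\<lambda>cs ds. \<phi> (x # cs) (y # ds)))"
    by (rule bilinearI; rule sweedler_list_linear_param[OF module_A xs(4)])
      (use 0(3,4) n in \<open>simp_all add: slot_linear_Suc\<close>)
  from sweedler_comult_mult[OF X this xs(2,3)] show ?case by (simp add: xs(1))
next
  case (Suc k)
  obtain m where n: "n = Suc m" using Suc.prems(2) by (cases n) auto
  obtain x xs' where x: "xs = x # xs'" "x \<in> carrier A" "xs' \<in> words A (Suc m)"
    using Suc.prems(1) unfolding n by (rule words_SucE)
  have k: "k < m" using Suc.prems(2) n by simp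
  have 1: "slot_linear K A (Suc m) X (\<lambda>cs. \<phi> cs (b # ds))" if "b \<in> carrier A" "ds \<in> words A m" for b ds
    using Suc.prems(3)[of "b # ds"] that by (simp add: n)
  have 2: "slot_linear K A (Suc m) X (\<phi> (a # cs))" if "a \<in> carrier A" "cs \<in> words A m" for a cs
    using Suc.prems(4)[of "a # cs"] that by (simp add: n)
  have c: "\<phi> cs ds \<in> carrier X" if "cs \<in> words A n" "ds \<in> words A n" for cs ds
  proof -
    obtain a cs' where "cs = a # cs'" "a \<in> carrier A" "cs' \<in> words A m" using \<open>cs \<in> words A n\<close> unfolding n by (rule words_SucE)
    then show ?thesis using Suc.prems(3)[OF that(2)] unfolding n slot_linear_Suc by (auto dest: linear_mapD(1))
  qed
  show ?case unfolding x(1) merge_Suc sweedler_list.simps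
    by (rule sweedler_cong'[OF supported_comult[OF x(2)] X])
      (use 1 2 c n k in \<open>auto intro!: sweedler_list_closed[OF merge_in_words[OF x(3) k]] Suc.IH[OF x(3) k]
        simp: slot_linear_Suc\<close>)
qed

text \<open>Coassociativity of the codiagonal coaction on words.\<close>

lemma sweedler_list_comult_word_prod:
  "xs \<in> words A n \<Longrightarrow>
    (\<And>cs. cs \<in> words A n \<Longrightarrow> bilinear_map K A A X (\<psi> cs)) \<Longrightarrow>
    (\<And>x y. x \<in> carrier A \<Longrightarrow> y \<in> carrier A \<Longrightarrow> slot_linear K A n X (\<lambda>cs. \<psi> cs x y)) \<Longrightarrow>
    sweedler_list K A X xs (\<lambda>cs ds. sweedler K X (comult A (word_prod ds)) (\<lambda>(x, y). \<psi> cs x y)) =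
    sweedler_list K A X xs (\<lambda>cs ds. sweedler_list K A X cs (\<lambda>es fs. \<psi> es (word_prod fs) (word_prod ds)))"
proof (induction n arbitrary: xs \<psi>)
  case 0
  \<comment> \<open>The empty word has product \<open>\<one>\<close>, whose comultiplication is
    \<open>\<one> \<otimes> \<one>\<close>.\<close>
  then show ?case by (simp add: sweedler_comult_one X)
next
  case (Suc n)
  from Suc.prems(1) obtain x xs' where x: "xs = x # xs'" "x \<in> carrier A" "xs' \<in> words A n" by (rule words_SucE)
  note s = supported_comult
  have b: "bilinear_map K A A X (\<psi> (a # cs))" if "a \<in> carrier A" "cs \<in> words A n" for a cs
    by (rule Suc.prems(2)) (simp add: that)
  have sl1: "linear_map K A X (\<lambda>a. \<psi> (a # cs) y z)" if "y \<in> carrier A" "z \<in> carrier A" "cs \<in> words A n" for y z cs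
    using Suc.prems(3)[OF that(1,2)] that(3) by (simp add: slot_linear_Suc)
  have sl2: "slot_linear K A n X (\<lambda>cs. \<psi> (a # cs) y z)" if "a \<in> carrier A" "y \<in> carrier A" "z \<in> carrier A" for a y z
    using Suc.prems(3)[OF that(2,3)] that(1) by (simp add: slot_linear_Suc)
  have c: "\<psi> (a # cs) y z \<in> carrier X" if "a \<in> carrier A" "y \<in> carrier A" "z \<in> carrier A" "cs \<in> words A n" for a y z cs
    using linear_mapD(1)[OF sl1] that by simp
  have b': "bilinear_map K A A X (\<lambda>y z. \<psi> (a # cs) (p \<otimes>\<^bsub>A\<^esub> y) (q \<otimes>\<^bsub>A\<^esub> z))"
    if "a \<in> carrier A" "p \<in> carrier A" "q \<in> carrier A" "cs \<in> words A n" for a p q cs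
    by (rule bilinearI)
      (auto intro!: linear_map_comp[OF mult_linear(1) bilinearD(1)[OF b]] linear_map_comp[OF mult_linear(1) bilinearD(2)[OF b]] that)
  \<comment> \<open>\<open>a\<close>, \<open>p\<close>, \<open>q\<close> are the three parts of the
    first letter after two comultiplications: \<open>a\<close> stays in the word, \<open>p\<close>
    and \<open>q\<close> are the left factors of the two products.\<close>
  let ?T = "\<lambda>a p q. sweedler_list K A X xs' (\<lambda>cs ds. sweedler_list K A X cs (\<lambda>es fs.
      \<psi> (a # es) (p \<otimes>\<^bsub>A\<^esub> word_prod fs) (q \<otimes>\<^bsub>A\<^esub> word_prod ds)))"
  have "sweedler_list K A X xs (\<lambda>cs ds. sweedler K X (comult A (word_prod ds)) (\<lambda>(x, y). \<psi> cs x y)) =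
    sweedler K X (comult A x) (\<lambda>(a, b). sweedler K X (comult A b) (\<lambda>(p, q). ?T a p q))"
    unfolding x(1) sweedler_list.simps
  proof (rule sweedler_cong'[OF s[OF x(2)] X])
    fix a b assume ab: "a \<in> carrier A" "b \<in> carrier A"
    show "sweedler_list K A X xs' (\<lambda>cs ds. sweedler K X (comult A (word_prod (b # ds))) (\<lambda>(x, y). \<psi> (a # cs) x y)) \<in> carrier X"
      by (rule sweedler_list_closed[OF x(3)], rule sweedler_closed[OF s X])
        (simp_all add: c ab word_prod_closed)
    have "sweedler_list K A X xs' (\<lambda>cs ds. sweedler K X (comult A (word_prod (b # ds))) (\<lambda>(x, y). \<psi> (a # cs) x y)) =
      sweedler_list K A X xs' (\<lambda>cs ds. sweedler K X (comult A b) (\<lambda>(p, q). sweedler K X (comult A (word_prod ds)) (\<lambda>(x, y). \<psi> (a # cs) (p \<otimes>\<^bsub>A\<^esub> x) (q \<otimes>\<^bsub>A\<^esub> y))))"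
    proof (rule sweedler_list_cong[OF x(3)])
      fix cs ds assume cd: "cs \<in> words A n" "ds \<in> words A n"
      show "sweedler K X (comult A (word_prod (b # ds))) (\<lambda>(x, y). \<psi> (a # cs) x y) \<in> carrier X"
        by (rule sweedler_closed[OF s X]) (simp_all add: c ab cd word_prod_closed[OF cd(2)])
      show "sweedler K X (comult A (word_prod (b # ds))) (\<lambda>(x, y). \<psi> (a # cs) x y) =
        sweedler K X (comult A b) (\<lambda>(p, q). sweedler K X (comult A (word_prod ds)) (\<lambda>(x, y). \<psi> (a # cs) (p \<otimes>\<^bsub>A\<^esub> x) (q \<otimes>\<^bsub>A\<^esub> y)))"
        using sweedler_comult_mult[OF X b[OF ab(1) cd(1)] ab(2) word_prod_closed[OF cd(2)]] by simp
    qed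
    \<comment> \<open>The sum over \<open>p\<close> and \<open>q\<close> is moved outside so that
      the induction hypothesis applies to the rest of the word, with \<open>p\<close> and
      \<open>q\<close> multiplied into \<open>\<psi>\<close>.\<close>
    also have "\<dots> = sweedler K X (comult A b) (\<lambda>(p, q). sweedler_list K A X xs' (\<lambda>cs ds. sweedler K X (comult A (word_prod ds)) (\<lambda>(x, y). \<psi> (a # cs) (p \<otimes>\<^bsub>A\<^esub> x) (q \<otimes>\<^bsub>A\<^esub> y))))"
      by (rule sweedler_list_swap[OF s[OF ab(2)] x(3)], rule sweedler_closed[OF s X])
        (simp_all add: c ab word_prod_closed)
    also have "\<dots> = sweedler K X (comult A b) (\<lambda>(p, q). ?T a p q)"
    proof (rule sweedler_cong'[OF s[OF ab(2)] X])
      fix p q assume pq: "p \<in> carrier A" "q \<in> carrier A"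
      show "sweedler_list K A X xs' (\<lambda>cs ds. sweedler K X (comult A (word_prod ds)) (\<lambda>(x, y). \<psi> (a # cs) (p \<otimes>\<^bsub>A\<^esub> x) (q \<otimes>\<^bsub>A\<^esub> y))) \<in> carrier X"
        by (rule sweedler_list_closed[OF x(3)], rule sweedler_closed[OF s X])
          (simp_all add: c ab pq word_prod_closed)
      show "sweedler_list K A X xs' (\<lambda>cs ds. sweedler K X (comult A (word_prod ds)) (\<lambda>(x, y). \<psi> (a # cs) (p \<otimes>\<^bsub>A\<^esub> x) (q \<otimes>\<^bsub>A\<^esub> y))) = ?T a p q"
        by (rule Suc.IH[OF x(3)]) (simp_all add: b' sl2 ab pq)
    qed
    finally show "sweedler_list K A X xs' (\<lambda>cs ds. sweedler K X (comult A (word_prod (b # ds))) (\<lambda>(x, y). \<psi> (a # cs) x y)) =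
      sweedler K X (comult A b) (\<lambda>(p, q). ?T a p q)" .
  qed
  \<comment> \<open>So far the second splitting of the first letter is that of its right part; the
    goal splits the left part. Coassociativity for this single letter connects the two.\<close>
  also have "\<dots> = sweedler K X (comult A x) (\<lambda>(b, q). sweedler K X (comult A b) (\<lambda>(a, p). ?T a p q))"
  proof (rule sweedler_coassoc[OF X x(2), symmetric])
    show "linear_map K A X (\<lambda>a. ?T a p q)" if "p \<in> carrier A" "q \<in> carrier A" for p q
      by (rule sweedler_list_linear_param[OF module_A x(3)], rule sweedler_list_linear_param[OF module_A],
        assumption, rule sl1) (simp_all add: that word_prod_closed)
    show "linear_map K A X (\<lambda>p. ?T a p q)" if "a \<in> carrier A" "q \<in> carrier A" for a q
      by (rule sweedler_list_linear_param[OF module_A x(3)], rule sweedler_list_linear_param[OF module_A],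
        assumption, rule linear_map_comp[OF mult_linear(2) bilinearD(1)[OF b]]) (simp_all add: that word_prod_closed)
    show "linear_map K A X (\<lambda>q. ?T a p q)" if "a \<in> carrier A" "p \<in> carrier A" for a p
      by (rule sweedler_list_linear_param[OF module_A x(3)], rule sweedler_list_linear_param[OF module_A],
        assumption, rule linear_map_comp[OF mult_linear(2) bilinearD(2)[OF b]]) (simp_all add: that word_prod_closed)
  qed
  also have "\<dots> = sweedler_list K A X xs (\<lambda>cs ds. sweedler_list K A X cs (\<lambda>es fs. \<psi> es (word_prod fs) (word_prod ds)))"
    unfolding x(1) sweedler_list.simps
  proof (rule sweedler_cong'[OF s[OF x(2)] X])
    fix b q assume bq: "b \<in> carrier A" "q \<in> carrier A"
    have c': "sweedler_list K A X cs (\<lambda>es fs. \<psi> (a # es) (p \<otimes>\<^bsub>A\<^esub> word_prod fs) (q \<otimes>\<^bsub>A\<^esub> word_prod ds)) \<in> carrier X"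
      if "cs \<in> words A n" "ds \<in> words A n" "a \<in> carrier A" "p \<in> carrier A" for cs ds a p
      by (rule sweedler_list_closed[OF that(1)]) (simp add: c that(3,4) bq word_prod_closed[OF that(2)] word_prod_closed)
    show "sweedler K X (comult A b) (\<lambda>(a, p). ?T a p q) \<in> carrier X"
      by (rule sweedler_closed[OF s[OF bq(1)] X], rule sweedler_list_closed[OF x(3) c'])
    show "sweedler K X (comult A b) (\<lambda>(a, p). ?T a p q) =
      sweedler_list K A X xs' (\<lambda>cs ds. sweedler K X (comult A b) (\<lambda>(a, p). sweedler_list K A X cs (\<lambda>es fs.
        \<psi> (a # es) (word_prod (p # fs)) (word_prod (q # ds)))))"
      by (simp, rule sweedler_list_swap[OF s[OF bq(1)] x(3) c', symmetric])
  qed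
  finally show ?case .
qed

end

end

section \<open>Spaces of linear maps\<close>

context
  fixes K :: "('k, 'q) ring_scheme" and X :: "('k, 'x, 'r) module_scheme" and Y :: "('k, 'y, 's) module_scheme"
  assumes X: "module K X" and Y: "module K Y"
begin

lemma hom_module_carrier:
  "f \<in> carrier (hom_module K X Y) \<longleftrightarrow> f \<in> extensional (carrier X) \<and> linear_map K X Y f"
  by (simp add: hom_module_def)

lemma hom_module_apply:
  assumes "x \<in> carrier X"
  shows "(f \<oplus>\<^bsub>hom_module K X Y\<^esub> g) x = f x \<oplus>\<^bsub>Y\<^esub> g x" "(k \<odot>\<^bsub>hom_module K X Y\<^esub> f) x = k \<odot>\<^bsub>Y\<^esub> f x"
    "\<zero>\<^bsub>hom_module K X Y\<^esub> x = \<zero>\<^bsub>Y\<^esub>"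
  using assms by (simp_all add: hom_module_def)

lemma hom_module_eqI:
  assumes "f \<in> carrier (hom_module K X Y)" "g \<in> carrier (hom_module K X Y)"
    "\<And>x. x \<in> carrier X \<Longrightarrow> f x = g x"
  shows "f = g"
  by (rule extensionalityI[of _ "carrier X"]) (use assms in \<open>auto simp: hom_module_carrier\<close>)

lemma hom_module_restrict: "linear_map K X Y f \<Longrightarrow> (\<lambda>x\<in>carrier X. f x) \<in> carrier (hom_module K X Y)"
  unfolding hom_module_carrier by (auto intro: linear_map_cong[OF X])

lemma hom_module_module: "module K (hom_module K X Y)"
proof -
  interpret X: module K X by (rule X)
  interpret Y: module K Y by (rule Y)
  let ?H = "hom_module K X Y"
  have sm: "k \<odot>\<^bsub>?H\<^esub> f \<in> carrier ?H" if "k \<in> carrier K" "f \<in> carrier ?H" for k f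
    using hom_module_restrict[OF linear_map_smult_fun[OF X Y _ that(1)]] that(2)
    by (simp add: hom_module_def)
  have ad: "f \<oplus>\<^bsub>?H\<^esub> g \<in> carrier ?H" if "f \<in> carrier ?H" "g \<in> carrier ?H" for f g
    using hom_module_restrict[OF linear_map_add_fun[OF X Y]] that by (simp add: hom_module_def)
  have ze: "\<zero>\<^bsub>?H\<^esub> \<in> carrier ?H"
    using hom_module_restrict[OF linear_map_zero_fun[OF X Y]] by (simp add: hom_module_def)
  have cl: "f x \<in> carrier Y" if "f \<in> carrier ?H" "x \<in> carrier X" for f x
    using that by (auto simp: hom_module_carrier linear_mapD)
  note [simp] = hom_module_apply cl
  show ?thesis
  proof (rule moduleI[OF X.R.is_cring _ sm])
    show "abelian_group ?H"
    proof (rule abelian_groupI)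
      fix f assume f: "f \<in> carrier ?H"
      have "(\<ominus>\<^bsub>K\<^esub> \<one>\<^bsub>K\<^esub>) \<odot>\<^bsub>?H\<^esub> f \<oplus>\<^bsub>?H\<^esub> f = \<zero>\<^bsub>?H\<^esub>"
        by (rule hom_module_eqI) (simp_all add: ad sm ze f Y.smult_l_minus Y.M.l_neg)
      then show "\<exists>g\<in>carrier ?H. g \<oplus>\<^bsub>?H\<^esub> f = \<zero>\<^bsub>?H\<^esub>" using sm f by blast
    qed (auto intro!: hom_module_eqI simp: ad sm ze Y.M.a_ac)
  qed (auto intro!: hom_module_eqI simp: ad sm ze Y.smult_l_distr Y.smult_r_distr Y.smult_assoc1)
qed

lemma hom_module_eval_linear: "x \<in> carrier X \<Longrightarrow> linear_map K (hom_module K X Y) Y (\<lambda>f. f x)"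
  by (rule linear_mapI) (auto simp: hom_module_apply hom_module_carrier intro: linear_mapD(1))

text \<open>Evaluation at \<open>x\<close> is a linear map and so passes through the sum.\<close>

lemma hom_module_finsum_apply:
  assumes "finite I" "\<And>i. i \<in> I \<Longrightarrow> f i \<in> carrier (hom_module K X Y)" "x \<in> carrier X"
  shows "(\<Oplus>\<^bsub>hom_module K X Y\<^esub>i\<in>I. f i) x = (\<Oplus>\<^bsub>Y\<^esub>i\<in>I. f i x)"
  by (rule linear_map_finsum[OF hom_module_module Y hom_module_eval_linear assms(1)]) (use assms in auto)

end


section \<open>Linearity of the differentials\<close>

context bialgebra
begin

lemma map2_mult_in_words: "cs \<in> words A n \<Longrightarrow> bs \<in> words A n \<Longrightarrow> map2 (\<lambda>c b. c \<otimes>\<^bsub>A\<^esub> b) cs bs \<in> words A n"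
  by (induction n arbitrary: cs bs) (auto elim!: words_SucE)

lemma slot_linear_map2_right:
  "slot_linear K A n X \<phi> \<Longrightarrow> cs \<in> words A n \<Longrightarrow> slot_linear K A n X (\<lambda>bs. \<phi> (map2 (\<lambda>c b. c \<otimes>\<^bsub>A\<^esub> b) cs bs))"
proof (induction n arbitrary: cs \<phi>)
  case (Suc n)
  from Suc.prems(2) obtain c cs' where c: "cs = c # cs'" "c \<in> carrier A" "cs' \<in> words A n" by (rule words_SucE)
  have 1: "linear_map K A X (\<lambda>a. \<phi> (a # as))" if "as \<in> words A n" for as
    using Suc.prems(1) that by (simp add: slot_linear_Suc)
  have 2: "slot_linear K A n X (\<lambda>as. \<phi> (a # as))" if "a \<in> carrier A" for a
    using Suc.prems(1) that by (simp add: slot_linear_Suc)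
  show ?case unfolding slot_linear_Suc c(1)
    using linear_map_comp[OF mult_linear(1)[OF c(2)] 1[OF map2_mult_in_words[OF c(3)]]] Suc.IH[OF 2 c(3)] c(2)
    by simp
qed (rule slot_linear_0)

lemma slot_linear_map2_left:
  "slot_linear K A n X \<phi> \<Longrightarrow> bs \<in> words A n \<Longrightarrow> slot_linear K A n X (\<lambda>cs. \<phi> (map2 (\<lambda>c b. c \<otimes>\<^bsub>A\<^esub> b) cs bs))"
proof (induction n arbitrary: bs \<phi>)
  case (Suc n)
  from Suc.prems(2) obtain b bs' where b: "bs = b # bs'" "b \<in> carrier A" "bs' \<in> words A n" by (rule words_SucE)
  have 1: "linear_map K A X (\<lambda>a. \<phi> (a # as))" if "as \<in> words A n" for as
    using Suc.prems(1) that by (simp add: slot_linear_Suc)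
  have 2: "slot_linear K A n X (\<lambda>as. \<phi> (a # as))" if "a \<in> carrier A" for a
    using Suc.prems(1) that by (simp add: slot_linear_Suc)
  show ?case unfolding slot_linear_Suc b(1)
    using linear_map_comp[OF mult_linear(2)[OF b(2)] 1[OF map2_mult_in_words[OF _ b(3)]]] Suc.IH[OF 2 b(3)] b(2)
    by simp
qed (rule slot_linear_0)

lemma slot_linear_merge:
  "slot_linear K A n X \<phi> \<Longrightarrow> k < n \<Longrightarrow> slot_linear K A (Suc n) X (\<lambda>as. \<phi> (merge A k as))"
proof (induction k arbitrary: n \<phi>)
  case 0
  then obtain m where n: "n = Suc m" by (auto simp: gr0_conv_Suc)
  have 1: "linear_map K A X (\<lambda>a. \<phi> (a # as))" if "as \<in> words A m" for as
    using 0(1) that by (simp add: slot_linear_Suc n)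
  have 2: "slot_linear K A m X (\<lambda>as. \<phi> (a # as))" if "a \<in> carrier A" for a
    using 0(1) that by (simp add: slot_linear_Suc n)
  show ?case unfolding n slot_linear_Suc
    by (auto elim!: words_SucE intro: linear_map_comp[OF mult_linear(1) 1] linear_map_comp[OF mult_linear(2) 1] 2)
next
  case (Suc k)
  then obtain m where n: "n = Suc m" "k < m" by (cases n) auto
  have 1: "linear_map K A X (\<lambda>a. \<phi> (a # as))" if "as \<in> words A m" for as
    using Suc.prems(1) that by (simp add: slot_linear_Suc n)
  have 2: "slot_linear K A m X (\<lambda>as. \<phi> (a # as))" if "a \<in> carrier A" for a
    using Suc.prems(1) that by (simp add: slot_linear_Suc n)
  show ?case unfolding n(1) slot_linear_Suc[of _ _ "Suc m"] merge_Suc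
    using 1[OF merge_in_words[OF _ n(2)]] Suc.IH[OF 2 n(2)] by blast
qed

text \<open>In the letter that is split, the map is the comultiplication followed by a bilinear map
  in the two new slots. For any other letter the split is a fixed sum, and the letter occupies one
  slot of \<open>\<psi>\<close>.\<close>

lemma slot_linear_comult_at:
  assumes "module K X"
  shows "slot_linear K A (Suc n) X \<psi> \<Longrightarrow> k < n \<Longrightarrow> slot_linear K A n X (\<lambda>bs.
    sweedler K X (comult A (bs ! k)) (\<lambda>(x, y). \<psi> (take k bs @ [x, y] @ drop (Suc k) bs)))"
proof (induction k arbitrary: n \<psi>)
  case 0
  then obtain m where n: "n = Suc m" by (auto simp: gr0_conv_Suc)
  have 1: "linear_map K A X (\<lambda>a. \<psi> (a # b # as))" "linear_map K A X (\<lambda>b. \<psi> (a # b # as))"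
    if "as \<in> words A m" "a \<in> carrier A" "b \<in> carrier A" for a b as
    using 0(1) that by (simp_all add: slot_linear_Suc n)
  have 2: "slot_linear K A m X (\<lambda>as. \<psi> (a # b # as))" if "a \<in> carrier A" "b \<in> carrier A" for a b
    using 0(1) that by (simp add: slot_linear_Suc n)
  show ?case unfolding n slot_linear_Suc
    by (auto intro!: comult_sweedler_linear[OF assms bilinearI] 1
        slot_linear_sweedler[OF supported_comult module_A assms] 2)
next
  case (Suc k)
  then obtain m where n: "n = Suc m" "k < m" by (cases n) auto
  have 1: "linear_map K A X (\<lambda>a. \<psi> (a # as))" if "as \<in> words A (Suc m)" for as
    using Suc.prems(1) that by (simp add: slot_linear_Suc[of _ _ "Suc m"] n)
  have 2: "slot_linear K A (Suc m) X (\<lambda>as. \<psi> (a # as))" if "a \<in> carrier A" for a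
    using Suc.prems(1) that by (simp add: slot_linear_Suc[of _ _ "Suc m"] n)
  have w: "take k bs @ x # y # drop (Suc k) bs \<in> words A (Suc m)" "bs ! k \<in> carrier A"
    if "bs \<in> words A m" "x \<in> carrier A" "y \<in> carrier A" for bs x y
    using that n(2) by (auto simp: words_def dest: in_set_takeD in_set_dropD)
  show ?case unfolding n(1) slot_linear_Suc[of _ _ m]
  proof (intro conjI ballI)
    fix as assume as: "as \<in> words A m"
    have k: "as ! k \<in> carrier A" using as n(2) by (auto simp: words_def)
    show "linear_map K A X (\<lambda>a. sweedler K X (comult A ((a # as) ! Suc k)) (\<lambda>(x, y).
        \<psi> (take (Suc k) (a # as) @ [x, y] @ drop (Suc (Suc k)) (a # as))))"
      by simp (rule sweedler_linear_param[OF supported_comult[OF k] module_A assms], rule 1, rule w[OF as])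
  next
    fix a assume a: "a \<in> carrier A"
    show "slot_linear K A m X (\<lambda>as. sweedler K X (comult A ((a # as) ! Suc k)) (\<lambda>(x, y).
        \<psi> (take (Suc k) (a # as) @ [x, y] @ drop (Suc (Suc k)) (a # as))))"
      using Suc.IH[OF 2[OF a] n(2)] by simp
  qed
qed

lemma iter_comult_linear: "linear_map K A (tensorr K A A p) (iter_comult K A p)"
proof (induction p)
  case 0
  show ?case unfolding iter_comult.simps by (rule multilinearD(1)[OF AA.tenr_multilinear]) simp
next
  case (Suc p)
  let ?X = "tensorr K A A (Suc p)"
  note X = AA.tensorr_module[of "Suc p"] and t = multilinearD[OF AA.tenr_multilinear[of "Suc p"]]
  have "multilinear K A A p ?X (\<lambda>c cs. sweedler K ?X (comult A c) (\<lambda>(c1, c2). tenr K A A (Suc p) c1 (c2 # cs)))"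
  proof (rule multilinearI)
    show "linear_map K A ?X (\<lambda>c. sweedler K ?X (comult A c) (\<lambda>(c1, c2). tenr K A A (Suc p) c1 (c2 # cs)))"
      if "cs \<in> words A p" for cs
      by (rule comult_sweedler_linear[OF X bilinearI]) (use t that in \<open>auto simp: slot_linear_Suc\<close>)
    show "slot_linear K A p ?X (\<lambda>cs. sweedler K ?X (comult A c) (\<lambda>(c1, c2). tenr K A A (Suc p) c1 (c2 # cs)))"
      if "c \<in> carrier A" for c
      by (rule slot_linear_sweedler[OF supported_comult[OF that] module_A X])
        (use t in \<open>auto simp: slot_linear_Suc\<close>)
  qed
  from linear_map_comp[OF Suc AA.sweedler_tensorr_linear[OF X this]] show ?case by simp
qed

lemma supported_iter_comult: "a \<in> carrier A \<Longrightarrow> supported K (carrier A \<times> words A p) (iter_comult K A p a)"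
  by (rule AA.supported_tensorr[OF linear_mapD(1)[OF iter_comult_linear]])

text \<open>For words whose final letter has a role of its own: in the last module face it acts on
  the module element, and for a free module it is the factor \<open>A\<close> of
  \<open>V \<otimes> A\<close>.\<close>

lemma slot_linear_butlast_last:
  assumes "\<And>b. b \<in> carrier A \<Longrightarrow> slot_linear K A n X (\<lambda>as. \<psi> as b)" "\<And>as. as \<in> words A n \<Longrightarrow> linear_map K A X (\<psi> as)"
  shows "slot_linear K A (Suc n) X (\<lambda>as. \<psi> (butlast as) (last as))"
proof (rule slot_linearI)
  fix as bs assume ab: "set as \<subseteq> carrier A" "set bs \<subseteq> carrier A" "Suc (length as + length bs) = Suc n"
  show "linear_map K A X (\<lambda>a. \<psi> (butlast (as @ a # bs)) (last (as @ a # bs)))"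
  proof (cases bs rule: rev_cases)
    case Nil
    then show ?thesis using ab assms(2)[of as] by (simp add: words_def)
  next
    case (snoc bs' b)
    then show ?thesis using ab slot_linearD[OF assms(1), of b as bs'] by (simp add: butlast_append)
  qed
qed

lemma multilinear_merge_last:
  assumes "multilinear K M A n X \<phi>" "\<And>m. m \<in> carrier M \<Longrightarrow> linear_map K A M (\<lambda>a. \<alpha> a m)"
    "\<And>a. a \<in> carrier A \<Longrightarrow> linear_map K M M (\<alpha> a)"
  shows "multilinear K M A (Suc n) X (\<lambda>m as. \<phi> (\<alpha> (last as) m) (butlast as))"
proof (rule multilinearI)
  note \<phi> = multilinearD[OF assms(1)]
  show "linear_map K M X (\<lambda>m. \<phi> (\<alpha> (last as) m) (butlast as))" if as: "as \<in> words A (Suc n)" for as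
    using as by (elim words_SucE') (auto intro!: linear_map_comp[OF assms(3) \<phi>(1)])
  show "slot_linear K A (Suc n) X (\<lambda>as. \<phi> (\<alpha> (last as) m) (butlast as))" if m: "m \<in> carrier M" for m
    by (rule slot_linear_butlast_last) (auto intro: \<phi>(2) linear_mapD(1)[OF assms(3)] m linear_map_comp[OF assms(2) \<phi>(1)])
qed

end

section \<open>Faces and differentials of the double complex for two Hopf modules\<close>

locale hopf_pair = bialgebra K A + M: hopf_module K A M + N: hopf_module K A N
  for K :: "('k, 'q) ring_scheme" and A :: "('k, 'a, 'r) bialg_scheme"
    and M :: "('k, 'm, 'a, 's) hmod_scheme" and N :: "('k, 'n, 'a, 't) hmod_scheme"
begin

abbreviation "TL n \<equiv> tensorl K A n M"
abbreviation "TR p \<equiv> tensorr K N A p"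
abbreviation "C n p \<equiv> cochains K A M N n p"
abbreviation "el n as m \<equiv> tenl K A n M as m"
abbreviation "er p y bs \<equiv> tenr K N A p y bs"

lemma module_M: "module K M" and module_N: "module K N" by unfold_locales

sublocale MA: two_modules K M A by unfold_locales
sublocale NA: two_modules K N A by unfold_locales

lemmas TL_module = MA.tensorl_module and TR_module = NA.tensorr_module
lemmas el = multilinearD[OF MA.tenl_multilinear] and er = multilinearD[OF NA.tenr_multilinear]

lemma er_Suc:
  "y \<in> carrier N \<Longrightarrow> bs \<in> words A p \<Longrightarrow> linear_map K A (TR (Suc p)) (\<lambda>b. er (Suc p) y (b # bs))"
  "y \<in> carrier N \<Longrightarrow> b \<in> carrier A \<Longrightarrow> slot_linear K A p (TR (Suc p)) (\<lambda>bs. er (Suc p) y (b # bs))"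
  using er(2)[of y "Suc p"] by (simp_all add: slot_linear_Suc)

lemma C_carrier: "f \<in> carrier (C n p) \<longleftrightarrow> f \<in> extensional (carrier (TL n)) \<and> linear_map K (TL n) (TR p) f"
  unfolding cochains_def by (rule hom_module_carrier[OF TL_module TR_module])

lemma C_linear: "f \<in> carrier (C n p) \<Longrightarrow> linear_map K (TL n) (TR p) f"
  by (simp add: C_carrier)

lemma C_module: "module K (C n p)"
  unfolding cochains_def by (rule hom_module_module[OF TL_module TR_module])

lemma C_apply:
  assumes "x \<in> carrier (TL n)"
  shows "(f \<oplus>\<^bsub>C n p\<^esub> g) x = f x \<oplus>\<^bsub>TR p\<^esub> g x" "(k \<odot>\<^bsub>C n p\<^esub> f) x = k \<odot>\<^bsub>TR p\<^esub> f x"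
    "\<zero>\<^bsub>C n p\<^esub> x = \<zero>\<^bsub>TR p\<^esub>"
  using hom_module_apply[OF TL_module TR_module assms] by (simp_all add: cochains_def)

lemma C_eqI:
  assumes "f \<in> carrier (C n p)" "g \<in> carrier (C n p)"
    "\<And>m as. m \<in> carrier M \<Longrightarrow> as \<in> words A n \<Longrightarrow> f (el n as m) = g (el n as m)"
  shows "f = g"
  using assms(1,2) unfolding cochains_def
  by (rule hom_module_eqI[OF TL_module TR_module])
    (rule MA.tensorl_eq[OF TR_module C_linear[OF assms(1)] C_linear[OF assms(2)] assms(3)])

lemma C_restrict: "linear_map K (TL n) (TR p) f \<Longrightarrow> (\<lambda>t\<in>carrier (TL n). f t) \<in> carrier (C n p)"
  unfolding cochains_def by (rule hom_module_restrict[OF TL_module TR_module])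

lemma C_el: "f \<in> carrier (C n p) \<Longrightarrow> multilinear K M A n (TR p) (\<lambda>m as. f (el n as m))"
  by (rule multilinear_comp[OF MA.tenl_multilinear C_linear])

lemma C_finsum_apply:
  "finite I \<Longrightarrow> (\<And>i. i \<in> I \<Longrightarrow> f i \<in> carrier (C n p)) \<Longrightarrow> x \<in> carrier (TL n) \<Longrightarrow>
    (\<Oplus>\<^bsub>C n p\<^esub>i\<in>I. f i) x = (\<Oplus>\<^bsub>TR p\<^esub>i\<in>I. f i x)"
  unfolding cochains_def by (rule hom_module_finsum_apply[OF TL_module TR_module])

text \<open>Cochains are determined by their values on pure tensors, so linearity of an operator has
  to be seen only there.\<close>

lemma C_linear_mapI:
  assumes "\<And>f. f \<in> carrier (C n p) \<Longrightarrow> L f \<in> carrier (C n' p')"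
    "\<And>m as. m \<in> carrier M \<Longrightarrow> as \<in> words A n' \<Longrightarrow> linear_map K (C n p) (TR p') (\<lambda>f. L f (el n' as m))"
  shows "linear_map K (C n p) (C n' p') L"
proof -
  interpret C: module K "C n p" by (rule C_module)
  interpret C': module K "C n' p'" by (rule C_module)
  show ?thesis
    by (rule linear_mapI)
      (auto intro!: C_eqI assms(1) simp: C_apply MA.tenl_closed linear_mapD[OF assms(2)])
qed

lemma C_eval_linear: "t \<in> carrier (TL n) \<Longrightarrow> linear_map K (C n p) (TR p) (\<lambda>f. f t)"
  unfolding cochains_def by (rule hom_module_eval_linear[OF TL_module TR_module])

subsection \<open>The module faces\<close>

text \<open>The action of \<open>a\<close> on \<open>N \<otimes> A^p\<close> through the iterated
  comultiplication. It isolates what the zeroth module face does to the value of a cochain.\<close>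

definition diag_act where
  "diag_act p a t = sweedler K (TR p) (iter_comult K A p a) (\<lambda>(c, cs).
    sweedler K (TR p) t (\<lambda>(y, bs). er p (act N c y) (map2 (\<lambda>c b. c \<otimes>\<^bsub>A\<^esub> b) cs bs)))"

lemma diag_act_multilinear:
  assumes "c \<in> carrier A" "cs \<in> words A p"
  shows "multilinear K N A p (TR p) (\<lambda>y bs. er p (act N c y) (map2 (\<lambda>c b. c \<otimes>\<^bsub>A\<^esub> b) cs bs))"
proof (rule multilinearI)
  show "linear_map K N (TR p) (\<lambda>y. er p (act N c y) (map2 (\<lambda>c b. c \<otimes>\<^bsub>A\<^esub> b) cs bs))" if "bs \<in> words A p" for bs
    by (rule linear_map_comp[OF N.act_linear er(1)]) (use assms map2_mult_in_words that in auto)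
  show "slot_linear K A p (TR p) (\<lambda>bs. er p (act N c y) (map2 (\<lambda>c b. c \<otimes>\<^bsub>A\<^esub> b) cs bs))" if "y \<in> carrier N" for y
    by (rule slot_linear_map2_right[OF er(2)]) (use assms that in \<open>auto intro: linear_mapD(1)[OF N.act_linear]\<close>)
qed

lemma diag_act_linear: "a \<in> carrier A \<Longrightarrow> linear_map K (TR p) (TR p) (diag_act p a)"
  unfolding diag_act_def
  by (rule sweedler_linear_param[OF supported_iter_comult TR_module TR_module])
    (auto intro: NA.sweedler_tensorr_linear[OF TR_module] diag_act_multilinear)

lemma diag_act_linear_left:
  assumes "t \<in> carrier (TR p)"
  shows "linear_map K A (TR p) (\<lambda>a. diag_act p a t)"
proof -
  note s = NA.supported_tensorr[OF assms]
  have "multilinear K A A p (TR p) (\<lambda>c cs.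
    sweedler K (TR p) t (\<lambda>(y, bs). er p (act N c y) (map2 (\<lambda>c b. c \<otimes>\<^bsub>A\<^esub> b) cs bs)))"
  proof (rule multilinearI)
    show "linear_map K A (TR p) (\<lambda>c. sweedler K (TR p) t (\<lambda>(y, bs). er p (act N c y) (map2 (\<lambda>c b. c \<otimes>\<^bsub>A\<^esub> b) cs bs)))"
      if "cs \<in> words A p" for cs
      by (rule sweedler_linear_param[OF s module_A TR_module], rule linear_map_comp[OF N.act_linear_left er(1)])
        (use map2_mult_in_words that in auto)
    show "slot_linear K A p (TR p) (\<lambda>cs. sweedler K (TR p) t (\<lambda>(y, bs). er p (act N c y) (map2 (\<lambda>c b. c \<otimes>\<^bsub>A\<^esub> b) cs bs)))"
      if "c \<in> carrier A" for c
      by (rule slot_linear_sweedler[OF s module_A TR_module], rule slot_linear_map2_left[OF er(2)])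
        (use that in \<open>auto intro: linear_mapD(1)[OF N.act_linear]\<close>)
  qed
  then show ?thesis unfolding diag_act_def
    by (intro linear_map_comp[OF iter_comult_linear AA.sweedler_tensorr_linear[OF TR_module]])
qed

text \<open>The faces on pure tensors. Once these formulas are known to be multilinear,
  \<open>bmap\<close>, a sum over a chosen representative, takes exactly these values there.\<close>

definition bface where
  "bface n p i f m as = (if i = 0 then diag_act p (hd as) (f (el n (tl as) m))
    else if i \<le> n then f (el n (merge A (i - 1) as) m)
    else f (el n (butlast as) (act M (last as) m)))"

lemma bface_multilinear:
  assumes f: "f \<in> carrier (C n p)" and i: "i \<le> Suc n"
  shows "multilinear K M A (Suc n) (TR p) (bface n p i f)"
proof -
  note \<phi> = multilinearD[OF C_el[OF f]]
  consider "i = 0" | "0 < i" "i \<le> n" | "i = Suc n" using i by linarith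
  then show ?thesis
  proof cases
    case 1
    have "multilinear K M A (Suc n) (TR p) (\<lambda>m as. diag_act p (hd as) (f (el n (tl as) m)))"
    proof (rule multilinearI)
      show "linear_map K M (TR p) (\<lambda>m. diag_act p (hd as) (f (el n (tl as) m)))" if "as \<in> words A (Suc n)" for as
        by (rule words_SucE[OF that]) (auto intro: linear_map_comp[OF \<phi>(1) diag_act_linear])
      show "slot_linear K A (Suc n) (TR p) (\<lambda>as. diag_act p (hd as) (f (el n (tl as) m)))" if "m \<in> carrier M" for m
        unfolding slot_linear_Suc
        by (auto intro: diag_act_linear_left \<phi>(3) slot_linear_comp[OF \<phi>(2) diag_act_linear] that)
    qed
    then show ?thesis by (simp add: bface_def[abs_def] 1)
  next
    case 2
    then have k: "i - 1 < n" by linarith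
    have "multilinear K M A (Suc n) (TR p) (\<lambda>m as. f (el n (merge A (i - 1) as) m))"
      by (rule multilinearI, rule \<phi>(1), erule merge_in_words, rule k, rule slot_linear_merge, erule \<phi>(2), rule k)
    then show ?thesis using 2 by (simp add: bface_def[abs_def])
  next
    case 3
    have "multilinear K M A (Suc n) (TR p) (\<lambda>m as. f (el n (butlast as) (act M (last as) m)))"
      by (rule multilinear_merge_last[OF C_el[OF f] M.act_linear_left M.act_linear])
    then show ?thesis by (simp add: bface_def[abs_def] 3)
  qed
qed

lemma bmap_eq: "bmap K A M N n p i f = (\<lambda>t\<in>carrier (TL (Suc n)). sweedler K (TR p) t (\<lambda>(as, m). bface n p i f m as))"
  unfolding bmap_def bface_def diag_act_def merge_def
  by (intro restrict_ext arg_cong[where f = "sweedler K (TR p) _"]) (auto simp: fun_eq_iff)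

lemma bmap_el:
  assumes "f \<in> carrier (C n p)" "i \<le> Suc n" "m \<in> carrier M" "as \<in> words A (Suc n)"
  shows "bmap K A M N n p i f (el (Suc n) as m) = bface n p i f m as"
  using MA.sweedler_tenl[OF TR_module bface_multilinear[OF assms(1,2)] assms(3,4)] assms
  by (simp add: bmap_eq MA.tenl_closed)

lemma bmap_closed: "f \<in> carrier (C n p) \<Longrightarrow> i \<le> Suc n \<Longrightarrow> bmap K A M N n p i f \<in> carrier (C (Suc n) p)"
  unfolding bmap_eq by (rule C_restrict, rule MA.sweedler_tensorl_linear[OF TR_module bface_multilinear])

lemma bmap_linear:
  assumes i: "i \<le> Suc n" shows "linear_map K (C n p) (C (Suc n) p) (bmap K A M N n p i)"
proof (rule C_linear_mapI[OF bmap_closed[OF _ i]])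
  fix m as assume m: "m \<in> carrier M" and as: "as \<in> words A (Suc n)"
  from as obtain a as' where a: "as = a # as'" "a \<in> carrier A" "as' \<in> words A n" by (rule words_SucE)
  from as obtain as'' b where b: "as = as'' @ [b]" "as'' \<in> words A n" "b \<in> carrier A" by (rule words_SucE')
  have "linear_map K (C n p) (TR p) (\<lambda>f. bface n p i f m as)"
  proof (cases "i = 0")
    case True
    then show ?thesis unfolding bface_def a(1)
      by (simp add: linear_map_comp[OF C_eval_linear diag_act_linear] MA.tenl_closed a m)
  next
    case False
    then have k: "i - 1 < n" if "i \<le> n" using that by linarith
    have "merge A (i - 1) as \<in> words A n" if "i \<le> n" using merge_in_words[OF as k[OF that]] .
    moreover have "act M b m \<in> carrier M" by (rule linear_mapD(1)[OF M.act_linear[OF b(3)] m])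
    moreover have "butlast as = as''" "last as = b" by (simp_all add: b)
    ultimately show ?thesis using False b(2) unfolding bface_def
      by (cases "i \<le> n") (simp_all add: C_eval_linear MA.tenl_closed m)
  qed
  then show "linear_map K (C n p) (TR p) (\<lambda>f. bmap K A M N n p i f (el (Suc n) as m))"
    by (rule linear_map_cong[OF C_module]) (simp add: bmap_el i m as)
qed

subsection \<open>The comodule faces\<close>

lemma coact_closed: "y \<in> carrier N \<Longrightarrow> coact N y \<in> carrier (tensor K N A)"
  by (rule linear_mapD(1)[OF N.coact_linear])

lemma supported_coact_N: "y \<in> carrier N \<Longrightarrow> supported K (carrier N \<times> carrier A) (coact N y)"
  by (rule NA.supported_tensor[OF coact_closed])

lemma supported_coact_M: "m \<in> carrier M \<Longrightarrow> supported K (carrier M \<times> carrier A) (coact M m)"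
  by (rule MA.supported_tensor[OF linear_mapD(1)[OF M.coact_linear]])

text \<open>Every comodule face but the last changes only the value of a cochain and is thus
  composition with a linear map from \<open>TR p\<close> to \<open>TR (Suc p)\<close>. The last one
  also comultiplies the arguments and is treated apart as \<open>cface_last\<close>.\<close>

definition cface_val where
  "cface_val p i y bs = (if i = 0 then
      sweedler K (TR (Suc p)) (coact N y) (\<lambda>(y0, y1). er (Suc p) y0 (y1 # bs))
    else sweedler K (TR (Suc p)) (comult A (bs ! (i - 1))) (\<lambda>(b1, b2).
      er (Suc p) y (take (i - 1) bs @ [b1, b2] @ drop i bs)))"

definition cface where
  "cface p i t = sweedler K (TR (Suc p)) t (\<lambda>(y, bs). cface_val p i y bs)"

definition append_factor where
  "append_factor p t a = sweedler K (TR (Suc p)) t (\<lambda>(y, bs). er (Suc p) y (bs @ [a]))"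

text \<open>The codiagonal coaction of \<open>A^n \<otimes> M\<close> followed by \<open>f\<close>;
  the factor of \<open>A\<close> that the coaction produces is put at the end of the value.\<close>

definition cface_last where
  "cface_last n p f m as = sweedler_list K A (TR (Suc p)) as (\<lambda>as1 as2.
    sweedler K (TR (Suc p)) (coact M m) (\<lambda>(m0, m1).
      append_factor p (f (el n as1 m0)) (word_prod as2 \<otimes>\<^bsub>A\<^esub> m1)))"

lemma cface_val_multilinear:
  assumes "i \<le> p" shows "multilinear K N A p (TR (Suc p)) (cface_val p i)"
proof (cases "i = 0")
  case True
  have "multilinear K N A p (TR (Suc p)) (\<lambda>y bs.
      sweedler K (TR (Suc p)) (coact N y) (\<lambda>(y0, y1). er (Suc p) y0 (y1 # bs)))"
  proof (rule multilinearI)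
    show "linear_map K N (TR (Suc p)) (\<lambda>y. sweedler K (TR (Suc p)) (coact N y) (\<lambda>(y0, y1). er (Suc p) y0 (y1 # bs)))"
      if "bs \<in> words A p" for bs
      by (rule linear_map_comp[OF N.coact_linear NA.sw_linear[OF TR_module bilinearI]])
        (use that in \<open>auto intro: er(1) er_Suc\<close>)
    show "slot_linear K A p (TR (Suc p)) (\<lambda>bs. sweedler K (TR (Suc p)) (coact N y) (\<lambda>(y0, y1). er (Suc p) y0 (y1 # bs)))"
      if "y \<in> carrier N" for y
      by (rule slot_linear_sweedler[OF supported_coact_N[OF that] module_A TR_module er_Suc(2)])
  qed
  then show ?thesis by (simp add: cface_val_def[abs_def] True)
next
  case False
  then have i: "i - 1 < p" "Suc (i - 1) = i" using assms by auto
  have "multilinear K N A p (TR (Suc p)) (\<lambda>y bs. sweedler K (TR (Suc p)) (comult A (bs ! (i - 1))) (\<lambda>(b1, b2).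
      er (Suc p) y (take (i - 1) bs @ [b1, b2] @ drop (Suc (i - 1)) bs)))"
  proof (rule multilinearI)
    show "linear_map K N (TR (Suc p)) (\<lambda>y. sweedler K (TR (Suc p)) (comult A (bs ! (i - 1))) (\<lambda>(b1, b2).
      er (Suc p) y (take (i - 1) bs @ [b1, b2] @ drop (Suc (i - 1)) bs)))" if bs: "bs \<in> words A p" for bs
    proof (rule sweedler_linear_param[OF supported_comult module_N TR_module er(1)])
      show "bs ! (i - 1) \<in> carrier A" using bs i(1) by (auto simp: words_def)
      show "take (i - 1) bs @ [b1, b2] @ drop (Suc (i - 1)) bs \<in> words A (Suc p)"
        if "b1 \<in> carrier A" "b2 \<in> carrier A" for b1 b2
        using bs i(1) that by (auto simp: words_def dest: in_set_takeD in_set_dropD)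
    qed
    show "slot_linear K A p (TR (Suc p)) (\<lambda>bs. sweedler K (TR (Suc p)) (comult A (bs ! (i - 1))) (\<lambda>(b1, b2).
      er (Suc p) y (take (i - 1) bs @ [b1, b2] @ drop (Suc (i - 1)) bs)))" if "y \<in> carrier N" for y
      by (rule slot_linear_comult_at[OF TR_module er(2)[OF that] i(1)])
  qed
  then show ?thesis unfolding i(2) by (simp add: cface_val_def[abs_def] False)
qed

lemma cface_linear: "i \<le> p \<Longrightarrow> linear_map K (TR p) (TR (Suc p)) (cface p i)"
  unfolding cface_def[abs_def] by (rule NA.sweedler_tensorr_linear[OF TR_module cface_val_multilinear])

lemma cface_er: "i \<le> p \<Longrightarrow> y \<in> carrier N \<Longrightarrow> bs \<in> words A p \<Longrightarrow> cface p i (er p y bs) = cface_val p i y bs"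
  unfolding cface_def by (rule NA.sweedler_tenr[OF TR_module cface_val_multilinear])

lemma append_factor_multilinear: "a \<in> carrier A \<Longrightarrow> multilinear K N A p (TR (Suc p)) (\<lambda>y bs. er (Suc p) y (bs @ [a]))"
  by (rule multilinearI) (auto intro: er(1) slot_linear_snoc[OF er(2)])

lemma append_factor_linear: "a \<in> carrier A \<Longrightarrow> linear_map K (TR p) (TR (Suc p)) (\<lambda>t. append_factor p t a)"
  unfolding append_factor_def by (rule NA.sweedler_tensorr_linear[OF TR_module append_factor_multilinear])

lemma append_factor_linear_right: "t \<in> carrier (TR p) \<Longrightarrow> linear_map K A (TR (Suc p)) (append_factor p t)"
  unfolding append_factor_def[abs_def]
  by (rule sweedler_linear_param[OF NA.supported_tensorr module_A TR_module])
    (auto intro: slot_linear_last[OF er(2)])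

lemma append_factor_er:
  "a \<in> carrier A \<Longrightarrow> y \<in> carrier N \<Longrightarrow> bs \<in> words A p \<Longrightarrow> append_factor p (er p y bs) a = er (Suc p) y (bs @ [a])"
  unfolding append_factor_def by (rule NA.sweedler_tenr[OF TR_module append_factor_multilinear])

lemma append_factor_bilinear:
  assumes "f \<in> carrier (C n p)" "as \<in> words A n" "c \<in> carrier A"
  shows "bilinear_map K M A (TR (Suc p)) (\<lambda>m a. append_factor p (f (el n as m)) (c \<otimes>\<^bsub>A\<^esub> a))"
proof (rule bilinearI)
  note \<phi> = multilinearD[OF C_el[OF assms(1)]]
  show "linear_map K M (TR (Suc p)) (\<lambda>m. append_factor p (f (el n as m)) (c \<otimes>\<^bsub>A\<^esub> a))" if "a \<in> carrier A" for a
    by (rule linear_map_comp[OF \<phi>(1) append_factor_linear]) (use assms that in auto)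
  show "linear_map K A (TR (Suc p)) (\<lambda>a. append_factor p (f (el n as m)) (c \<otimes>\<^bsub>A\<^esub> a))" if "m \<in> carrier M" for m
    by (rule linear_map_comp[OF mult_linear(1) append_factor_linear_right]) (use assms that \<phi>(3) in auto)
qed

lemma cface_last_multilinear:
  assumes f: "f \<in> carrier (C n p)"
  shows "multilinear K M A n (TR (Suc p)) (cface_last n p f)"
  unfolding cface_last_def[abs_def]
proof (rule multilinearI)
  note \<phi> = multilinearD[OF C_el[OF f]]
  show "linear_map K M (TR (Suc p)) (\<lambda>m. sweedler_list K A (TR (Suc p)) as (\<lambda>as1 as2.
    sweedler K (TR (Suc p)) (coact M m) (\<lambda>(m0, m1). append_factor p (f (el n as1 m0)) (word_prod as2 \<otimes>\<^bsub>A\<^esub> m1))))"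
    if as: "as \<in> words A n" for as
    by (rule sweedler_list_linear_param[OF TR_module module_M as],
        rule linear_map_comp[OF M.coact_linear MA.sw_linear[OF TR_module append_factor_bilinear]])
      (auto intro: f word_prod_closed)
  show "slot_linear K A n (TR (Suc p)) (\<lambda>as. sweedler_list K A (TR (Suc p)) as (\<lambda>as1 as2.
    sweedler K (TR (Suc p)) (coact M m) (\<lambda>(m0, m1). append_factor p (f (el n as1 m0)) (word_prod as2 \<otimes>\<^bsub>A\<^esub> m1))))"
    if m: "m \<in> carrier M" for m
  proof (rule sweedler_list_slot_linear[OF TR_module]; rule slot_linear_sweedler[OF supported_coact_M[OF m] module_A TR_module])
    fix ds m0 m1 assume *: "ds \<in> words A n" "m0 \<in> carrier M" "m1 \<in> carrier A"
    then have "word_prod ds \<in> carrier A" by (intro word_prod_closed)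
    with * show "slot_linear K A n (TR (Suc p)) (\<lambda>cs. append_factor p (f (el n cs m0)) (word_prod ds \<otimes>\<^bsub>A\<^esub> m1))"
      by (intro slot_linear_comp[OF \<phi>(2) append_factor_linear]) auto
  next
    fix cs m0 m1 assume *: "cs \<in> words A n" "m0 \<in> carrier M" "m1 \<in> carrier A"
    then show "slot_linear K A n (TR (Suc p)) (\<lambda>ds. append_factor p (f (el n cs m0)) (word_prod ds \<otimes>\<^bsub>A\<^esub> m1))"
      by (intro slot_linear_comp[OF word_prod_slot_linear linear_map_comp[OF mult_linear(2) append_factor_linear_right]] \<phi>(3))
  qed
qed

lemma cmap_le:
  assumes "i \<le> p" shows "cmap K A M N n p i f = (\<lambda>t\<in>carrier (TL n). cface p i (f t))"
  using assms by (cases "i = 0") (simp_all add: cmap_def cface_def cface_val_def)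

lemma cmap_last:
  "cmap K A M N n p (Suc p) f = (\<lambda>t\<in>carrier (TL n). sweedler K (TR (Suc p)) t (\<lambda>(as, m). cface_last n p f m as))"
  unfolding cmap_def cface_last_def append_factor_def by simp

lemma cmap_el_last:
  "f \<in> carrier (C n p) \<Longrightarrow> m \<in> carrier M \<Longrightarrow> as \<in> words A n \<Longrightarrow>
    cmap K A M N n p (Suc p) f (el n as m) = cface_last n p f m as"
  using MA.sweedler_tenl[OF TR_module cface_last_multilinear] by (simp add: cmap_last MA.tenl_closed)

lemma cmap_closed:
  assumes "f \<in> carrier (C n p)" "i \<le> Suc p" shows "cmap K A M N n p i f \<in> carrier (C n (Suc p))"
proof (cases "i \<le> p")
  case True
  then show ?thesis unfolding cmap_le[OF True]
    by (intro C_restrict linear_map_comp[OF C_linear[OF assms(1)] cface_linear])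
next
  case False
  then have "i = Suc p" using assms(2) by simp
  then show ?thesis using assms(1)
    by (simp only: cmap_last) (intro C_restrict MA.sweedler_tensorl_linear[OF TR_module cface_last_multilinear])
qed

lemma cmap_linear:
  assumes i: "i \<le> Suc p" shows "linear_map K (C n p) (C n (Suc p)) (cmap K A M N n p i)"
proof (rule C_linear_mapI[OF cmap_closed[OF _ i]])
  fix m as assume m: "m \<in> carrier M" and as: "as \<in> words A n"
  show "linear_map K (C n p) (TR (Suc p)) (\<lambda>f. cmap K A M N n p i f (el n as m))"
  proof (cases "i \<le> p")
    case True
    show ?thesis unfolding cmap_le[OF True]
      by (simp add: MA.tenl_closed m as linear_map_comp[OF C_eval_linear cface_linear[OF True]])
  next
    case False
    then have i: "i = Suc p" using i by simp
    have "linear_map K (C n p) (TR (Suc p)) (\<lambda>f. cface_last n p f m as)"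
      unfolding cface_last_def
      by (rule sweedler_list_linear_param[OF TR_module C_module as],
          rule sweedler_linear_param[OF supported_coact_M[OF m] C_module TR_module],
          rule linear_map_comp[OF C_eval_linear append_factor_linear])
        (auto intro: MA.tenl_closed word_prod_closed)
    then show ?thesis unfolding i
      by (rule linear_map_cong[OF C_module]) (simp add: cmap_el_last m as)
  qed
qed

subsection \<open>The total differential\<close>

lemma sgn_pow_closed: "sgn_pow K i \<in> carrier K"
  by (simp add: sgn_pow_def)

lemma d_m_linear: "linear_map K (C n p) (C (Suc n) p) (d_m K A M N n p)"
  unfolding d_m_def[abs_def]
  by (rule linear_map_finsum_fun[OF C_module C_module])
    (auto intro: linear_map_smult_fun[OF C_module C_module bmap_linear sgn_pow_closed])

lemma d_c_linear: "linear_map K (C n p) (C n (Suc p)) (d_c K A M N n p)"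
  unfolding d_c_def[abs_def]
  by (rule linear_map_finsum_fun[OF C_module C_module])
    (auto intro: linear_map_smult_fun[OF C_module C_module cmap_linear sgn_pow_closed])

lemma d_m_apply:
  assumes f: "f \<in> carrier (C n p)" and t: "t \<in> carrier (TL (Suc n))"
  shows "d_m K A M N n p f t = (\<Oplus>\<^bsub>TR p\<^esub>i\<in>{..Suc n}. sgn_pow K i \<odot>\<^bsub>TR p\<^esub> bmap K A M N n p i f t)"
proof -
  interpret C: module K "C (Suc n) p" by (rule C_module)
  interpret T: module K "TR p" by (rule TR_module)
  show ?thesis unfolding d_m_def
    by (subst C_finsum_apply) (auto simp: C_apply t bmap_closed f sgn_pow_closed
        intro!: T.M.finsum_cong' linear_mapD(1)[OF C_linear[OF bmap_closed[OF f]]])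
qed

end

section \<open>Free Hopf modules\<close>

context hopf_setup
begin

abbreviation "FV \<equiv> free_hmod K V A"

lemma free_module: "module K FV"
  by (rule hmod_module[OF T_module])

lemma free_ten_bilinear: "bilinear_map K V A FV (ten K V A)"
  using VA.ten_bilinear by (simp add: bilinear_map_def hmod_cong)

lemma free_ten_closed: "v \<in> carrier V \<Longrightarrow> b \<in> carrier A \<Longrightarrow> ten K V A v b \<in> carrier FV"
  by (simp add: hmod_ops VA.ten_closed)

lemma supported_free: "t \<in> carrier FV \<Longrightarrow> supported K (carrier V \<times> carrier A) t"
  by (rule VA.supported_tensor) (simp add: hmod_ops)

lemma free_eq:
  assumes "module K X" "linear_map K FV X f" "linear_map K FV X h"
    "\<And>v b. v \<in> carrier V \<Longrightarrow> b \<in> carrier A \<Longrightarrow> f (ten K V A v b) = h (ten K V A v b)" "t \<in> carrier FV"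
  shows "f t = h t"
  by (rule VA.tensor_eq[OF assms(1)]) (use assms in \<open>simp_all add: hmod_cong hmod_ops\<close>)

lemma free_sweedler_linear:
  "module K X \<Longrightarrow> bilinear_map K V A X \<phi> \<Longrightarrow> linear_map K FV X (\<lambda>t. sweedler K X t (\<lambda>(v, b). \<phi> v b))"
  using VA.sw_linear by (simp add: hmod_cong)

lemma free_act_ten: "a \<in> carrier A \<Longrightarrow> v \<in> carrier V \<Longrightarrow> b \<in> carrier A \<Longrightarrow>
    act FV a (ten K V A v b) = ten K V A v (a \<otimes>\<^bsub>A\<^esub> b)"
  by (simp add: hmod_ops ac_ten)

text \<open>The coaction of \<open>V \<otimes> A\<close> is the comultiplication of its factor
  \<open>A\<close>. Inside sums it therefore looks like the splitting of one more letter.\<close>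

lemma free_coact_sweedler:
  assumes "module K X" "bilinear_map K FV A X \<psi>" "v \<in> carrier V" "b \<in> carrier A"
  shows "sweedler K X (coact FV (ten K V A v b)) (\<lambda>(m, a). \<psi> m a) =
    sweedler K X (comult A b) (\<lambda>(b1, b2). \<psi> (ten K V A v b1) b2)"
proof -
  have "bilinear_map K T A X \<psi>" using assms(2) by (simp add: bilinear_map_def hmod_cong hmod_ops)
  from sw_co0[OF assms(1) this assms(3) comult_closed[OF assms(4)]] show ?thesis
    by (simp add: hmod_ops co_ten assms)
qed

end

text \<open>\<open>iter_comult\<close> always splits the leading factor. Peeling off one step
  exposes \<open>c1\<close> and \<open>c2\<close> as the parts of a single comultiplication, to
  which a counit law applies.\<close>

lemma (in bialgebra) sweedler_iter_comult_Suc: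
  assumes "module K X" "multilinear K A A (Suc p) X \<phi>" "a \<in> carrier A"
  shows "sweedler K X (iter_comult K A (Suc p) a) (\<lambda>(c, cs). \<phi> c cs) =
    sweedler K X (iter_comult K A p a) (\<lambda>(c, cs). sweedler K X (comult A c) (\<lambda>(c1, c2). \<phi> c1 (c2 # cs)))"
proof -
  let ?T = "tensorr K A A (Suc p)"
  note L = AA.sweedler_tensorr_linear[OF assms(1,2)] and e = AA.sweedler_tenr[OF assms(1,2)]
  note T = AA.tensorr_module[of "Suc p"] and \<phi> = multilinearD[OF assms(2)]
  let ?L = "\<lambda>t. sweedler K X t (\<lambda>(c, cs). \<phi> c cs)"
  note s = supported_comult
  have c: "tenr K A A (Suc p) c1 (c2 # cs) \<in> carrier ?T" if "c1 \<in> carrier A" "c2 \<in> carrier A" "cs \<in> words A p" for c1 c2 cs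
    by (rule AA.tenr_closed) (use that in auto)
  have "?L (iter_comult K A (Suc p) a) = sweedler K X (iter_comult K A p a) (\<lambda>(c, cs).
      ?L (sweedler K ?T (comult A c) (\<lambda>(c1, c2). tenr K A A (Suc p) c1 (c2 # cs))))"
    unfolding iter_comult.simps
    by (rule sweedler_linear_comp[OF supported_iter_comult[OF assms(3)] T assms(1) L])
      (rule sweedler_closed[OF s T c])
  also have "\<dots> = sweedler K X (iter_comult K A p a) (\<lambda>(c, cs). sweedler K X (comult A c) (\<lambda>(c1, c2). \<phi> c1 (c2 # cs)))"
  proof (rule sweedler_cong'[OF supported_iter_comult[OF assms(3)] assms(1), symmetric])
    fix d ds assume d: "d \<in> carrier A" "ds \<in> words A p"
    show "sweedler K X (comult A d) (\<lambda>(c1, c2). \<phi> c1 (c2 # ds)) \<in> carrier X"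
      by (rule sweedler_closed[OF s[OF d(1)] assms(1)]) (simp add: \<phi> d)
    show "sweedler K X (comult A d) (\<lambda>(c1, c2). \<phi> c1 (c2 # ds)) =
      ?L (sweedler K ?T (comult A d) (\<lambda>(c1, c2). tenr K A A (Suc p) c1 (c2 # ds)))"
      by (subst sweedler_linear_comp[OF s[OF d(1)] T assms(1) L])
        (auto simp: c e d \<phi> intro!: sweedler_cong'[OF s[OF d(1)] assms(1)])
  qed
  finally show ?thesis .
qed

section \<open>The counit contraction on values in a cofree comodule\<close>

locale free_pair = bialgebra K A + V: hopf_setup K A V + W: hopf_setup K A W
  for K :: "('k, 'q) ring_scheme" and A :: "('k, 'a, 'r) bialg_scheme"
    and V :: "('k, 'v, 's) module_scheme" and W :: "('k, 'w, 't) module_scheme"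
begin

sublocale hopf_pair K A "free_hmod K V A" "free_hmod K W A"
  by (intro hopf_pair.intro hopf_module_free_hmod bialgebra_axioms V.V_module W.V_module)

abbreviation "vten \<equiv> ten K V A"
abbreviation "wten \<equiv> ten K W A"

lemmas wten = bilinearD[OF W.free_ten_bilinear] W.free_ten_closed
lemmas vten = bilinearD[OF V.free_ten_bilinear] V.free_ten_closed

definition counit_map where
  "counit_map t = sweedler K W t (\<lambda>(w, b). counit A b \<odot>\<^bsub>W\<^esub> w)"

lemma counit_bilinear: "bilinear_map K W A W (\<lambda>w b. counit A b \<odot>\<^bsub>W\<^esub> w)"
  by (rule bilinearI)
    (auto intro: linear_map_smult_fun[OF W.V_module W.V_module linear_map_id counit_closed]
      counit_smult_linear[OF W.V_module])

lemma counit_map_linear: "linear_map K W.FV W counit_map"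
  unfolding counit_map_def[abs_def] by (rule W.free_sweedler_linear[OF W.V_module counit_bilinear])

lemmas counit_map_closed = linear_mapD(1)[OF counit_map_linear]

lemma counit_map_ten: "w \<in> carrier W \<Longrightarrow> b \<in> carrier A \<Longrightarrow> counit_map (wten w b) = counit A b \<odot>\<^bsub>W\<^esub> w"
  unfolding counit_map_def by (rule W.VA.sw_ten[OF W.V_module counit_bilinear])

text \<open>The counit is multiplicative, so applying it to the factor \<open>A\<close> of
  \<open>W \<otimes> A\<close> is linear over \<open>A\<close> when \<open>A\<close> acts on
  \<open>W\<close> through the counit.\<close>

lemma counit_map_act:
  assumes "a \<in> carrier A" "y \<in> carrier W.FV"
  shows "counit_map (act W.FV a y) = counit A a \<odot>\<^bsub>W\<^esub> counit_map y"
proof (rule W.free_eq[OF W.V_module _ _ _ assms(2)])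
  show "linear_map K W.FV W (\<lambda>y. counit_map (act W.FV a y))"
    by (rule linear_map_comp[OF N.act_linear[OF assms(1)] counit_map_linear])
  show "linear_map K W.FV W (\<lambda>y. counit A a \<odot>\<^bsub>W\<^esub> counit_map y)"
    by (rule linear_map_smult_fun[OF module_N W.V_module counit_map_linear counit_closed[OF assms(1)]])
qed (simp add: assms W.free_act_ten counit_map_ten counit_mult counit_closed W.V.smult_assoc1)

text \<open>\<^term>\<open>contract\<close> is \<open>(w \<otimes> a\<^sup>0) \<otimes> a\<^sup>1 \<otimes> a\<^sup>2 \<otimes> \<dots> \<mapsto> \<epsilon>(a\<^sup>0) (w \<otimes> a\<^sup>1) \<otimes> a\<^sup>2 \<otimes> \<dots>\<close>.\<close>

definition contract where
  "contract p t = sweedler K (TR p) t (\<lambda>(y, bs). er p (wten (counit_map y) (hd bs)) (tl bs))"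

lemma contract_multilinear:
  "multilinear K W.FV A (Suc p) (TR p) (\<lambda>y bs. er p (wten (counit_map y) (hd bs)) (tl bs))"
proof (rule multilinearI)
  show "linear_map K W.FV (TR p) (\<lambda>y. er p (wten (counit_map y) (hd bs)) (tl bs))" if "bs \<in> words A (Suc p)" for bs
    by (rule words_SucE[OF that])
      (auto intro!: linear_map_comp[OF linear_map_comp[OF counit_map_linear wten(1)] er(1)])
  show "slot_linear K A (Suc p) (TR p) (\<lambda>bs. er p (wten (counit_map y) (hd bs)) (tl bs))" if "y \<in> carrier W.FV" for y
    unfolding slot_linear_Suc using that
    by (auto intro!: linear_map_comp[OF wten(2) er(1)] er(2) wten(3) counit_map_closed)
qed

lemma contract_linear: "linear_map K (TR (Suc p)) (TR p) (contract p)"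
  unfolding contract_def[abs_def] by (rule NA.sweedler_tensorr_linear[OF TR_module contract_multilinear])

lemma contract_er:
  "y \<in> carrier W.FV \<Longrightarrow> b \<in> carrier A \<Longrightarrow> bs \<in> words A p \<Longrightarrow>
    contract p (er (Suc p) y (b # bs)) = er p (wten (counit_map y) b) bs"
  unfolding contract_def using NA.sweedler_tenr[OF TR_module contract_multilinear, of y "b # bs"] by simp

lemma er_Suc_closed: "y \<in> carrier W.FV \<Longrightarrow> b \<in> carrier A \<Longrightarrow> bs \<in> words A p \<Longrightarrow> er (Suc p) y (b # bs) \<in> carrier (TR (Suc p))"
  by (rule NA.tenr_closed) auto

text \<open>The coaction turns \<open>w \<otimes> b\<close> into \<open>w \<otimes> b_1\<close> and
  a new factor \<open>b_2\<close>; the contraction leaves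
  \<open>w \<otimes> \<epsilon>(b_1) b_2\<close>, which is \<open>w \<otimes> b\<close> by the
  counit law.\<close>

lemma contract_cface_0:
  assumes "t \<in> carrier (TR p)" shows "contract p (cface p 0 t) = t"
proof (rule NA.tensorr_eq[OF TR_module _ linear_map_id _ assms])
  show "linear_map K (TR p) (TR p) (\<lambda>t. contract p (cface p 0 t))"
    by (rule linear_map_comp[OF cface_linear contract_linear]) simp
  interpret T: module K "TR p" by (rule TR_module)
  fix y bs assume y: "y \<in> carrier W.FV" and bs: "bs \<in> words A p"
  have er1: "linear_map K W.FV (TR p) (\<lambda>y. er p y bs)" by (rule er(1)[OF bs])
  have bil: "bilinear_map K W.FV A (TR p) (\<lambda>y0 y1. er p (wten (counit_map y0) y1) bs)"
    by (rule bilinearI)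
      (auto intro!: linear_map_comp[OF linear_map_comp[OF counit_map_linear wten(1)] er1]
        linear_map_comp[OF wten(2) er1] counit_map_closed)
  have "contract p (cface p 0 (er p y bs)) =
    contract p (sweedler K (TR (Suc p)) (coact W.FV y) (\<lambda>(y0, y1). er (Suc p) y0 (y1 # bs)))"
    by (simp add: cface_er y bs cface_val_def)
  also have "\<dots> = sweedler K (TR p) (coact W.FV y) (\<lambda>(y0, y1). contract p (er (Suc p) y0 (y1 # bs)))"
    by (rule sweedler_linear_comp[OF supported_coact_N[OF y] TR_module TR_module contract_linear])
      (rule er_Suc_closed[OF _ _ bs])
  also have "\<dots> = sweedler K (TR p) (coact W.FV y) (\<lambda>(y0, y1). er p (wten (counit_map y0) y1) bs)"
    by (rule sweedler_cong'[OF supported_coact_N[OF y] TR_module])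
      (auto simp: contract_er bs intro!: linear_mapD(1)[OF er1] wten(3) counit_map_closed)
  also have "\<dots> = er p y bs"
  proof (rule W.free_eq[OF TR_module _ er1 _ y])
    show "linear_map K W.FV (TR p) (\<lambda>y. sweedler K (TR p) (coact W.FV y) (\<lambda>(y0, y1). er p (wten (counit_map y0) y1) bs))"
      by (rule linear_map_comp[OF N.coact_linear NA.sw_linear[OF TR_module bil]])
    fix w b assume w: "w \<in> carrier W" and b: "b \<in> carrier A"
    have "sweedler K (TR p) (coact W.FV (wten w b)) (\<lambda>(y0, y1). er p (wten (counit_map y0) y1) bs) =
      sweedler K (TR p) (comult A b) (\<lambda>(b1, b2). er p (wten (counit_map (wten w b1)) b2) bs)"
      by (rule W.free_coact_sweedler[OF TR_module bil w b])
    also have "\<dots> = sweedler K (TR p) (comult A b) (\<lambda>(b1, b2). counit A b1 \<odot>\<^bsub>TR p\<^esub> er p (wten w b2) bs)"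
      by (rule sweedler_cong'[OF supported_comult[OF b] TR_module])
        (auto simp: counit_map_ten w counit_closed linear_mapD(3)[OF wten(1)] linear_mapD(3)[OF er1] wten(3)
          intro!: T.smult_closed linear_mapD(1)[OF er1])
    also have "\<dots> = er p (wten w b) bs"
      by (rule sweedler_counit_left[OF TR_module linear_map_comp[OF wten(2)[OF w] er1] b])
    finally show "sweedler K (TR p) (coact W.FV (wten w b)) (\<lambda>(y0, y1). er p (wten (counit_map y0) y1) bs) =
      er p (wten w b) bs" .
  qed
  finally show "contract p (cface p 0 (er p y bs)) = er p y bs" .
qed

text \<open>Dropping the leading factor renumbers the faces by one. Only \<open>i = 0\<close> is
  more than bookkeeping: the factor that is comultiplied is the one that moves into
  \<open>W \<otimes> A\<close>, and there comultiplying it is the coaction.\<close>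

lemma contract_cface_Suc:
  assumes "i \<le> p" "t \<in> carrier (TR (Suc p))"
  shows "contract (Suc p) (cface (Suc p) (Suc i) t) = cface p i (contract p t)"
proof (rule NA.tensorr_eq[OF TR_module _ _ _ assms(2)])
  show "linear_map K (TR (Suc p)) (TR (Suc p)) (\<lambda>t. contract (Suc p) (cface (Suc p) (Suc i) t))"
    by (rule linear_map_comp[OF cface_linear contract_linear]) (use assms in simp)
  show "linear_map K (TR (Suc p)) (TR (Suc p)) (\<lambda>t. cface p i (contract p t))"
    by (rule linear_map_comp[OF contract_linear cface_linear]) (use assms in simp)
  fix y as assume y: "y \<in> carrier W.FV" and "as \<in> words A (Suc p)"
  then obtain b bs where as: "as = b # bs" "b \<in> carrier A" "bs \<in> words A p" by (auto elim: words_SucE)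
  note cy = counit_map_closed[OF y]
  have R: "cface p i (contract p (er (Suc p) y as)) = cface_val p i (wten (counit_map y) b) bs"
    by (simp add: as contract_er y cface_er assms wten(3) cy)
  show "contract (Suc p) (cface (Suc p) (Suc i) (er (Suc p) y as)) = cface p i (contract p (er (Suc p) y as))"
  proof (cases i)
    case 0
    have "contract (Suc p) (cface (Suc p) (Suc i) (er (Suc p) y as)) =
      contract (Suc p) (sweedler K (TR (Suc (Suc p))) (comult A b) (\<lambda>(b1, b2). er (Suc (Suc p)) y (b1 # b2 # bs)))"
      using as by (subst cface_er) (simp_all add: y cface_val_def 0)
    also have "\<dots> = sweedler K (TR (Suc p)) (comult A b) (\<lambda>(b1, b2). contract (Suc p) (er (Suc (Suc p)) y (b1 # b2 # bs)))"
      by (rule sweedler_linear_comp[OF supported_comult[OF as(2)] TR_module TR_module contract_linear])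
        (simp add: er_Suc_closed y as)
    also have "\<dots> = sweedler K (TR (Suc p)) (comult A b) (\<lambda>(b1, b2). er (Suc p) (wten (counit_map y) b1) (b2 # bs))"
      by (rule sweedler_cong'[OF supported_comult[OF as(2)] TR_module])
        (simp_all add: contract_er y as er_Suc_closed wten(3) cy)
    also have "\<dots> = cface_val p i (wten (counit_map y) b) bs"
      unfolding 0 cface_val_def if_P[OF refl]
      by (rule W.free_coact_sweedler[OF TR_module bilinearI cy as(2), symmetric])
        (use as(3) in \<open>auto intro: er(1) er_Suc\<close>)
    finally show ?thesis unfolding R .
  next
    case (Suc j)
    then have j: "j < p" using assms by simp
    then have bj: "bs ! j \<in> carrier A" using as(3) by (auto simp: words_def)
    have w: "take j bs @ b1 # b2 # drop (Suc j) bs \<in> words A (Suc p)" if "b1 \<in> carrier A" "b2 \<in> carrier A" for b1 b2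
      using as(3) j that by (auto simp: words_def dest: in_set_takeD in_set_dropD)
    have "contract (Suc p) (cface (Suc p) (Suc i) (er (Suc p) y as)) =
      contract (Suc p) (sweedler K (TR (Suc (Suc p))) (comult A (bs ! j)) (\<lambda>(b1, b2).
        er (Suc (Suc p)) y (b # take j bs @ b1 # b2 # drop (Suc j) bs)))"
      using as assms by (subst cface_er) (simp_all add: y cface_val_def Suc)
    also have "\<dots> = sweedler K (TR (Suc p)) (comult A (bs ! j)) (\<lambda>(b1, b2).
        contract (Suc p) (er (Suc (Suc p)) y (b # take j bs @ b1 # b2 # drop (Suc j) bs)))"
      by (rule sweedler_linear_comp[OF supported_comult[OF bj] TR_module TR_module contract_linear])
        (rule er_Suc_closed[OF y as(2) w])
    also have "\<dots> = sweedler K (TR (Suc p)) (comult A (bs ! j)) (\<lambda>(b1, b2).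
        er (Suc p) (wten (counit_map y) b) (take j bs @ b1 # b2 # drop (Suc j) bs))"
      by (rule sweedler_cong'[OF supported_comult[OF bj] TR_module])
        (simp_all add: contract_er y as w wten(3) cy NA.tenr_closed)
    also have "\<dots> = cface_val p i (wten (counit_map y) b) bs"
      by (simp add: cface_val_def Suc)
    finally show ?thesis unfolding R .
  qed
qed

text \<open>As \<open>t\<close> has a factor of \<open>A\<close> of its own, that factor moves
  forward and the appended one stays at the end. In \<open>TR 0\<close> the appended factor itself
  would move, which is the source of the residue.\<close>

lemma contract_append_factor:
  assumes "a \<in> carrier A" "t \<in> carrier (TR (Suc p))"
  shows "contract (Suc p) (append_factor (Suc p) t a) = append_factor p (contract p t) a"
proof (rule NA.tensorr_eq[OF TR_module _ _ _ assms(2)])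
  show "linear_map K (TR (Suc p)) (TR (Suc p)) (\<lambda>t. contract (Suc p) (append_factor (Suc p) t a))"
    by (rule linear_map_comp[OF append_factor_linear[OF assms(1)] contract_linear])
  show "linear_map K (TR (Suc p)) (TR (Suc p)) (\<lambda>t. append_factor p (contract p t) a)"
    by (rule linear_map_comp[OF contract_linear append_factor_linear[OF assms(1)]])
  fix y as assume y: "y \<in> carrier W.FV" and "as \<in> words A (Suc p)"
  then obtain b bs where as: "as = b # bs" "b \<in> carrier A" "bs \<in> words A p" by (auto elim: words_SucE)
  show "contract (Suc p) (append_factor (Suc p) (er (Suc p) y as) a) = append_factor p (contract p (er (Suc p) y as)) a"
    by (simp add: append_factor_er contract_er assms y as wten(3) counit_map_closed)
qed

lemma diag_act_er:
  assumes "a \<in> carrier A" "y \<in> carrier W.FV" "bs \<in> words A p"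
  shows "diag_act p a (er p y bs) = sweedler K (TR p) (iter_comult K A p a) (\<lambda>(c, cs).
    er p (act W.FV c y) (map2 (\<lambda>c b. c \<otimes>\<^bsub>A\<^esub> b) cs bs))"
  unfolding diag_act_def
  by (rule sweedler_cong'[OF supported_iter_comult[OF assms(1)] TR_module])
    (simp_all add: NA.sweedler_tenr[OF TR_module diag_act_multilinear] assms NA.tenr_closed
      linear_mapD(1)[OF N.act_linear] map2_mult_in_words)

text \<open>The leading part \<open>a_1\<close> acts on the factor that the counit removes and
  survives only as \<open>\<epsilon>(a_1)\<close>. The counit law absorbs this scalar into
  \<open>a_2\<close>, so the \<open>p + 2\<close> parts of \<open>a\<close> become the
  \<open>p + 1\<close> parts that act on the contracted tensor.\<close>

lemma contract_diag_act:
  assumes a: "a \<in> carrier A" and t: "t \<in> carrier (TR (Suc p))"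
  shows "contract p (diag_act (Suc p) a t) = diag_act p a (contract p t)"
proof (rule NA.tensorr_eq[OF TR_module _ _ _ t])
  show "linear_map K (TR (Suc p)) (TR p) (\<lambda>t. contract p (diag_act (Suc p) a t))"
    by (rule linear_map_comp[OF diag_act_linear[OF a] contract_linear])
  show "linear_map K (TR (Suc p)) (TR p) (\<lambda>t. diag_act p a (contract p t))"
    by (rule linear_map_comp[OF contract_linear diag_act_linear[OF a]])
  interpret T: module K "TR p" by (rule TR_module)
  fix y as assume y: "y \<in> carrier W.FV" and as0: "as \<in> words A (Suc p)"
  then obtain b bs where as: "as = b # bs" "b \<in> carrier A" "bs \<in> words A p" by (auto elim: words_SucE)
  let ?m = "map2 (\<lambda>c b. c \<otimes>\<^bsub>A\<^esub> b)"
  note cy = counit_map_closed[OF y] and ac = linear_mapD(1)[OF N.act_linear] and sc = supported_iter_comult[OF a]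
  have mult: "multilinear K A A (Suc p) (TR (Suc p)) (\<lambda>c cs. er (Suc p) (act W.FV c y) (?m cs as))"
    by (rule multilinearI)
      (auto intro!: linear_map_comp[OF N.act_linear_left[OF y] er(1)] map2_mult_in_words as0
        slot_linear_map2_left er(2) ac y)
  have "contract p (diag_act (Suc p) a (er (Suc p) y as)) =
    contract p (sweedler K (TR (Suc p)) (iter_comult K A p a) (\<lambda>(c, cs). sweedler K (TR (Suc p)) (comult A c)
      (\<lambda>(c1, c2). er (Suc p) (act W.FV c1 y) ((c2 \<otimes>\<^bsub>A\<^esub> b) # ?m cs bs))))"
    unfolding diag_act_er[OF a y as0] sweedler_iter_comult_Suc[OF TR_module mult a] by (simp add: as(1))
  also have "\<dots> = sweedler K (TR p) (iter_comult K A p a) (\<lambda>(c, cs). contract p (sweedler K (TR (Suc p)) (comult A c)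
      (\<lambda>(c1, c2). er (Suc p) (act W.FV c1 y) ((c2 \<otimes>\<^bsub>A\<^esub> b) # ?m cs bs))))"
    by (rule sweedler_linear_comp[OF sc TR_module TR_module contract_linear])
      (auto intro!: sweedler_closed[OF supported_comult TR_module] er_Suc_closed ac map2_mult_in_words simp: y as)
  also have "\<dots> = sweedler K (TR p) (iter_comult K A p a) (\<lambda>(c, cs). er p (act W.FV c (wten (counit_map y) b)) (?m cs bs))"
  proof (rule sweedler_cong'[OF sc TR_module, symmetric])
    fix c cs assume c: "c \<in> carrier A" and cs: "cs \<in> words A p"
    note m = map2_mult_in_words[OF cs as(3)]
    show "er p (act W.FV c (wten (counit_map y) b)) (?m cs bs) \<in> carrier (TR p)"
      by (simp add: NA.tenr_closed ac c wten(3) cy as(2) m)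
    have L: "linear_map K A (TR p) (\<lambda>z. er p (wten (counit_map y) (z \<otimes>\<^bsub>A\<^esub> b)) (?m cs bs))"
      by (rule linear_map_comp[OF linear_map_comp[OF mult_linear(2)[OF as(2)] wten(2)[OF cy]] er(1)[OF m]])
    have "contract p (sweedler K (TR (Suc p)) (comult A c) (\<lambda>(c1, c2). er (Suc p) (act W.FV c1 y) ((c2 \<otimes>\<^bsub>A\<^esub> b) # ?m cs bs))) =
      sweedler K (TR p) (comult A c) (\<lambda>(c1, c2). contract p (er (Suc p) (act W.FV c1 y) ((c2 \<otimes>\<^bsub>A\<^esub> b) # ?m cs bs)))"
      by (rule sweedler_linear_comp[OF supported_comult[OF c] TR_module TR_module contract_linear])
        (simp add: er_Suc_closed ac y as m)
    also have "\<dots> = sweedler K (TR p) (comult A c) (\<lambda>(c1, c2). counit A c1 \<odot>\<^bsub>TR p\<^esub> er p (wten (counit_map y) (c2 \<otimes>\<^bsub>A\<^esub> b)) (?m cs bs))"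
      by (rule sweedler_cong'[OF supported_comult[OF c] TR_module])
        (simp_all add: contract_er ac y as m counit_map_act counit_closed cy NA.tenr_closed wten(3)
          linear_mapD(3)[OF wten(1)] linear_mapD(3)[OF er(1)])
    also have "\<dots> = er p (wten (counit_map y) (c \<otimes>\<^bsub>A\<^esub> b)) (?m cs bs)"
      by (rule sweedler_counit_left[OF TR_module L c])
    finally show "er p (act W.FV c (wten (counit_map y) b)) (?m cs bs) =
      contract p (sweedler K (TR (Suc p)) (comult A c) (\<lambda>(c1, c2). er (Suc p) (act W.FV c1 y) ((c2 \<otimes>\<^bsub>A\<^esub> b) # ?m cs bs)))"
      by (simp add: W.free_act_ten c cy as)
  qed
  also have "\<dots> = diag_act p a (contract p (er (Suc p) y as))"
    by (simp add: as contract_er y diag_act_er a wten(3) cy)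
  finally show "contract p (diag_act (Suc p) a (er (Suc p) y as)) = diag_act p a (contract p (er (Suc p) y as))" .
qed

end

context free_pair
begin

subsection \<open>The contraction of the comodule differential\<close>

text \<open>The operator \<sigma>. It acts on the values of a cochain alone.\<close>

definition contr where
  "contr n p f = (\<lambda>t\<in>carrier (TL n). contract p (f t))"

lemma contr_closed: "f \<in> carrier (C n (Suc p)) \<Longrightarrow> contr n p f \<in> carrier (C n p)"
  unfolding contr_def by (intro C_restrict linear_map_comp[OF C_linear contract_linear])

lemma contr_apply: "t \<in> carrier (TL n) \<Longrightarrow> contr n p f t = contract p (f t)"
  by (simp add: contr_def)

lemma contr_linear: "linear_map K (C n (Suc p)) (C n p) (contr n p)"
  by (rule C_linear_mapI[OF contr_closed])
    (simp_all add: contr_apply MA.tenl_closed linear_map_comp[OF C_eval_linear contract_linear])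

lemma contr_cmap_0:
  assumes "f \<in> carrier (C n p)" shows "contr n p (cmap K A V.FV W.FV n p 0 f) = f"
  by (rule C_eqI[OF contr_closed[OF cmap_closed[OF assms]] assms])
    (auto simp: contr_apply cmap_le MA.tenl_closed intro!: contract_cface_0 linear_mapD(1)[OF C_linear[OF assms]])

text \<open>For the inner faces this is the statement on values. The last face appends a factor that
  the contraction does not reach, since the value already has one, so \<sigma> passes under the sums
  of the codiagonal coaction.\<close>

lemma contr_cmap_Suc:
  assumes f: "f \<in> carrier (C n (Suc p))" and i: "i \<le> Suc p"
  shows "contr n (Suc p) (cmap K A V.FV W.FV n (Suc p) (Suc i) f) = cmap K A V.FV W.FV n p i (contr n p f)"
proof (rule C_eqI[OF contr_closed[OF cmap_closed[OF f]] cmap_closed[OF contr_closed[OF f] i]])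
  show "Suc i \<le> Suc (Suc p)" using i by simp
  fix m as assume m: "m \<in> carrier V.FV" and as: "as \<in> words A n"
  note e = MA.tenl_closed[OF m as] and fc = linear_mapD(1)[OF C_linear[OF f]]
  show "contr n (Suc p) (cmap K A V.FV W.FV n (Suc p) (Suc i) f) (el n as m) =
    cmap K A V.FV W.FV n p i (contr n p f) (el n as m)"
  proof (cases "i \<le> p")
    case True
    then show ?thesis by (simp add: contr_apply cmap_le e contract_cface_Suc fc)
  next
    case False
    then have i: "i = Suc p" using i by simp
    have ac: "append_factor (Suc p) (f (el n cs x)) (word_prod ds \<otimes>\<^bsub>A\<^esub> a) \<in> carrier (TR (Suc (Suc p)))"
      if "cs \<in> words A n" "ds \<in> words A n" "x \<in> carrier V.FV" "a \<in> carrier A" for cs ds x a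
      using that word_prod_closed[OF that(2)]
      by (intro linear_mapD(1)[OF append_factor_linear] fc MA.tenl_closed) auto
    have ac': "append_factor p (contr n p f (el n cs x)) (word_prod ds \<otimes>\<^bsub>A\<^esub> a) \<in> carrier (TR (Suc p))"
      if "cs \<in> words A n" "ds \<in> words A n" "x \<in> carrier V.FV" "a \<in> carrier A" for cs ds x a
      using that word_prod_closed[OF that(2)]
      by (intro linear_mapD(1)[OF append_factor_linear] linear_mapD(1)[OF C_linear[OF contr_closed[OF f]]] MA.tenl_closed) auto
    note s = supported_coact_M[OF m]
    have "contract (Suc p) (cface_last n (Suc p) f m as) = sweedler_list K A (TR (Suc p)) as (\<lambda>cs ds.
        contract (Suc p) (sweedler K (TR (Suc (Suc p))) (coact V.FV m) (\<lambda>(x, a).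
          append_factor (Suc p) (f (el n cs x)) (word_prod ds \<otimes>\<^bsub>A\<^esub> a))))"
      unfolding cface_last_def
      by (rule sweedler_list_linear_comp[OF TR_module TR_module contract_linear as])
        (rule sweedler_closed[OF s TR_module ac])
    also have "\<dots> = cface_last n p (contr n p f) m as"
      unfolding cface_last_def
    proof (rule sweedler_list_cong[OF TR_module as, symmetric])
      fix cs ds assume cd: "cs \<in> words A n" "ds \<in> words A n"
      show "sweedler K (TR (Suc p)) (coact V.FV m) (\<lambda>(x, a). append_factor p (contr n p f (el n cs x)) (word_prod ds \<otimes>\<^bsub>A\<^esub> a))
        \<in> carrier (TR (Suc p))"
        by (rule sweedler_closed[OF s TR_module ac'[OF cd]])
      show "sweedler K (TR (Suc p)) (coact V.FV m) (\<lambda>(x, a). append_factor p (contr n p f (el n cs x)) (word_prod ds \<otimes>\<^bsub>A\<^esub> a)) =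
        contract (Suc p) (sweedler K (TR (Suc (Suc p))) (coact V.FV m) (\<lambda>(x, a).
          append_factor (Suc p) (f (el n cs x)) (word_prod ds \<otimes>\<^bsub>A\<^esub> a)))"
        by (subst sweedler_linear_comp[OF s TR_module TR_module contract_linear ac[OF cd]], assumption+,
            rule sweedler_cong'[OF s TR_module ac'[OF cd]], assumption+)
          (simp add: contract_append_factor contr_apply MA.tenl_closed fc cd word_prod_closed[OF cd(2)])
    qed
    finally show ?thesis
      by (simp add: contr_apply e i cmap_el_last f m as contr_closed)
  qed
qed

text \<open>Module faces other than the zeroth change only the arguments, which \<sigma> leaves
  alone; the zeroth commutes with \<sigma> because the contraction respects the diagonal
  action.\<close>

lemma contr_bmap:
  assumes f: "f \<in> carrier (C n (Suc p))" and i: "i \<le> Suc n"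
  shows "contr (Suc n) p (bmap K A V.FV W.FV n (Suc p) i f) = bmap K A V.FV W.FV n p i (contr n p f)"
proof (rule C_eqI[OF contr_closed[OF bmap_closed[OF f i]] bmap_closed[OF contr_closed[OF f] i]])
  fix m as assume m: "m \<in> carrier V.FV" and as: "as \<in> words A (Suc n)"
  note fc = linear_mapD(1)[OF C_linear[OF f]]
  from as obtain a as' where a: "as = a # as'" "a \<in> carrier A" "as' \<in> words A n" by (rule words_SucE)
  from as obtain as'' b where b: "as = as'' @ [b]" "as'' \<in> words A n" "b \<in> carrier A" by (rule words_SucE')
  have "act V.FV b m \<in> carrier V.FV" by (rule linear_mapD(1)[OF M.act_linear[OF b(3)] m])
  moreover have "butlast as = as''" "last as = b" by (simp_all add: b)
  moreover have "merge A (i - 1) as \<in> words A n" if "i \<noteq> 0" "i \<le> n"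
    by (rule merge_in_words[OF as]) (use that in simp)
  moreover have "hd as = a" "tl as = as'" by (simp_all add: a)
  ultimately have "contract p (bface n (Suc p) i f m as) = bface n p i (contr n p f) m as"
    unfolding bface_def using a b m
    by (auto simp: contr_apply MA.tenl_closed contract_diag_act fc)
  then show "contr (Suc n) p (bmap K A V.FV W.FV n (Suc p) i f) (el (Suc n) as m) =
    bmap K A V.FV W.FV n p i (contr n p f) (el (Suc n) as m)"
    by (simp add: contr_apply MA.tenl_closed m as bmap_el f i contr_closed)
qed

lemma contr_d_m:
  assumes f: "f \<in> carrier (C n (Suc p))"
  shows "contr (Suc n) p (d_m K A V.FV W.FV n (Suc p) f) = d_m K A V.FV W.FV n p (contr n p f)"
proof -
  interpret C: module K "C (Suc n) p" by (rule C_module)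
  interpret C': module K "C (Suc n) (Suc p)" by (rule C_module)
  show ?thesis unfolding d_m_def
    by (subst linear_map_finsum[OF C_module C_module contr_linear])
      (auto intro!: C.M.finsum_cong' simp: sgn_pow_closed bmap_closed contr_closed f contr_bmap
        linear_mapD(3)[OF contr_linear])
qed

lemma sgn_pow_Suc: "sgn_pow K (Suc i) = \<ominus>\<^bsub>K\<^esub> sgn_pow K i"
  by (simp add: sgn_pow_def K.l_minus K.r_minus)

lemma sgn_pow_0: "sgn_pow K 0 = \<one>\<^bsub>K\<^esub>"
  by (simp add: sgn_pow_def)

text \<open>The index \<open>1\<close> is the last face in comodule degree 0, the only one besides
  the zeroth. \<open>residue_val\<close> identifies the result as the colinear extension of
  \<open>\<epsilon> \<circ> f\<close>.\<close>

definition residue where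
  "residue n f = contr n 0 (cmap K A V.FV W.FV n 0 1 f)"

lemma residue_linear: "linear_map K (C n 0) (C n 0) (residue n)"
  unfolding residue_def[abs_def] by (rule linear_map_comp[OF cmap_linear contr_linear]) simp

lemmas residue_closed = linear_mapD(1)[OF residue_linear]

lemma contr_d_c_0:
  assumes f: "f \<in> carrier (C n 0)"
  shows "contr n 0 (d_c K A V.FV W.FV n 0 f) = f \<ominus>\<^bsub>C n 0\<^esub> residue n f"
proof -
  interpret C: module K "C n 0" by (rule C_module)
  interpret C': module K "C n (Suc 0)" by (rule C_module)
  have c: "cmap K A V.FV W.FV n 0 0 f \<in> carrier (C n (Suc 0))" "cmap K A V.FV W.FV n 0 1 f \<in> carrier (C n (Suc 0))"
    by (rule cmap_closed[OF f], simp)+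
  have "d_c K A V.FV W.FV n 0 f = cmap K A V.FV W.FV n 0 0 f \<ominus>\<^bsub>C n (Suc 0)\<^esub> cmap K A V.FV W.FV n 0 1 f"
    using c by (simp add: d_c_def Pi_iff cmap_closed f sgn_pow_closed sgn_pow_0 sgn_pow_Suc C'.smult_l_minus a_minus_def C'.M.a_comm)
  then show ?thesis
    using linear_map_minus[OF C_module C_module contr_linear c] by (simp add: contr_cmap_0 f residue_def)
qed

text \<open>The zeroth face gives back \<open>f\<close>. The face \<open>Suc i\<close> becomes face
  \<open>i\<close> of \<open>contr n p f\<close>, and the shift of the index changes its
  sign.\<close>

lemma contr_d_c_Suc:
  assumes f: "f \<in> carrier (C n (Suc p))"
  shows "contr n (Suc p) (d_c K A V.FV W.FV n (Suc p) f) = f \<ominus>\<^bsub>C n (Suc p)\<^esub> d_c K A V.FV W.FV n p (contr n p f)"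
proof -
  interpret C: module K "C n (Suc p)" by (rule C_module)
  interpret C': module K "C n (Suc (Suc p))" by (rule C_module)
  note s = sgn_pow_closed
  let ?g = "contr n p f"
  note g = contr_closed[OF f]
  have "contr n (Suc p) (d_c K A V.FV W.FV n (Suc p) f) =
      (\<Oplus>\<^bsub>C n (Suc p)\<^esub>i\<in>{..Suc (Suc p)}. sgn_pow K i \<odot>\<^bsub>C n (Suc p)\<^esub> contr n (Suc p) (cmap K A V.FV W.FV n (Suc p) i f))"
    unfolding d_c_def
    by (subst linear_map_finsum[OF C_module C_module contr_linear])
      (auto intro!: C.M.finsum_cong' simp: s cmap_closed contr_closed f linear_mapD(3)[OF contr_linear])
  also have "\<dots> = (\<Oplus>\<^bsub>C n (Suc p)\<^esub>i\<in>{..Suc p}. sgn_pow K (Suc i) \<odot>\<^bsub>C n (Suc p)\<^esub> contr n (Suc p) (cmap K A V.FV W.FV n (Suc p) (Suc i) f))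
      \<oplus>\<^bsub>C n (Suc p)\<^esub> f"
    by (subst C.M.finsum_Suc2) (auto simp: s cmap_closed contr_closed f contr_cmap_0 sgn_pow_0)
  also have "(\<Oplus>\<^bsub>C n (Suc p)\<^esub>i\<in>{..Suc p}. sgn_pow K (Suc i) \<odot>\<^bsub>C n (Suc p)\<^esub> contr n (Suc p) (cmap K A V.FV W.FV n (Suc p) (Suc i) f)) =
      (\<Oplus>\<^bsub>C n (Suc p)\<^esub>i\<in>{..Suc p}. (\<ominus>\<^bsub>K\<^esub> \<one>\<^bsub>K\<^esub>) \<odot>\<^bsub>C n (Suc p)\<^esub> (sgn_pow K i \<odot>\<^bsub>C n (Suc p)\<^esub> cmap K A V.FV W.FV n p i ?g))"
    by (rule C.M.finsum_cong'[OF refl])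
      (auto simp: s cmap_closed g f contr_cmap_Suc sgn_pow_Suc C.smult_l_minus)
  also have "\<dots> = (\<ominus>\<^bsub>K\<^esub> \<one>\<^bsub>K\<^esub>) \<odot>\<^bsub>C n (Suc p)\<^esub> d_c K A V.FV W.FV n p ?g"
    unfolding d_c_def by (rule C.finsum_smult_ldistr[symmetric]) (auto simp: s cmap_closed g)
  also have "\<dots> = \<ominus>\<^bsub>C n (Suc p)\<^esub> d_c K A V.FV W.FV n p ?g"
    by (simp add: C.smult_l_minus linear_mapD(1)[OF d_c_linear g])
  finally show ?thesis
    by (simp add: a_minus_def C.M.a_comm f linear_mapD(1)[OF d_c_linear g])
qed

subsection \<open>Cochains without comodule degree\<close>

text \<open>\<open>TR 0\<close> is a copy of \<open>W \<otimes> A\<close> over the empty word. On it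
  \<open>bottom_counit\<close> applies the counit to the factor \<open>A\<close>, and
  \<open>bottom w b\<close> is its element \<open>w \<otimes> b\<close>.\<close>

definition bottom_counit where
  "bottom_counit t = sweedler K W t (\<lambda>(y, bs). counit_map y)"

definition bottom where
  "bottom w b = er 0 (wten w b) []"

lemma bottom_counit_multilinear: "multilinear K W.FV A 0 W (\<lambda>y bs. counit_map y)"
  by (rule multilinearI[OF counit_map_linear slot_linear_0])

lemma bottom_counit_linear: "linear_map K (TR 0) W bottom_counit"
  unfolding bottom_counit_def[abs_def]
  by (rule NA.sweedler_tensorr_linear[OF W.V_module bottom_counit_multilinear])

lemmas bottom_counit_closed = linear_mapD(1)[OF bottom_counit_linear]

lemma bottom_counit_er: "y \<in> carrier W.FV \<Longrightarrow> bottom_counit (er 0 y []) = counit_map y"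
  unfolding bottom_counit_def by (rule NA.sweedler_tenr[OF W.V_module bottom_counit_multilinear]) simp_all

lemma bottom_linear:
  "b \<in> carrier A \<Longrightarrow> linear_map K W (TR 0) (\<lambda>w. bottom w b)"
  "w \<in> carrier W \<Longrightarrow> linear_map K A (TR 0) (bottom w)"
  unfolding bottom_def[abs_def]
  by (rule linear_map_comp[OF wten(1) er(1)]; simp) (rule linear_map_comp[OF wten(2) er(1)]; simp)

lemma bottom_closed: "w \<in> carrier W \<Longrightarrow> b \<in> carrier A \<Longrightarrow> bottom w b \<in> carrier (TR 0)"
  by (rule linear_mapD(1)[OF bottom_linear(1)])

lemma TR_0_eq:
  assumes "module K X" "linear_map K (TR 0) X f" "linear_map K (TR 0) X h"
    "\<And>w b. w \<in> carrier W \<Longrightarrow> b \<in> carrier A \<Longrightarrow> f (bottom w b) = h (bottom w b)" "t \<in> carrier (TR 0)"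
  shows "f t = h t"
proof (rule NA.tensorr_eq[OF assms(1-3) _ assms(5)])
  fix y as assume y: "y \<in> carrier W.FV" and "as \<in> words A 0"
  then have as: "as = []" by simp
  have "f (er 0 y []) = h (er 0 y [])"
    by (rule W.free_eq[OF assms(1) linear_map_comp[OF er(1) assms(2)] linear_map_comp[OF er(1) assms(3)] _ y])
      (simp_all add: assms(4)[unfolded bottom_def])
  then show "f (er 0 y as) = h (er 0 y as)" by (simp add: as)
qed

lemma append_factor_bottom:
  "w \<in> carrier W \<Longrightarrow> b \<in> carrier A \<Longrightarrow> a \<in> carrier A \<Longrightarrow>
    append_factor 0 (bottom w b) a = er (Suc 0) (wten w b) [a]"
  by (simp add: bottom_def append_factor_er wten(3))

text \<open>With no other factor present, the appended \<open>a\<close> itself moves into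
  \<open>W \<otimes> A\<close>, and of \<open>t\<close> only its image under the counit is
  left.\<close>

lemma contract_append_bottom:
  assumes "a \<in> carrier A" "t \<in> carrier (TR 0)"
  shows "contract 0 (append_factor 0 t a) = bottom (bottom_counit t) a"
proof (rule NA.tensorr_eq[OF TR_module _ _ _ assms(2)])
  show "linear_map K (TR 0) (TR 0) (\<lambda>t. contract 0 (append_factor 0 t a))"
    by (rule linear_map_comp[OF append_factor_linear[OF assms(1)] contract_linear])
  show "linear_map K (TR 0) (TR 0) (\<lambda>t. bottom (bottom_counit t) a)"
    by (rule linear_map_comp[OF bottom_counit_linear bottom_linear(1)[OF assms(1)]])
qed (use assms in \<open>simp add: append_factor_er contract_er bottom_counit_er bottom_def\<close>)

lemma diag_act_bottom:
  assumes "a \<in> carrier A" "w \<in> carrier W" "b \<in> carrier A"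
  shows "diag_act 0 a (bottom w b) = bottom w (a \<otimes>\<^bsub>A\<^esub> b)"
proof -
  have "multilinear K A A 0 (TR 0) (\<lambda>c cs. er 0 (act W.FV c (wten w b)) (map2 (\<lambda>c b. c \<otimes>\<^bsub>A\<^esub> b) cs []))"
    by (rule multilinearI[OF _ slot_linear_0])
      (auto intro!: linear_map_comp[OF N.act_linear_left er(1)] wten(3) assms)
  from AA.sweedler_tenr[OF TR_module this assms(1)] show ?thesis
    by (simp add: bottom_def diag_act_er assms wten(3) W.free_act_ten)
qed

text \<open>After composition with the counit, the zeroth module face is multiplication by
  \<open>\<epsilon>(a)\<close>: the zeroth face of a bar complex with trivial coefficients in
  \<open>W\<close>.\<close>

lemma bottom_counit_diag_act:
  assumes "a \<in> carrier A" "t \<in> carrier (TR 0)"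
  shows "bottom_counit (diag_act 0 a t) = counit A a \<odot>\<^bsub>W\<^esub> bottom_counit t"
proof (rule TR_0_eq[OF W.V_module _ _ _ assms(2)])
  show "linear_map K (TR 0) W (\<lambda>t. bottom_counit (diag_act 0 a t))"
    by (rule linear_map_comp[OF diag_act_linear[OF assms(1)] bottom_counit_linear])
  show "linear_map K (TR 0) W (\<lambda>t. counit A a \<odot>\<^bsub>W\<^esub> bottom_counit t)"
    by (rule linear_map_smult_fun[OF TR_module W.V_module bottom_counit_linear counit_closed[OF assms(1)]])
  show "bottom_counit (diag_act 0 a (bottom w b)) = counit A a \<odot>\<^bsub>W\<^esub> bottom_counit (bottom w b)"
    if "w \<in> carrier W" "b \<in> carrier A" for w b
    using that assms
    by (simp add: diag_act_bottom) (simp add: bottom_def bottom_counit_er wten(3) counit_map_ten counit_mult counit_closed W.V.smult_assoc1)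
qed

text \<open>A cochain on \<open>A\<^sup>n \<otimes> (V \<otimes> A)\<close> is evaluated on words of length \<open>n + 1\<close>, whose last letter is
  the factor \<open>A\<close> of \<open>V \<otimes> A\<close>.\<close>

definition val where
  "val n f v xs = f (el n (butlast xs) (vten v (last xs)))"

lemma val_snoc [simp]: "val n f v (as @ [b]) = f (el n as (vten v b))"
  by (simp add: val_def)

lemma val_slot_linear:
  assumes "f \<in> carrier (C n p)" "v \<in> carrier V"
  shows "slot_linear K A (Suc n) (TR p) (val n f v)"
  unfolding val_def[abs_def]
  by (rule slot_linear_butlast_last)
    (auto intro: multilinearD(2)[OF C_el[OF assms(1)]] vten(3) assms(2)
      linear_map_comp[OF vten(2) multilinearD(1)[OF C_el[OF assms(1)]]])

lemma val_closed:
  assumes "f \<in> carrier (C n p)" "v \<in> carrier V" "xs \<in> words A (Suc n)"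
  shows "val n f v xs \<in> carrier (TR p)"
  using assms(3) by (elim words_SucE') (simp add: multilinearD(3)[OF C_el[OF assms(1)]] vten(3) assms(2))

lemma C_eqI_val:
  assumes "f \<in> carrier (C n p)" "g \<in> carrier (C n p)"
    "\<And>v xs. v \<in> carrier V \<Longrightarrow> xs \<in> words A (Suc n) \<Longrightarrow> val n f v xs = val n g v xs"
  shows "f = g"
proof (rule C_eqI[OF assms(1,2)])
  fix m as assume m: "m \<in> carrier V.FV" and as: "as \<in> words A n"
  show "f (el n as m) = g (el n as m)"
  proof (rule V.free_eq[OF TR_module multilinearD(1)[OF C_el[OF assms(1)] as] multilinearD(1)[OF C_el[OF assms(2)] as] _ m])
    show "f (el n as (vten v b)) = g (el n as (vten v b))" if "v \<in> carrier V" "b \<in> carrier A" for v b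
      using assms(3)[of v "as @ [b]"] that as by simp
  qed
qed

text \<open>\<open>sweedler_list\<close> recurses from the front, whereas the factor of
  \<open>V \<otimes> A\<close> is the last letter.\<close>

lemma sweedler_list_snoc:
  "sweedler_list K A X (as @ [b]) \<phi> = sweedler_list K A X as (\<lambda>cs ds.
    sweedler K X (comult A b) (\<lambda>(b1, b2). \<phi> (cs @ [b1]) (ds @ [b2])))"
  by (induction as arbitrary: \<phi>) simp_all

text \<open>The coaction on \<open>v \<otimes> b\<close> comultiplies \<open>b\<close> just as the
  codiagonal coaction does with the letters before it. All \<open>Suc n\<close> letters are treated
  alike, and the appended factor is the product of all second halves.\<close>

lemma val_cmap_last:
  assumes f: "f \<in> carrier (C n p)" and v: "v \<in> carrier V" and xs: "xs \<in> words A (Suc n)"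
  shows "val n (cmap K A V.FV W.FV n p (Suc p) f) v xs =
    sweedler_list K A (TR (Suc p)) xs (\<lambda>cs ds. append_factor p (val n f v cs) (word_prod ds))"
proof -
  from xs obtain as b where x: "xs = as @ [b]" "as \<in> words A n" "b \<in> carrier A" by (rule words_SucE')
  have bil: "bilinear_map K V.FV A (TR (Suc p)) (\<lambda>m a. append_factor p (f (el n cs m)) (word_prod ds \<otimes>\<^bsub>A\<^esub> a))"
    if "cs \<in> words A n" "ds \<in> words A n" for cs ds
    by (rule append_factor_bilinear[OF f that(1) word_prod_closed[OF that(2)]])
  have c: "append_factor p (f (el n cs m)) (word_prod ds \<otimes>\<^bsub>A\<^esub> a) \<in> carrier (TR (Suc p))"
    if "cs \<in> words A n" "ds \<in> words A n" "m \<in> carrier V.FV" "a \<in> carrier A" for cs ds m a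
    using linear_mapD(1)[OF bilinearD(1)[OF bil[OF that(1,2)] that(4)] that(3)] .
  show ?thesis unfolding x(1) sweedler_list_snoc val_snoc cmap_el_last[OF f vten(3)[OF v x(3)] x(2)] cface_last_def
  proof (rule sweedler_list_cong[OF TR_module x(2)])
    fix cs ds assume cd: "cs \<in> words A n" "ds \<in> words A n"
    show "sweedler K (TR (Suc p)) (coact V.FV (vten v b)) (\<lambda>(m0, m1). append_factor p (f (el n cs m0)) (word_prod ds \<otimes>\<^bsub>A\<^esub> m1))
      \<in> carrier (TR (Suc p))"
      by (rule sweedler_closed[OF supported_coact_M TR_module c[OF cd]]) (rule vten(3)[OF v x(3)])
    show "sweedler K (TR (Suc p)) (coact V.FV (vten v b)) (\<lambda>(m0, m1). append_factor p (f (el n cs m0)) (word_prod ds \<otimes>\<^bsub>A\<^esub> m1)) =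
      sweedler K (TR (Suc p)) (comult A b) (\<lambda>(b1, b2). append_factor p (f (el n cs (vten v b1))) (word_prod (ds @ [b2])))"
      unfolding V.free_coact_sweedler[OF TR_module bil[OF cd] v x(3)]
      by (rule sweedler_cong'[OF supported_comult[OF x(3)] TR_module c[OF cd]])
        (auto simp: vten(3) v word_prod_snoc[OF cd(2)] simp del: foldr_append)
  qed
qed

text \<open>The last comodule face appends the product of the second halves, and \<sigma> moves
  exactly that product into \<open>W \<otimes> A\<close>. The result is the usual extension of a
  linear map into \<open>W\<close> to a colinear map into a cofree comodule.\<close>

lemma residue_val:
  assumes f: "f \<in> carrier (C n 0)" and v: "v \<in> carrier V" and xs: "xs \<in> words A (Suc n)"
  shows "val n (residue n f) v xs =
    sweedler_list K A (TR 0) xs (\<lambda>cs ds. bottom (bottom_counit (val n f v cs)) (word_prod ds))"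
proof -
  from xs obtain as b where x: "xs = as @ [b]" "as \<in> words A n" "b \<in> carrier A" by (rule words_SucE')
  have "val n (residue n f) v xs = contract 0 (val n (cmap K A V.FV W.FV n 0 (Suc 0) f) v xs)"
    by (simp add: residue_def contr_apply MA.tenl_closed x vten(3) v)
  also have "\<dots> = sweedler_list K A (TR 0) xs (\<lambda>cs ds. contract 0 (append_factor 0 (val n f v cs) (word_prod ds)))"
    unfolding val_cmap_last[OF f v xs]
    by (rule sweedler_list_linear_comp[OF TR_module TR_module contract_linear xs])
      (auto intro: linear_mapD(1)[OF append_factor_linear] val_closed f v word_prod_closed)
  also have "\<dots> = sweedler_list K A (TR 0) xs (\<lambda>cs ds. bottom (bottom_counit (val n f v cs)) (word_prod ds))"
    by (rule sweedler_list_cong[OF TR_module xs, symmetric])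
      (auto simp: contract_append_bottom val_closed f v word_prod_closed intro!: bottom_closed bottom_counit_closed)
  finally show ?thesis .
qed

lemma cface_bottom:
  assumes w: "w \<in> carrier W" and b: "b \<in> carrier A"
  shows "cface 0 0 (bottom w b) = sweedler K (TR (Suc 0)) (comult A b) (\<lambda>(b1, b2). er (Suc 0) (wten w b1) [b2])"
proof -
  have "cface 0 0 (bottom w b) = sweedler K (TR (Suc 0)) (coact W.FV (wten w b)) (\<lambda>(y0, y1). er (Suc 0) y0 [y1])"
    by (simp add: bottom_def cface_er wten(3) w b cface_val_def)
  also have "\<dots> = sweedler K (TR (Suc 0)) (comult A b) (\<lambda>(b1, b2). er (Suc 0) (wten w b1) [b2])"
    by (rule W.free_coact_sweedler[OF TR_module bilinearI w b]) (auto intro: er(1) er_Suc)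
  finally show ?thesis .
qed

text \<open>The two faces agree: the zeroth comultiplies the product of the second halves, the last
  splits the first halves once more, and coassociativity on words identifies the results. Equality
  of the faces says that \<open>residue n f\<close> is colinear.\<close>

lemma residue_cocycle:
  assumes f: "f \<in> carrier (C n 0)"
  shows "d_c K A V.FV W.FV n 0 (residue n f) = \<zero>\<^bsub>C n (Suc 0)\<^esub>"
proof -
  interpret C: module K "C n (Suc 0)" by (rule C_module)
  note r = residue_closed[OF f]
  have c: "cmap K A V.FV W.FV n 0 0 (residue n f) \<in> carrier (C n (Suc 0))"
    "cmap K A V.FV W.FV n 0 1 (residue n f) \<in> carrier (C n (Suc 0))"
    by (rule cmap_closed[OF r], simp)+
  have "cmap K A V.FV W.FV n 0 0 (residue n f) = cmap K A V.FV W.FV n 0 1 (residue n f)"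
  proof (rule C_eqI_val[OF c])
    fix v xs assume v: "v \<in> carrier V" and xs: "xs \<in> words A (Suc n)"
    let ?u = "\<lambda>cs. bottom_counit (val n f v cs)"
    have u: "?u cs \<in> carrier W" if "cs \<in> words A (Suc n)" for cs
      by (rule bottom_counit_closed[OF val_closed[OF f v that]])
    have usl: "slot_linear K A (Suc n) W ?u"
      by (rule slot_linear_comp[OF val_slot_linear[OF f v] bottom_counit_linear])
    let ?\<psi> = "\<lambda>cs d1 d2. er (Suc 0) (wten (?u cs) d1) [d2]"
    have \<psi>: "?\<psi> cs d1 d2 \<in> carrier (TR (Suc 0))" if "cs \<in> words A (Suc n)" "d1 \<in> carrier A" "d2 \<in> carrier A" for cs d1 d2
      using that by (intro er_Suc_closed wten(3) u) auto
    note wp = word_prod_closed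
    from xs obtain as b where x: "xs = as @ [b]" "as \<in> words A n" "b \<in> carrier A" by (rule words_SucE')
    have "val n (cmap K A V.FV W.FV n 0 0 (residue n f)) v xs = cface 0 0 (val n (residue n f) v xs)"
      by (simp add: cmap_le x MA.tenl_closed vten(3) v)
    also have "\<dots> = sweedler_list K A (TR (Suc 0)) xs (\<lambda>cs ds. cface 0 0 (bottom (?u cs) (word_prod ds)))"
      unfolding residue_val[OF f v xs]
      by (rule sweedler_list_linear_comp[OF TR_module TR_module cface_linear xs])
        (auto intro!: bottom_closed u wp)
    also have "\<dots> = sweedler_list K A (TR (Suc 0)) xs (\<lambda>cs ds. sweedler K (TR (Suc 0)) (comult A (word_prod ds))
        (\<lambda>(d1, d2). ?\<psi> cs d1 d2))"
      by (rule sweedler_list_cong[OF TR_module xs])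
        (auto simp: cface_bottom u wp intro!: sweedler_closed[OF supported_comult TR_module] \<psi>)
    \<comment> \<open>The only step that leaves the shape of the zeroth face: the coproduct of a
      product of second halves is traded for a second splitting of the first halves.\<close>
    also have "\<dots> = sweedler_list K A (TR (Suc 0)) xs (\<lambda>cs ds. sweedler_list K A (TR (Suc 0)) cs
        (\<lambda>es fs. ?\<psi> es (word_prod fs) (word_prod ds)))"
    proof (rule sweedler_list_comult_word_prod[OF TR_module xs])
      show "bilinear_map K A A (TR (Suc 0)) (?\<psi> cs)" if "cs \<in> words A (Suc n)" for cs
        by (rule bilinearI) (auto intro!: linear_map_comp[OF wten(2) er(1)] er_Suc wten(3) u that)
      show "slot_linear K A (Suc n) (TR (Suc 0)) (\<lambda>cs. ?\<psi> cs d1 d2)" if "d1 \<in> carrier A" "d2 \<in> carrier A" for d1 d2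
        by (rule slot_linear_comp[OF usl linear_map_comp[OF wten(1) er(1)]]) (use that in auto)
    qed
    also have "\<dots> = sweedler_list K A (TR (Suc 0)) xs (\<lambda>cs ds. append_factor 0 (val n (residue n f) v cs) (word_prod ds))"
    proof (rule sweedler_list_cong[OF TR_module xs])
      fix cs ds assume cd: "cs \<in> words A (Suc n)" "ds \<in> words A (Suc n)"
      show "sweedler_list K A (TR (Suc 0)) cs (\<lambda>es fs. ?\<psi> es (word_prod fs) (word_prod ds)) \<in> carrier (TR (Suc 0))"
        by (rule sweedler_list_closed[OF TR_module cd(1)]) (intro \<psi> wp[OF cd(2)] wp)
      show "sweedler_list K A (TR (Suc 0)) cs (\<lambda>es fs. ?\<psi> es (word_prod fs) (word_prod ds)) =
        append_factor 0 (val n (residue n f) v cs) (word_prod ds)"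
        unfolding residue_val[OF f v cd(1)]
        by (subst sweedler_list_linear_comp[OF TR_module TR_module append_factor_linear[OF wp[OF cd(2)]] cd(1)],
            intro bottom_closed u wp, assumption+, rule sweedler_list_cong[OF TR_module cd(1)])
          (auto intro!: \<psi> wp[OF cd(2)] intro: wp simp: append_factor_bottom u wp wp[OF cd(2)])
    qed
    also have "\<dots> = val n (cmap K A V.FV W.FV n 0 1 (residue n f)) v xs"
      using val_cmap_last[OF r v xs] by simp
    finally show "val n (cmap K A V.FV W.FV n 0 0 (residue n f)) v xs = val n (cmap K A V.FV W.FV n 0 1 (residue n f)) v xs" .
  qed
  then show ?thesis
    using c by (simp add: d_c_def Pi_iff cmap_closed r sgn_pow_closed sgn_pow_0 sgn_pow_Suc C.smult_l_minus C.M.l_neg)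
qed

end

section \<open>The contraction of the bar complex of a free module\<close>

context free_pair
begin

text \<open>A section for the last module face: \<open>b\<close> acting on
  \<open>v \<otimes> 1\<close> gives back \<open>v \<otimes> b\<close>.\<close>

definition shift where
  "shift n p f = (\<lambda>t\<in>carrier (TL n). sweedler K (TR p) t (\<lambda>(as, m).
    sweedler K (TR p) m (\<lambda>(v, b). f (el (Suc n) (as @ [b]) (vten v \<one>\<^bsub>A\<^esub>)))))"

context
  fixes n p f
  assumes f: "f \<in> carrier (C (Suc n) p)"
begin

lemma shift_bilinear:
  assumes "as \<in> words A n"
  shows "bilinear_map K V A (TR p) (\<lambda>v b. f (el (Suc n) (as @ [b]) (vten v \<one>\<^bsub>A\<^esub>)))"
proof (rule bilinearI)
  note \<phi> = multilinearD[OF C_el[OF f]]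
  show "linear_map K V (TR p) (\<lambda>v. f (el (Suc n) (as @ [b]) (vten v \<one>\<^bsub>A\<^esub>)))" if "b \<in> carrier A" for b
    by (rule linear_map_comp[OF vten(1) \<phi>(1)]) (use assms that in auto)
  show "linear_map K A (TR p) (\<lambda>b. f (el (Suc n) (as @ [b]) (vten v \<one>\<^bsub>A\<^esub>)))" if "v \<in> carrier V" for v
    by (rule slot_linear_last[OF \<phi>(2) assms]) (use that in \<open>auto intro: vten(3)\<close>)
qed

lemma shift_multilinear:
  "multilinear K V.FV A n (TR p) (\<lambda>m as. sweedler K (TR p) m (\<lambda>(v, b). f (el (Suc n) (as @ [b]) (vten v \<one>\<^bsub>A\<^esub>))))"
proof (rule multilinearI)
  show "linear_map K V.FV (TR p) (\<lambda>m. sweedler K (TR p) m (\<lambda>(v, b). f (el (Suc n) (as @ [b]) (vten v \<one>\<^bsub>A\<^esub>))))"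
    if "as \<in> words A n" for as
    by (rule V.free_sweedler_linear[OF TR_module shift_bilinear[OF that]])
  show "slot_linear K A n (TR p) (\<lambda>as. sweedler K (TR p) m (\<lambda>(v, b). f (el (Suc n) (as @ [b]) (vten v \<one>\<^bsub>A\<^esub>))))"
    if "m \<in> carrier V.FV" for m
    by (rule slot_linear_sweedler[OF V.supported_free[OF that] module_A TR_module])
      (auto intro: slot_linear_snoc[OF multilinearD(2)[OF C_el[OF f]]] vten(3))
qed

lemma shift_closed: "shift n p f \<in> carrier (C n p)"
  unfolding shift_def by (rule C_restrict[OF MA.sweedler_tensorl_linear[OF TR_module shift_multilinear]])

lemma shift_val:
  assumes "v \<in> carrier V" "xs \<in> words A (Suc n)"
  shows "val n (shift n p f) v xs = f (el (Suc n) xs (vten v \<one>\<^bsub>A\<^esub>))"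
proof -
  from assms(2) obtain as b where x: "xs = as @ [b]" "as \<in> words A n" "b \<in> carrier A" by (rule words_SucE')
  show ?thesis unfolding x(1) val_snoc
    by (simp add: shift_def MA.tenl_closed vten(3) assms x MA.sweedler_tenl[OF TR_module shift_multilinear]
      V.VA.sw_ten[OF TR_module shift_bilinear])
qed

end

text \<open>The letter next to the module acts on \<open>v \<otimes> b\<close> by multiplication
  into \<open>b\<close>, so on full words the last module face is one more
  \<open>merge\<close>.\<close>

lemma bface_val:
  assumes "1 \<le> i" "i \<le> Suc n" "v \<in> carrier V" "xs \<in> words A (Suc (Suc n))"
  shows "bface n p i f (vten v (last xs)) (butlast xs) = val n f v (merge A (i - 1) xs)"
proof -
  from assms(4) obtain as b where x: "xs = as @ [b]" "as \<in> words A (Suc n)" "b \<in> carrier A" by (rule words_SucE')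
  from x(2) obtain as' a where a: "as = as' @ [a]" "as' \<in> words A n" "a \<in> carrier A" by (rule words_SucE')
  show ?thesis
  proof (cases "i \<le> n")
    case True
    have "merge A (i - 1) xs = merge A (i - 1) as @ [b]" unfolding x(1)
      by (rule merge_snoc) (use True assms x(2) in \<open>auto simp: words_def\<close>)
    then show ?thesis using True assms by (simp add: bface_def x)
  next
    case False
    then have i: "i = Suc n" using assms by simp
    have "merge A n xs = as' @ [a \<otimes>\<^bsub>A\<^esub> b]"
      using merge_last[of A as' a b] a(2) by (simp add: x a words_def)
    then show ?thesis by (simp add: bface_def i x(1,3) a(1,3) V.free_act_ten assms(3) butlast_append)
  qed
qed

lemma sgn_pow_square: "sgn_pow K i \<otimes>\<^bsub>K\<^esub> sgn_pow K i = \<one>\<^bsub>K\<^esub>"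
proof (induction i)
  case (Suc i)
  then show ?case by (simp add: sgn_pow_Suc sgn_pow_closed K.l_minus K.r_minus)
qed (simp add: sgn_pow_0)

text \<open>The bar complex of a free module is contracted by \<^term>\<open>shift\<close>; here this is applied to the
  cocycle \<open>\<epsilon> \<circ> f\<close> with values in \<open>W\<close>, which \<^term>\<open>residue\<close> extends to \<open>W \<otimes> A\<close>.\<close>

lemma d_m_residue_shift:
  assumes f: "f \<in> carrier (C (Suc n) 0)" and d: "d_m K A V.FV W.FV (Suc n) 0 f = \<zero>\<^bsub>C (Suc (Suc n)) 0\<^esub>"
  shows "d_m K A V.FV W.FV n 0 (residue n (shift n 0 f)) = sgn_pow K (Suc n) \<odot>\<^bsub>C (Suc n) 0\<^esub> residue (Suc n) f"
proof -
  interpret C: module K "C (Suc n) 0" by (rule C_module)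
  interpret T: module K "TR 0" by (rule TR_module)
  let ?g = "residue n (shift n 0 f)"
  note s = shift_closed[OF f]
  note g = residue_closed[OF s] and r = residue_closed[OF f] and wp = word_prod_closed
  show ?thesis
  proof (rule C_eqI_val[OF linear_mapD(1)[OF d_m_linear g] C.smult_closed[OF sgn_pow_closed r]])
    fix v xs assume v: "v \<in> carrier V" and xs: "xs \<in> words A (Suc (Suc n))"
    from xs obtain as b where x: "xs = as @ [b]" "as \<in> words A (Suc n)" "b \<in> carrier A" by (rule words_SucE')
    note e = MA.tenl_closed[OF vten(3)[OF v x(3)] x(2)]
    \<comment> \<open>\<open>?U\<close> is \<open>\<epsilon> \<circ> f\<close> with module argument
      \<open>v \<otimes> 1\<close>; the \<open>?B i\<close> are the faces of its bar differential
      with trivial coefficients, the last face left out.\<close>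
    let ?U = "\<lambda>cs. bottom_counit (f (el (Suc n) cs (vten v \<one>\<^bsub>A\<^esub>)))"
    let ?B = "\<lambda>i cs. if i = 0 then counit A (hd cs) \<odot>\<^bsub>W\<^esub> ?U (tl cs) else ?U (merge A (i - 1) cs)"
    have v1: "vten v \<one>\<^bsub>A\<^esub> \<in> carrier V.FV" by (simp add: vten(3) v)
    have fc: "f (el (Suc n) cs (vten v \<one>\<^bsub>A\<^esub>)) \<in> carrier (TR 0)" if "cs \<in> words A (Suc n)" for cs
      by (rule multilinearD(3)[OF C_el[OF f] v1 that])
    note U = bottom_counit_closed[OF fc]
    have Usl: "slot_linear K A (Suc n) W ?U"
      by (rule slot_linear_comp[OF multilinearD(2)[OF C_el[OF f] v1] bottom_counit_linear])
    have mw: "merge A (i - 1) cs \<in> words A (Suc n)" if "i \<noteq> 0" "i \<le> Suc n" "cs \<in> words A (Suc (Suc n))" for i cs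
      by (rule merge_in_words[OF that(3)]) (use that in simp)
    have B: "?B i cs \<in> carrier W" if "cs \<in> words A (Suc (Suc n))" "i \<le> Suc n" for i cs
    proof (cases "i = 0")
      case True
      then show ?thesis using that(1) by (elim words_SucE[of cs]) (simp add: U counit_closed)
    qed (use U[OF mw[OF _ that(2,1)]] in simp)
    have gval: "val n ?g v ys = sweedler_list K A (TR 0) ys (\<lambda>cs ds. bottom (?U cs) (word_prod ds))"
      if "ys \<in> words A (Suc n)" for ys
      unfolding residue_val[OF s v that]
      by (rule sweedler_list_cong[OF TR_module that])
        (simp_all add: shift_val[OF f v] bottom_closed U wp bottom_counit_closed[OF val_closed[OF s v]])

    \<comment> \<open>Module faces are compatible with colinear extension: face \<open>i\<close> of
      \<open>?g\<close> is the extension of the bar face \<open>?B i\<close>.\<close>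
    have face: "bmap K A V.FV W.FV n 0 i ?g (el (Suc n) as (vten v b)) =
        sweedler_list K A (TR 0) xs (\<lambda>cs ds. bottom (?B i cs) (word_prod ds))" if i: "i \<le> Suc n" for i
    proof (cases "i = 0")
      case True
      from x(2) obtain a as' where a: "as = a # as'" "a \<in> carrier A" "as' \<in> words A n" by (rule words_SucE)
      have ys: "as' @ [b] \<in> words A (Suc n)" using a x by simp
      let ?L = "\<lambda>z. sweedler_list K A (TR 0) (as' @ [b]) (\<lambda>cs ds. bottom (?U cs) (z \<otimes>\<^bsub>A\<^esub> word_prod ds))"
      have L: "linear_map K A (TR 0) ?L"
        by (rule sweedler_list_linear_param[OF TR_module module_A ys])
          (rule linear_map_comp[OF mult_linear(2)[OF wp] bottom_linear(2)[OF U]])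
      have "bmap K A V.FV W.FV n 0 i ?g (el (Suc n) as (vten v b)) = diag_act 0 a (val n ?g v (as' @ [b]))"
        by (simp add: bmap_el[OF g] x vten(3) v bface_def True a)
      also have "\<dots> = sweedler_list K A (TR 0) (as' @ [b]) (\<lambda>cs ds. diag_act 0 a (bottom (?U cs) (word_prod ds)))"
        unfolding gval[OF ys]
        by (rule sweedler_list_linear_comp[OF TR_module TR_module diag_act_linear[OF a(2)] ys])
          (simp add: bottom_closed U wp)
      also have "\<dots> = ?L a"
        by (rule sweedler_list_cong[OF TR_module ys, symmetric])
          (simp_all add: diag_act_bottom bottom_closed U wp a)
      \<comment> \<open>The counit law is read backwards to split the letter \<open>a\<close> too,
        so that the sum ranges over the whole word \<open>xs\<close> as it does for the other
        faces.\<close>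
      also have "\<dots> = sweedler K (TR 0) (comult A a) (\<lambda>(a1, a2). counit A a1 \<odot>\<^bsub>TR 0\<^esub> ?L a2)"
        by (rule sweedler_counit_left[OF TR_module L a(2), symmetric])
      also have "\<dots> = sweedler K (TR 0) (comult A a) (\<lambda>(a1, a2).
          sweedler_list K A (TR 0) (as' @ [b]) (\<lambda>cs ds. bottom (counit A a1 \<odot>\<^bsub>W\<^esub> ?U cs) (a2 \<otimes>\<^bsub>A\<^esub> word_prod ds)))"
      proof (rule sweedler_cong'[OF supported_comult[OF a(2)] TR_module])
        fix a1 a2 assume a12: "a1 \<in> carrier A" "a2 \<in> carrier A"
        show "counit A a1 \<odot>\<^bsub>TR 0\<^esub> ?L a2 \<in> carrier (TR 0)"
          by (intro T.smult_closed counit_closed a12 linear_mapD(1)[OF L])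
        have "counit A a1 \<odot>\<^bsub>TR 0\<^esub> ?L a2 = sweedler_list K A (TR 0) (as' @ [b]) (\<lambda>cs ds.
            counit A a1 \<odot>\<^bsub>TR 0\<^esub> bottom (?U cs) (a2 \<otimes>\<^bsub>A\<^esub> word_prod ds))"
          by (rule sweedler_list_linear_comp[OF TR_module TR_module
                linear_map_smult_fun[OF TR_module TR_module linear_map_id counit_closed[OF a12(1)]] ys])
            (simp add: bottom_closed U wp a12)
        also have "\<dots> = sweedler_list K A (TR 0) (as' @ [b]) (\<lambda>cs ds. bottom (counit A a1 \<odot>\<^bsub>W\<^esub> ?U cs) (a2 \<otimes>\<^bsub>A\<^esub> word_prod ds))"
          by (rule sweedler_list_cong[OF TR_module ys])
            (simp_all add: bottom_closed U wp a12 counit_closed linear_mapD(3)[OF bottom_linear(1)])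
        finally show "counit A a1 \<odot>\<^bsub>TR 0\<^esub> ?L a2 = \<dots>" .
      qed
      finally show ?thesis by (simp add: x(1) a(1) True)
    next
      case False
      have "bmap K A V.FV W.FV n 0 i ?g (el (Suc n) as (vten v b)) = val n ?g v (merge A (i - 1) xs)"
        using bface_val[OF _ i v xs, of 0 ?g] False by (simp add: bmap_el[OF g i] x vten(3) v)
      also have "\<dots> = sweedler_list K A (TR 0) xs (\<lambda>cs ds. bottom (?U (merge A (i - 1) cs)) (word_prod (merge A (i - 1) ds)))"
        unfolding gval[OF mw[OF False i xs]]
      proof (rule sweedler_list_merge[OF TR_module xs])
        show "i - 1 < Suc n" using i False by simp
        show "slot_linear K A (Suc n) (TR 0) (\<lambda>cs. bottom (?U cs) (word_prod ds))" if "ds \<in> words A (Suc n)" for ds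
          by (rule slot_linear_comp[OF Usl bottom_linear(1)[OF wp[OF that]]])
        show "slot_linear K A (Suc n) (TR 0) (\<lambda>ds. bottom (?U cs) (word_prod ds))" if "cs \<in> words A (Suc n)" for cs
          by (rule slot_linear_comp[OF word_prod_slot_linear bottom_linear(2)[OF U[OF that]]])
      qed
      also have "\<dots> = sweedler_list K A (TR 0) xs (\<lambda>cs ds. bottom (?B i cs) (word_prod ds))"
      proof (rule sweedler_list_cong[OF TR_module xs])
        fix cs ds assume cd: "cs \<in> words A (Suc (Suc n))" "ds \<in> words A (Suc (Suc n))"
        note m = mw[OF False i cd(1)] mw[OF False i cd(2)]
        show "bottom (?U (merge A (i - 1) cs)) (word_prod (merge A (i - 1) ds)) \<in> carrier (TR 0)"
          by (rule bottom_closed[OF U[OF m(1)] wp[OF m(2)]])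
        have "word_prod (merge A (i - 1) ds) = word_prod ds"
          by (rule word_prod_merge[OF cd(2)]) (use i False in simp)
        then show "bottom (?U (merge A (i - 1) cs)) (word_prod (merge A (i - 1) ds)) = bottom (?B i cs) (word_prod ds)"
          using False by simp
      qed
      finally show ?thesis .
    qed

    \<comment> \<open>This is \<open>d_m f = 0\<close> evaluated at \<open>cs\<close> and
      \<open>v \<otimes> 1\<close> and composed with the counit. The faces up to
      \<open>Suc n\<close> are the \<open>?B i\<close>; in the last one the final letter
      \<open>c\<close> acts on \<open>v \<otimes> 1\<close>, which yields the value of
      \<open>f\<close> at \<open>v \<otimes> c\<close>.\<close>
    have sum: "(\<Oplus>\<^bsub>W\<^esub>i\<in>{..Suc n}. sgn_pow K i \<odot>\<^bsub>W\<^esub> ?B i cs) = sgn_pow K (Suc n) \<odot>\<^bsub>W\<^esub> bottom_counit (val (Suc n) f v cs)"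
      if cs: "cs \<in> words A (Suc (Suc n))" for cs
    proof -
      let ?h = "\<lambda>i. bottom_counit (bmap K A V.FV W.FV (Suc n) 0 i f (el (Suc (Suc n)) cs (vten v \<one>\<^bsub>A\<^esub>)))"
      note e' = MA.tenl_closed[OF v1 cs]
      from cs obtain cs' c where c: "cs = cs' @ [c]" "cs' \<in> words A (Suc n)" "c \<in> carrier A" by (rule words_SucE')
      have bc: "bmap K A V.FV W.FV (Suc n) 0 i f (el (Suc (Suc n)) cs (vten v \<one>\<^bsub>A\<^esub>)) \<in> carrier (TR 0)" if "i \<le> Suc (Suc n)" for i
        by (rule linear_mapD(1)[OF C_linear[OF bmap_closed[OF f that]] e'])
      have h: "?h i = ?B i cs" if "i \<le> Suc n" for i
        using cs that by (elim words_SucE[of cs])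
          (auto simp: bmap_el[OF f] v1 bface_def bottom_counit_diag_act fc)
      have hl: "?h (Suc (Suc n)) = bottom_counit (val (Suc n) f v cs)"
        by (simp add: bmap_el[OF f] v1 c bface_def V.free_act_ten v)
      note vc = bottom_counit_closed[OF val_closed[OF f v cs]]
      have "\<zero>\<^bsub>W\<^esub> = bottom_counit (d_m K A V.FV W.FV (Suc n) 0 f (el (Suc (Suc n)) cs (vten v \<one>\<^bsub>A\<^esub>)))"
        unfolding d C_apply(3)[OF e'] linear_map_zero[OF TR_module W.V_module bottom_counit_linear] ..
      also have "\<dots> = (\<Oplus>\<^bsub>W\<^esub>i\<in>{..Suc (Suc n)}. sgn_pow K i \<odot>\<^bsub>W\<^esub> ?h i)"
        unfolding d_m_apply[OF f e']
        by (subst linear_map_finsum[OF TR_module W.V_module bottom_counit_linear])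
          (auto intro!: W.V.M.finsum_cong' simp: bc sgn_pow_closed bottom_counit_closed linear_mapD(3)[OF bottom_counit_linear])
      also have "\<dots> = sgn_pow K (Suc (Suc n)) \<odot>\<^bsub>W\<^esub> ?h (Suc (Suc n)) \<oplus>\<^bsub>W\<^esub> (\<Oplus>\<^bsub>W\<^esub>i\<in>{..Suc n}. sgn_pow K i \<odot>\<^bsub>W\<^esub> ?h i)"
        by (rule W.V.M.finsum_Suc) (auto simp: bc sgn_pow_closed bottom_counit_closed)
      also have "(\<Oplus>\<^bsub>W\<^esub>i\<in>{..Suc n}. sgn_pow K i \<odot>\<^bsub>W\<^esub> ?h i) = (\<Oplus>\<^bsub>W\<^esub>i\<in>{..Suc n}. sgn_pow K i \<odot>\<^bsub>W\<^esub> ?B i cs)"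
        by (rule W.V.M.finsum_cong'[OF refl]) (use h B[OF cs] in \<open>auto simp: sgn_pow_closed\<close>)
      finally have z: "\<zero>\<^bsub>W\<^esub> = sgn_pow K (Suc (Suc n)) \<odot>\<^bsub>W\<^esub> bottom_counit (val (Suc n) f v cs) \<oplus>\<^bsub>W\<^esub>
          (\<Oplus>\<^bsub>W\<^esub>i\<in>{..Suc n}. sgn_pow K i \<odot>\<^bsub>W\<^esub> ?B i cs)" unfolding hl .
      have S: "(\<Oplus>\<^bsub>W\<^esub>i\<in>{..Suc n}. sgn_pow K i \<odot>\<^bsub>W\<^esub> ?B i cs) \<in> carrier W"
        by (rule W.V.M.finsum_closed) (use B[OF cs] in \<open>auto simp: sgn_pow_closed\<close>)
      \<comment> \<open>The remaining face carries the sign of index \<open>Suc (Suc n)\<close>;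
        moved to the other side of the equation it gets that of \<open>Suc n\<close>.\<close>
      have m: "sgn_pow K (Suc (Suc n)) \<odot>\<^bsub>W\<^esub> bottom_counit (val (Suc n) f v cs) =
          \<ominus>\<^bsub>W\<^esub> (sgn_pow K (Suc n) \<odot>\<^bsub>W\<^esub> bottom_counit (val (Suc n) f v cs))"
        unfolding sgn_pow_Suc[of "Suc n"] by (rule W.V.smult_l_minus[OF sgn_pow_closed vc])
      have x: "sgn_pow K (Suc n) \<odot>\<^bsub>W\<^esub> bottom_counit (val (Suc n) f v cs) \<in> carrier W"
        by (intro W.V.smult_closed sgn_pow_closed vc)
      from W.V.M.r_neg2[OF x S] show ?thesis unfolding z[unfolded m, symmetric] W.V.M.r_zero[OF x] ..
    qed

    have bB: "bottom (sgn_pow K i \<odot>\<^bsub>W\<^esub> ?B i cs) (word_prod ds) \<in> carrier (TR 0)"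
      if "i \<le> Suc n" "cs \<in> words A (Suc (Suc n))" "ds \<in> words A (Suc (Suc n))" for i cs ds
      by (intro bottom_closed W.V.smult_closed sgn_pow_closed B wp that) (rule that(3))
    have "val (Suc n) (d_m K A V.FV W.FV n 0 ?g) v xs =
        (\<Oplus>\<^bsub>TR 0\<^esub>i\<in>{..Suc n}. sgn_pow K i \<odot>\<^bsub>TR 0\<^esub> bmap K A V.FV W.FV n 0 i ?g (el (Suc n) as (vten v b)))"
      by (simp add: x(1) d_m_apply[OF g e] del: T.M.finsum_Suc)
    also have "\<dots> = (\<Oplus>\<^bsub>TR 0\<^esub>i\<in>{..Suc n}. sweedler_list K A (TR 0) xs (\<lambda>cs ds.
        bottom (sgn_pow K i \<odot>\<^bsub>W\<^esub> ?B i cs) (word_prod ds)))"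
    proof (rule T.M.finsum_cong'[OF refl])
      show "(\<lambda>i. sweedler_list K A (TR 0) xs (\<lambda>cs ds. bottom (sgn_pow K i \<odot>\<^bsub>W\<^esub> ?B i cs) (word_prod ds)))
          \<in> {..Suc n} \<rightarrow> carrier (TR 0)"
        by (auto intro!: sweedler_list_closed[OF TR_module xs] bB simp del: if_split)
      fix i assume "i \<in> {..Suc n}"
      then have i: "i \<le> Suc n" by simp
      show "sgn_pow K i \<odot>\<^bsub>TR 0\<^esub> bmap K A V.FV W.FV n 0 i ?g (el (Suc n) as (vten v b)) =
          sweedler_list K A (TR 0) xs (\<lambda>cs ds. bottom (sgn_pow K i \<odot>\<^bsub>W\<^esub> ?B i cs) (word_prod ds))"
        unfolding face[OF i]
        by (subst sweedler_list_linear_comp[OF TR_module TR_module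
              linear_map_smult_fun[OF TR_module TR_module linear_map_id sgn_pow_closed] xs],
            rule bottom_closed[OF B[OF _ i] wp], assumption+, rule sweedler_list_cong[OF TR_module xs, symmetric])
          (rule bB[OF i], assumption+, rule linear_mapD(3)[OF bottom_linear(1)[OF wp] sgn_pow_closed B[OF _ i]], assumption+)
    qed
    also have "\<dots> = sweedler_list K A (TR 0) xs (\<lambda>cs ds. \<Oplus>\<^bsub>TR 0\<^esub>i\<in>{..Suc n}. bottom (sgn_pow K i \<odot>\<^bsub>W\<^esub> ?B i cs) (word_prod ds))"
      by (rule sweedler_list_finsum[OF TR_module finite_atMost xs], rule bB) (simp_all only: atMost_iff)
    \<comment> \<open>Linearity of \<open>bottom\<close> in its first argument takes the alternating
      sum inside, where \<open>sum\<close> evaluates it for each \<open>cs\<close>.\<close>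
    also have "\<dots> = sweedler_list K A (TR 0) xs (\<lambda>cs ds. sgn_pow K (Suc n) \<odot>\<^bsub>TR 0\<^esub> bottom (bottom_counit (val (Suc n) f v cs)) (word_prod ds))"
    proof (rule sweedler_list_cong[OF TR_module xs, symmetric])
      fix cs ds assume cd: "cs \<in> words A (Suc (Suc n))" "ds \<in> words A (Suc (Suc n))"
      note lin = bottom_linear(1)[OF wp[OF cd(2)]] and vc = bottom_counit_closed[OF val_closed[OF f v cd(1)]]
      show "sgn_pow K (Suc n) \<odot>\<^bsub>TR 0\<^esub> bottom (bottom_counit (val (Suc n) f v cs)) (word_prod ds) \<in> carrier (TR 0)"
        by (intro T.smult_closed sgn_pow_closed linear_mapD(1)[OF lin vc])
      have "(\<Oplus>\<^bsub>TR 0\<^esub>i\<in>{..Suc n}. bottom (sgn_pow K i \<odot>\<^bsub>W\<^esub> ?B i cs) (word_prod ds)) =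
          bottom (\<Oplus>\<^bsub>W\<^esub>i\<in>{..Suc n}. sgn_pow K i \<odot>\<^bsub>W\<^esub> ?B i cs) (word_prod ds)"
        by (rule linear_map_finsum[OF W.V_module TR_module lin finite_atMost, symmetric],
            rule W.V.smult_closed[OF sgn_pow_closed B[OF cd(1)]]) (simp only: atMost_iff)
      then show "sgn_pow K (Suc n) \<odot>\<^bsub>TR 0\<^esub> bottom (bottom_counit (val (Suc n) f v cs)) (word_prod ds) =
          (\<Oplus>\<^bsub>TR 0\<^esub>i\<in>{..Suc n}. bottom (sgn_pow K i \<odot>\<^bsub>W\<^esub> ?B i cs) (word_prod ds))"
        unfolding sum[OF cd(1)] by (simp only: linear_mapD(3)[OF lin sgn_pow_closed vc])
    qed
    also have "\<dots> = sgn_pow K (Suc n) \<odot>\<^bsub>TR 0\<^esub> val (Suc n) (residue (Suc n) f) v xs"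
      unfolding residue_val[OF f v xs]
      by (rule sweedler_list_linear_comp[OF TR_module TR_module
            linear_map_smult_fun[OF TR_module TR_module linear_map_id sgn_pow_closed] xs, symmetric])
        (intro bottom_closed bottom_counit_closed val_closed[OF f v] wp; assumption)
    also have "\<dots> = val (Suc n) (sgn_pow K (Suc n) \<odot>\<^bsub>C (Suc n) 0\<^esub> residue (Suc n) f) v xs"
      by (simp add: x(1) C_apply e)
    finally show "val (Suc n) (d_m K A V.FV W.FV n 0 ?g) v xs =
        val (Suc n) (sgn_pow K (Suc n) \<odot>\<^bsub>C (Suc n) 0\<^esub> residue (Suc n) f) v xs" .
  qed
qed

end

section \<open>The total complex\<close>

context
  fixes K :: "('k, 'q) ring_scheme" and I :: "'i set" and Y :: "'i \<Rightarrow> ('k, 'y, 's) module_scheme"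
  assumes Y: "\<And>i. i \<in> I \<Longrightarrow> module K (Y i)" and K: "cring K"
begin

lemma prod_module_carrier: "carrier (prod_module I Y) = (\<Pi>\<^sub>E i\<in>I. carrier (Y i))"
  by (simp add: prod_module_def)

lemma prod_module_apply:
  assumes "i \<in> I"
  shows "(F \<oplus>\<^bsub>prod_module I Y\<^esub> G) i = F i \<oplus>\<^bsub>Y i\<^esub> G i" "(k \<odot>\<^bsub>prod_module I Y\<^esub> F) i = k \<odot>\<^bsub>Y i\<^esub> F i"
    "\<zero>\<^bsub>prod_module I Y\<^esub> i = \<zero>\<^bsub>Y i\<^esub>"
  using assms by (simp_all add: prod_module_def)

lemma prod_module_eqI:
  assumes "F \<in> carrier (prod_module I Y)" "G \<in> carrier (prod_module I Y)" "\<And>i. i \<in> I \<Longrightarrow> F i = G i"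
  shows "F = G"
  using assms unfolding prod_module_carrier by (blast intro: PiE_ext)

lemma prod_module_module: "module K (prod_module I Y)"
proof -
  interpret K: cring K by (rule K)
  let ?P = "prod_module I Y"
  have ag: "abelian_group (Y i)" if "i \<in> I" for i using Y[OF that] by (simp add: module_def)
  have sm: "k \<odot>\<^bsub>?P\<^esub> F \<in> carrier ?P" if "k \<in> carrier K" "F \<in> carrier ?P" for k F
    using that by (auto simp: prod_module_def PiE_iff intro: module.smult_closed[OF Y])
  have ad: "F \<oplus>\<^bsub>?P\<^esub> G \<in> carrier ?P" if "F \<in> carrier ?P" "G \<in> carrier ?P" for F G
    using that by (auto simp: prod_module_def PiE_iff intro!: abelian_groupE(1)[OF ag])
  have ze: "\<zero>\<^bsub>?P\<^esub> \<in> carrier ?P"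
    by (auto simp: prod_module_def intro: abelian_groupE(2)[OF ag])
  have cl: "F i \<in> carrier (Y i)" if "F \<in> carrier ?P" "i \<in> I" for F i
    using that by (auto simp: prod_module_carrier)
  note ap = prod_module_apply
  show ?thesis
  proof (rule moduleI[OF K _ sm])
    show "abelian_group ?P"
    proof (rule abelian_groupI[OF ad ze])
      show "F \<oplus>\<^bsub>?P\<^esub> G \<oplus>\<^bsub>?P\<^esub> H = F \<oplus>\<^bsub>?P\<^esub> (G \<oplus>\<^bsub>?P\<^esub> H)"
        if "F \<in> carrier ?P" "G \<in> carrier ?P" "H \<in> carrier ?P" for F G H
        by (rule prod_module_eqI) (simp_all add: ad that ap cl abelian_groupE(3)[OF ag])
      show "F \<oplus>\<^bsub>?P\<^esub> G = G \<oplus>\<^bsub>?P\<^esub> F" if "F \<in> carrier ?P" "G \<in> carrier ?P" for F G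
        by (rule prod_module_eqI) (simp_all add: ad that ap cl abelian_groupE(4)[OF ag])
      show "\<zero>\<^bsub>?P\<^esub> \<oplus>\<^bsub>?P\<^esub> F = F" if "F \<in> carrier ?P" for F
        by (rule prod_module_eqI) (simp_all add: ad ze that ap cl abelian_groupE(5)[OF ag])
      fix F assume F: "F \<in> carrier ?P"
      have "(\<ominus>\<^bsub>K\<^esub> \<one>\<^bsub>K\<^esub>) \<odot>\<^bsub>?P\<^esub> F \<oplus>\<^bsub>?P\<^esub> F = \<zero>\<^bsub>?P\<^esub>"
      proof (rule prod_module_eqI)
        fix i assume i: "i \<in> I"
        interpret Yi: module K "Y i" by (rule Y[OF i])
        show "((\<ominus>\<^bsub>K\<^esub> \<one>\<^bsub>K\<^esub>) \<odot>\<^bsub>?P\<^esub> F \<oplus>\<^bsub>?P\<^esub> F) i = \<zero>\<^bsub>?P\<^esub> i"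
          by (simp add: ap i cl[OF F i] Yi.smult_l_minus Yi.M.l_neg)
      qed (simp_all add: ad sm ze F)
      then show "\<exists>G\<in>carrier ?P. G \<oplus>\<^bsub>?P\<^esub> F = \<zero>\<^bsub>?P\<^esub>" using sm F by blast
    qed
    show "(k \<oplus>\<^bsub>K\<^esub> l) \<odot>\<^bsub>?P\<^esub> F = k \<odot>\<^bsub>?P\<^esub> F \<oplus>\<^bsub>?P\<^esub> l \<odot>\<^bsub>?P\<^esub> F"
      if "k \<in> carrier K" "l \<in> carrier K" "F \<in> carrier ?P" for k l F
      by (rule prod_module_eqI) (simp_all add: ad sm that ap cl module.smult_l_distr[OF Y])
    show "k \<odot>\<^bsub>?P\<^esub> (F \<oplus>\<^bsub>?P\<^esub> G) = k \<odot>\<^bsub>?P\<^esub> F \<oplus>\<^bsub>?P\<^esub> k \<odot>\<^bsub>?P\<^esub> G"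
      if "k \<in> carrier K" "F \<in> carrier ?P" "G \<in> carrier ?P" for k F G
      by (rule prod_module_eqI) (simp_all add: ad sm that ap cl module.smult_r_distr[OF Y])
    show "(k \<otimes>\<^bsub>K\<^esub> l) \<odot>\<^bsub>?P\<^esub> F = k \<odot>\<^bsub>?P\<^esub> (l \<odot>\<^bsub>?P\<^esub> F)"
      if "k \<in> carrier K" "l \<in> carrier K" "F \<in> carrier ?P" for k l F
      by (rule prod_module_eqI) (simp_all add: sm that ap cl module.smult_assoc1[OF Y])
    show "\<one>\<^bsub>K\<^esub> \<odot>\<^bsub>?P\<^esub> F = F" if "F \<in> carrier ?P" for F
      by (rule prod_module_eqI) (simp_all add: sm that ap cl module.smult_one[OF Y])
  qed
qed

lemma prod_module_proj_linear: "i \<in> I \<Longrightarrow> linear_map K (prod_module I Y) (Y i) (\<lambda>F. F i)"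
  by (rule linear_mapI) (auto simp: prod_module_apply prod_module_carrier)

lemma prod_module_tuple_linear:
  assumes "module K X" "\<And>i. i \<in> I \<Longrightarrow> linear_map K X (Y i) (f i)"
  shows "linear_map K X (prod_module I Y) (\<lambda>x. \<lambda>i\<in>I. f i x)"
  by (rule linear_mapI)
    (use linear_mapD[OF assms(2)] in \<open>auto simp: prod_module_def intro!: restrict_ext\<close>)

end

context hopf_pair
begin

abbreviation "Tot r \<equiv> total K A M N r"

lemma Tot_module: "module K (Tot r)"
  unfolding total_def by (rule prod_module_module[OF C_module K.is_cring])

lemma Tot_carrier: "carrier (Tot r) = (\<Pi>\<^sub>E n\<in>{..r}. carrier (C n (r - n)))"
  unfolding total_def by (rule prod_module_carrier[OF C_module K.is_cring])

lemma Tot_closed: "F \<in> carrier (Tot r) \<Longrightarrow> n \<le> r \<Longrightarrow> F n \<in> carrier (C n (r - n))"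
  by (auto simp: Tot_carrier)

lemma Tot_proj_linear: "n \<le> r \<Longrightarrow> linear_map K (Tot r) (C n (r - n)) (\<lambda>F. F n)"
  unfolding total_def by (rule prod_module_proj_linear[OF C_module K.is_cring]) simp

lemma total_d_linear: "linear_map K (Tot r) (Tot (Suc r)) (total_d K A M N r)"
  unfolding total_d_def[abs_def] total_def[of _ _ _ _ "Suc r"]
proof (rule prod_module_tuple_linear[OF C_module K.is_cring Tot_module],
    rule linear_map_add_fun[OF Tot_module C_module])
  fix n assume "n \<in> {..Suc r}"
  then have n: "n \<le> Suc r" by simp
  show "linear_map K (Tot r) (C n (Suc r - n))
      (\<lambda>F. if n = 0 then \<zero>\<^bsub>C n (Suc r - n)\<^esub> else d_m K A M N (n - 1) (Suc r - n) (F (n - 1)))"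
  proof (cases n)
    case 0
    then show ?thesis using linear_map_zero_fun[OF Tot_module C_module] by simp
  next
    case (Suc k)
    then show ?thesis using linear_map_comp[OF Tot_proj_linear d_m_linear, of k r] n by simp
  qed
  show "linear_map K (Tot r) (C n (Suc r - n))
      (\<lambda>F. if n = Suc r then \<zero>\<^bsub>C n (Suc r - n)\<^esub>
        else sgn_pow K n \<odot>\<^bsub>C n (Suc r - n)\<^esub> d_c K A M N n (r - n) (F n))"
  proof (cases "n = Suc r")
    case True
    then show ?thesis using linear_map_zero_fun[OF Tot_module C_module] by simp
  next
    case False
    then have n: "n \<le> r" using n by simp
    \<comment> \<open>Subtraction is truncated; \<open>n \<le> r\<close> makes the index match the
      target of \<open>d_c n (r - n)\<close>.\<close>
    then have "Suc r - n = Suc (r - n)" by simp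
    then show ?thesis using False
      linear_map_smult_fun[OF Tot_module C_module linear_map_comp[OF Tot_proj_linear[OF n] d_c_linear] sgn_pow_closed]
      by simp
  qed
qed

end

text \<open>Translation by an element of the image maps the image onto itself, so the coset of any
  element of \<open>Z\<close> is the image, the zero of the quotient. That \<open>Z\<close> is
  nonempty provides a coset.\<close>

lemma quot_module_trivial:
  assumes "module K X" "module K Y" "linear_map K X Y D" "Z \<subseteq> D ` carrier X" "Z \<noteq> {}"
  shows "carrier (quot_module (Y\<lparr>carrier := Z\<rparr>) (D ` carrier X)) =
    {\<zero>\<^bsub>quot_module (Y\<lparr>carrier := Z\<rparr>) (D ` carrier X)\<^esub>}"
proof -
  interpret X: module K X by fact
  interpret Y: module K Y by fact
  note D = linear_mapD[OF assms(3)]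
  have "D ` carrier X +>\<^bsub>Y\<lparr>carrier := Z\<rparr>\<^esub> z = D ` carrier X" if z: "z \<in> Z" for z
  proof -
    obtain x where x: "x \<in> carrier X" "z = D x" using z assms(4) by blast
    have "(\<lambda>h. h \<oplus>\<^bsub>Y\<^esub> z) ` D ` carrier X = D ` carrier X"
    proof (intro equalityI subsetI)
      fix y assume "y \<in> (\<lambda>h. h \<oplus>\<^bsub>Y\<^esub> z) ` D ` carrier X"
      then obtain u where "u \<in> carrier X" "y = D u \<oplus>\<^bsub>Y\<^esub> D x" using x(2) by blast
      then show "y \<in> D ` carrier X" using D(2)[of u x] x(1) by (auto intro!: image_eqI[of _ _ "u \<oplus>\<^bsub>X\<^esub> x"])
    next
      fix y assume "y \<in> D ` carrier X"
      then obtain u where u: "u \<in> carrier X" "y = D u" by blast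
      have "D (u \<ominus>\<^bsub>X\<^esub> x) \<oplus>\<^bsub>Y\<^esub> z = y"
        unfolding linear_map_minus[OF assms(1-3) u(1) x(1)] u(2) x(2)
        using u(1) x(1) D(1) by (simp add: a_minus_def Y.M.a_assoc Y.M.l_neg)
      moreover have "u \<ominus>\<^bsub>X\<^esub> x \<in> carrier X" using u x by (simp add: X.M.minus_closed)
      ultimately show "y \<in> (\<lambda>h. h \<oplus>\<^bsub>Y\<^esub> z) ` D ` carrier X" by (metis image_eqI)
    qed
    then show ?thesis by (auto simp: a_r_coset_def')
  qed
  moreover have "\<zero>\<^bsub>quot_module (Y\<lparr>carrier := Z\<rparr>) (D ` carrier X)\<^esub> = D ` carrier X" by (simp add: quot_module_def)
  ultimately show ?thesis unfolding quot_module_carrier using assms(5) by auto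
qed

section \<open>Primitives of cocycles in positive degree\<close>

context free_pair
begin

text \<open>Signs square to one, so the sign of index \<open>Suc k\<close> on \<open>Q\<close> turns
  into that of index \<open>k\<close> on \<open>P\<close>. This solves a component of the cocycle
  condition for its \<open>d_m\<close> part.\<close>

lemma sgn_pow_cancel:
  assumes "module K X" "P \<in> carrier X" "Q \<in> carrier X" "P \<oplus>\<^bsub>X\<^esub> sgn_pow K (Suc k) \<odot>\<^bsub>X\<^esub> Q = \<zero>\<^bsub>X\<^esub>"
  shows "sgn_pow K k \<odot>\<^bsub>X\<^esub> P = Q"
proof -
  interpret X: module K X by fact
  note s = sgn_pow_closed
  have "P = sgn_pow K k \<odot>\<^bsub>X\<^esub> Q"
    using assms(2-4) X.M.minus_equality[of P "sgn_pow K (Suc k) \<odot>\<^bsub>X\<^esub> Q"]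
    by (simp add: sgn_pow_Suc X.smult_l_minus s)
  then show ?thesis by (simp add: s assms(3) sgn_pow_square flip: X.smult_assoc1)
qed

text \<open>In an inner component \<open>n\<close> the differential of \<open>G\<close> has the
  \<open>d_m\<close> part \<open>\<sigma> d_c F_n\<close>, by the cocycle condition, and the
  \<open>d_c\<close> part \<open>F_n - \<sigma> d_c F_n\<close>, by the homotopy formula. Only the
  two ends of the range behave differently.\<close>

lemma cocycle_primitive:
  assumes F: "F \<in> carrier (Tot (Suc q))"
    and d: "total_d K A V.FV W.FV (Suc q) F = \<zero>\<^bsub>Tot (Suc (Suc q))\<^esub>"
  shows "\<exists>G\<in>carrier (Tot q). total_d K A V.FV W.FV q G = F"
proof -
  let ?dm = "d_m K A V.FV W.FV" and ?dc = "d_c K A V.FV W.FV"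
  note s = sgn_pow_closed
  have dn: "total_d K A V.FV W.FV (Suc q) F n = \<zero>\<^bsub>C n (Suc (Suc q) - n)\<^esub>" if "n \<le> Suc (Suc q)" for n
    unfolding d total_def by (rule prod_module_apply(3)[OF C_module K.is_cring]) (use that in simp)
  have Fc: "F n \<in> carrier (C n (Suc (q - n)))" if "n \<le> q" for n
    using Tot_closed[OF F, of n] that by (simp add: Suc_diff_le)
  have Fr: "F (Suc q) \<in> carrier (C (Suc q) 0)" using Tot_closed[OF F, of "Suc q"] by simp
  have d0: "?dc 0 (Suc q) (F 0) = \<zero>\<^bsub>C 0 (Suc (Suc q))\<^esub>"
  proof -
    interpret C: module K "C 0 (Suc (Suc q))" by (rule C_module)
    show ?thesis using dn[of 0] linear_mapD(1)[OF d_c_linear Fc[of 0]] by (simp add: total_d_def sgn_pow_0)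
  qed
  have dk: "?dm k (Suc (q - k)) (F k) \<oplus>\<^bsub>C (Suc k) (Suc (q - k))\<^esub>
      sgn_pow K (Suc k) \<odot>\<^bsub>C (Suc k) (Suc (q - k))\<^esub> ?dc (Suc k) (q - k) (F (Suc k)) = \<zero>\<^bsub>C (Suc k) (Suc (q - k))\<^esub>"
    if "k \<le> q" for k
    using dn[of "Suc k"] that by (simp add: total_d_def Suc_diff_le)
  have dr: "?dm (Suc q) 0 (F (Suc q)) = \<zero>\<^bsub>C (Suc (Suc q)) 0\<^esub>"
  proof -
    interpret C: module K "C (Suc (Suc q)) 0" by (rule C_module)
    show ?thesis using dn[of "Suc (Suc q)"] linear_mapD(1)[OF d_m_linear Fr] by (simp add: total_d_def)
  qed
  let ?Q = "\<lambda>k. contr (Suc k) (q - k) (?dc (Suc k) (q - k) (F (Suc k)))"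
  \<comment> \<open>\<sigma> is applied to component \<open>Suc k\<close> of the cocycle condition
    and then moved past \<open>d_m\<close>.\<close>
  have cd: "sgn_pow K k \<odot>\<^bsub>C (Suc k) (q - k)\<^esub> ?dm k (q - k) (contr k (q - k) (F k)) = ?Q k" if k: "k \<le> q" for k
  proof -
    have c: "F (Suc k) \<in> carrier (C (Suc k) (q - k))"
      using Tot_closed[OF F, of "Suc k"] k by simp
    interpret C: module K "C (Suc k) (Suc (q - k))" by (rule C_module)
    interpret C': module K "C (Suc k) (q - k)" by (rule C_module)
    note a = linear_mapD(1)[OF d_m_linear Fc[OF k]] and b = linear_mapD(1)[OF d_c_linear c]
    have "contr (Suc k) (q - k) (?dm k (Suc (q - k)) (F k)) \<oplus>\<^bsub>C (Suc k) (q - k)\<^esub>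
        sgn_pow K (Suc k) \<odot>\<^bsub>C (Suc k) (q - k)\<^esub> ?Q k = \<zero>\<^bsub>C (Suc k) (q - k)\<^esub>"
      using arg_cong[OF dk[OF k], of "contr (Suc k) (q - k)"] a b
      by (simp add: linear_mapD[OF contr_linear] s linear_map_zero[OF C_module C_module contr_linear])
    then have "sgn_pow K k \<odot>\<^bsub>C (Suc k) (q - k)\<^esub> contr (Suc k) (q - k) (?dm k (Suc (q - k)) (F k)) = ?Q k"
      by (rule sgn_pow_cancel[OF C_module contr_closed[OF a] contr_closed[OF b]])
    then show ?thesis by (simp only: contr_d_m[OF Fc[OF k]])
  qed
  \<comment> \<open>The sign is its own inverse and cancels the one in
    \<open>d_m_residue_shift\<close>, so that \<open>d_m\<close> of \<open>z\<close> is exactly the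
    residue of \<open>F (Suc q)\<close>.\<close>
  define z where "z = sgn_pow K (Suc q) \<odot>\<^bsub>C q 0\<^esub> residue q (shift q 0 (F (Suc q)))"
  note rs = residue_closed[OF shift_closed[OF Fr]]
  interpret Cq: module K "C q 0" by (rule C_module)
  interpret Cr: module K "C (Suc q) 0" by (rule C_module)
  have z: "z \<in> carrier (C q 0)" unfolding z_def by (intro Cq.smult_closed s rs)
  \<comment> \<open>Since \<open>d_c\<close> kills \<open>z\<close>, the correction leaves component
    \<open>q\<close> of the differential unchanged and shows only in component
    \<open>Suc q\<close>.\<close>
  have zc: "?dc q 0 z = \<zero>\<^bsub>C q (Suc 0)\<^esub>"
  proof -
    interpret C: module K "C q (Suc 0)" by (rule C_module)
    show ?thesis by (simp add: z_def linear_mapD(3)[OF d_c_linear] s rs residue_cocycle[OF shift_closed[OF Fr]])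
  qed
  have zm: "?dm q 0 z = residue (Suc q) (F (Suc q))"
    by (simp add: z_def linear_mapD(3)[OF d_m_linear] s rs d_m_residue_shift[OF Fr dr] residue_closed[OF Fr]
      sgn_pow_square flip: Cr.smult_assoc1)
  define G where "G = (\<lambda>n\<in>{..q}. sgn_pow K n \<odot>\<^bsub>C n (q - n)\<^esub> contr n (q - n) (F n)
    \<oplus>\<^bsub>C n (q - n)\<^esub> (if n = q then z else \<zero>\<^bsub>C n (q - n)\<^esub>))"
  have Gc: "G n \<in> carrier (C n (q - n))" if n: "n \<le> q" for n
  proof -
    interpret C: module K "C n (q - n)" by (rule C_module)
    show ?thesis using n contr_closed[OF Fc[OF n]] z by (auto simp: G_def s)
  qed
  have G: "G \<in> carrier (Tot q)" unfolding Tot_carrier using Gc by (auto simp: G_def)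
  have Glt: "G n = sgn_pow K n \<odot>\<^bsub>C n (q - n)\<^esub> contr n (q - n) (F n)" if n: "n < q" for n
  proof -
    interpret C: module K "C n (q - n)" by (rule C_module)
    show ?thesis using n contr_closed[OF Fc[of n]] by (simp add: G_def s)
  qed
  \<comment> \<open>The sign in \<open>G n\<close> meets the sign of the total differential, and
    what is left is \<open>d_c \<sigma> F_n\<close>.\<close>
  have Gdc: "sgn_pow K n \<odot>\<^bsub>C n (Suc (q - n))\<^esub> ?dc n (q - n) (G n) =
      F n \<ominus>\<^bsub>C n (Suc (q - n))\<^esub> contr n (Suc (q - n)) (?dc n (Suc (q - n)) (F n))" if n: "n \<le> q" for n
  proof -
    interpret C: module K "C n (q - n)" by (rule C_module)
    interpret C': module K "C n (Suc (q - n))" by (rule C_module)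
    note h = contr_closed[OF Fc[OF n]]
    note D = linear_mapD[OF d_c_linear[of n "q - n"]]
    have zz: "(if n = q then z else \<zero>\<^bsub>C n (q - n)\<^esub>) \<in> carrier (C n (q - n))"
      "?dc n (q - n) (if n = q then z else \<zero>\<^bsub>C n (q - n)\<^esub>) = \<zero>\<^bsub>C n (Suc (q - n))\<^esub>"
      using z zc linear_map_zero[OF C_module C_module d_c_linear] by auto
    have "?dc n (q - n) (G n) = sgn_pow K n \<odot>\<^bsub>C n (Suc (q - n))\<^esub> ?dc n (q - n) (contr n (q - n) (F n))"
      using n D(2)[OF C.smult_closed[OF s h] zz(1)] D(1)[OF h] by (simp add: G_def D(3) s h zz(2) del: if_split)
    then have "sgn_pow K n \<odot>\<^bsub>C n (Suc (q - n))\<^esub> ?dc n (q - n) (G n) = ?dc n (q - n) (contr n (q - n) (F n))"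
      by (simp add: s D(1)[OF h] sgn_pow_square flip: C'.smult_assoc1)
    moreover have "?dc n (q - n) (contr n (q - n) (F n)) =
        F n \<ominus>\<^bsub>C n (Suc (q - n))\<^esub> contr n (Suc (q - n)) (?dc n (Suc (q - n)) (F n))"
    proof -
      note b = contr_closed[OF linear_mapD(1)[OF d_c_linear Fc[OF n]]]
      show ?thesis unfolding contr_d_c_Suc[OF Fc[OF n]] using Fc[OF n] D(1)[OF h]
        by (simp add: a_minus_def C'.M.minus_add C'.M.r_neg2)
    qed
    ultimately show ?thesis by simp
  qed
  have "total_d K A V.FV W.FV q G = F"
  proof (rule PiE_ext)
    show "total_d K A V.FV W.FV q G \<in> (\<Pi>\<^sub>E n\<in>{..Suc q}. carrier (C n (Suc q - n)))"
      using linear_mapD(1)[OF total_d_linear G] by (simp add: Tot_carrier)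
    show "F \<in> (\<Pi>\<^sub>E n\<in>{..Suc q}. carrier (C n (Suc q - n)))" using F by (simp add: Tot_carrier)
    fix n assume "n \<in> {..Suc q}"
    then consider "n = 0" | k where "n = Suc k" "k < q" | "n = Suc q" by (cases n) force+
    then show "total_d K A V.FV W.FV q G n = F n"
    proof cases
      \<comment> \<open>There is no \<open>d_m\<close> part here; instead the cocycle condition in
        component 0 says \<open>d_c (F 0) = 0\<close>, so the term \<open>\<sigma> d_c F_0\<close>
        vanishes.\<close>
      case 1
      interpret C: module K "C 0 (Suc q)" by (rule C_module)
      have "contr 0 (Suc q) (?dc 0 (Suc q) (F 0)) = \<zero>\<^bsub>C 0 (Suc q)\<^esub>"
        unfolding d0 by (rule linear_map_zero[OF C_module C_module contr_linear])
      then show ?thesis using Gdc[of 0] Fc[of 0] by (simp add: total_d_def 1 a_minus_def)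
    next
      case 2
      interpret C: module K "C (Suc k) (q - k)" by (rule C_module)
      have e: "Suc (q - Suc k) = q - k" using 2 by simp
      note c = Fc[of "Suc k", unfolded e] and h = contr_closed[OF Fc[of k]]
      have Qc: "?Q k \<in> carrier (C (Suc k) (q - k))"
        using 2 by (intro contr_closed linear_mapD(1)[OF d_c_linear] c) simp
      have "?dm k (q - k) (G k) = ?Q k"
        using 2 cd[of k] by (simp add: Glt linear_mapD(3)[OF d_m_linear] s h)
      moreover have "sgn_pow K (Suc k) \<odot>\<^bsub>C (Suc k) (q - k)\<^esub> ?dc (Suc k) (q - Suc k) (G (Suc k)) =
          F (Suc k) \<ominus>\<^bsub>C (Suc k) (q - k)\<^esub> ?Q k"
        using Gdc[of "Suc k", unfolded e] 2 by simp
      ultimately show ?thesis using 2 c Qc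
        by (simp add: total_d_def a_minus_def C.M.a_lcomm C.M.r_neg)
    next
      \<comment> \<open>There is no \<open>d_c\<close> part here. \<open>F (Suc q)\<close> has
        comodule degree 0, so \<open>\<sigma> d_c\<close> returns it only up to its residue, which
        \<open>z\<close> supplies.\<close>
      case 3
      note h = contr_closed[OF Fc[of q], simplified] and R = residue_closed[OF Fr]
      have "?dm q 0 (G q) = sgn_pow K q \<odot>\<^bsub>C (Suc q) 0\<^esub> ?dm q 0 (contr q 0 (F q)) \<oplus>\<^bsub>C (Suc q) 0\<^esub> residue (Suc q) (F (Suc q))"
        by (simp add: G_def linear_mapD(2,3)[OF d_m_linear] s h z zm)
      also have "sgn_pow K q \<odot>\<^bsub>C (Suc q) 0\<^esub> ?dm q 0 (contr q 0 (F q)) = F (Suc q) \<ominus>\<^bsub>C (Suc q) 0\<^esub> residue (Suc q) (F (Suc q))"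
        using cd[of q] contr_d_c_0[OF Fr] by simp
      also have "\<dots> \<oplus>\<^bsub>C (Suc q) 0\<^esub> residue (Suc q) (F (Suc q)) = F (Suc q)"
        using Fr R by (simp add: a_minus_def Cr.M.a_assoc Cr.M.l_neg)
      finally show ?thesis using Fr by (simp add: total_d_def 3)
    qed
  qed
  then show ?thesis using G by blast
qed

lemma cohomology_trivial:
  "carrier (cohomology K A V.FV W.FV (Suc q)) = {\<zero>\<^bsub>cohomology K A V.FV W.FV (Suc q)\<^esub>}"
proof -
  interpret T: module K "Tot (Suc q)" by (rule Tot_module)
  have "cocycles K A V.FV W.FV (Suc q) \<subseteq> total_d K A V.FV W.FV q ` carrier (Tot q)"
    unfolding cocycles_def using cocycle_primitive by blast
  \<comment> \<open>The zero cochain is a cocycle, so the quotient is not empty.\<close>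
  moreover have "\<zero>\<^bsub>Tot (Suc q)\<^esub> \<in> cocycles K A V.FV W.FV (Suc q)"
    by (simp add: cocycles_def linear_map_zero[OF Tot_module Tot_module total_d_linear])
  ultimately show ?thesis
    unfolding cohomology_def coboundaries_def nat.case
    by (intro quot_module_trivial[OF Tot_module Tot_module total_d_linear]) auto
qed

end

theorem proposition5:
  fixes K :: "('k, 'q) ring_scheme"
    and A :: "('k, 'a, 'r) bialg_scheme"
    and V :: "('k, 'v, 's) module_scheme"
    and W :: "('k, 'w, 't) module_scheme"
  assumes "field K"
    and "bialgebra K A"
    and "module K V"
    and "module K W"
  shows "\<forall>p. carrier (cohomology K A (free_hmod K V A) (free_hmod K W A) (Suc p)) =
    {\<zero>\<^bsub>cohomology K A (free_hmod K V A) (free_hmod K W A) (Suc p)\<^esub>}"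
proof -
  interpret free_pair K A V W
    using assms by (simp add: free_pair_def hopf_setup_def)
  show ?thesis by (intro allI cohomology_trivial)
qed

end
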